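(* Let $Q>1$. Let $X=(X,d,\mu)$ be a proper, quasiconvex, $Q$-Ahlfors regular metric measure space supporting a weak $(1,Q)$-Poincar\'e inequality, and let $Y=(Y,d',\nu)$ be a pathwise connected, $Q$-Ahlfors regular, locally compact and linearly locally connected metric measure space. Assume that $X$ and $Y$ are either both bounded or both unbounded. Suppose that $\varphi:X\to Y$ is a homeomorphism such that the mapping $f\mapsto f\circ\varphi$ induced by $\varphi$ is bounded from $\dot{B}^s_{Q/s,q}(Y)$ to $\dot{B}^s_{Q/s,q}(X)$ for some $0<s<1$ and $1<q<\infty$ with $q\neq Q/s$. Suppose also that $\varphi$ maps bounded sets onto bounded sets. Then $\varphi$ is bi-Lipschitz.
   Context: All measures are Borel regular. A metric space is proper if closed balls are compact; quasiconvex if there is $C$ such that any two points $x,y$ can be joined by a curve of length at most $C\,d(x,y)$. $(X,d,\mu)$ is $Q$-Ahlfors regular if there is $C\ge1$ with $C^{-1}r^Q\le\mu(B(x,r))\le Cr^Q$ for all $x\in X$, $0<r<\operatorname{diam}X$. $Y$ is linearly locally connected if there is $C\ge1$ such that for all $y\in Y$, $r>0$: any two points of $B(y,r)$ can be joined by a continuum in $B(y,Cr)$, and any two points of $Y\setminus\overline{B}(y,r)$ can be joined by a continuum in $Y\setminus\overline{B}(y,r/C)$. $X$ supports a weak $(1,p)$-Poincar\'e inequality if there are $C,\tau\ge1$ such that $\frac1{\mu(B)}\int_B|u-u_B|\,d\mu\le C\operatorname{diam}(B)\left(\frac1{\mu(\tau B)}\int_{\tau B}\rho^p\,d\mu\right)^{1/p}$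 for all balls $B$, all bounded continuous functions $u$ on $\tau B$ and all upper gradients $\rho$ of $u$, where $u_B=\frac{1}{\mu(B)}\int_Bu\,d\mu$. For $0<s<1$, $1\le p,q<\infty$ and measurable $f$ on $X$, $$\|f\|_{\dot{B}^s_{p,q}(X)}=\left(\int_0^\infty\left[t^{-s}\left(\int_X\frac1{\mu(B(x,t))}\int_{B(x,t)}|f(x)-f(y)|^p\,d\mu(y)\,d\mu(x)\right)^{1/p}\right]^q\frac{dt}{t}\right)^{1/q},$$ and $\dot{B}^s_{p,q}(X)$ is the space of functions (modulo a.e. constants) with finite norm; similarly for $Y$. "The mapping induced by $\varphi$ is bounded from $\dot{B}^s_{p,q}(Y)$ to $\dot{B}^s_{p,q}(X)$" means: there is $C$ such that $\|f\circ\varphi\|_{\dot{B}^s_{p,q}(X)}\le C\|f\|_{\dot{B}^s_{p,q}(Y)}$ for every continuous $f\in\dot{B}^s_{p,q}(Y)$. "Maps bounded sets onto bounded sets" means that images of bounded sets are bounded. $\varphi$ is bi-Lipschitz if there is $L\ge1$ with $L^{-1}d(x,y)\le d'(\varphi(x),\varphi(y))\le L\,d(x,y)$ for all $x,y\in X$. *)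

theory Defs
  imports "HOL-Analysis.Analysis"
begin

(* Conventions.  A metric space is a type of class metric_space.  A Borel regular (outer) measure is
   determined by its restriction to the Borel sets, and every Borel measure arises in this way; so a
   Borel regular measure is a measure M with  sets M = sets borel. *)

(* Real powers of [0,\<infinity>]-valued quantities; only used with exponent a > 0. *)
definition ennpow :: "ennreal \<Rightarrow> real \<Rightarrow> ennreal" where
  "ennpow x a = (if x = \<infinity> then \<infinity> else ennreal (enn2real x powr a))"


subsection \<open>Curves and upper gradients\<close>

definition curve_length :: "(real \<Rightarrow> 'a::metric_space) \<Rightarrow> real \<Rightarrow> real \<Rightarrow> ennreal" where
  "curve_length g a b =
     (SUP (n, t) \<in> {(n::nat, t::nat \<Rightarrow> real). mono_on {..n} t \<and> t ` {..n} \<subseteq> {a..b}}.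
        \<Sum>i<n. ennreal (dist (g (t i)) (g (t (Suc i)))))"

definition rectifiable :: "(real \<Rightarrow> 'a::metric_space) \<Rightarrow> bool" where
  "rectifiable g \<longleftrightarrow> path g \<and> curve_length g 0 1 < \<infinity>"

(* For a rectifiable g and 0 \<le> l \<le> length of g, a parameter u with length of g on [0,u] equal to l
   exists, and g takes the same value at all such u; so the choice is immaterial. *)
definition arclength_param :: "(real \<Rightarrow> 'a::metric_space) \<Rightarrow> real \<Rightarrow> 'a" where
  "arclength_param g l = g (SOME u. u \<in> {0..1} \<and> curve_length g 0 u = ennreal l)"

definition line_integral :: "(real \<Rightarrow> 'a::metric_space) \<Rightarrow> ('a \<Rightarrow> ennreal) \<Rightarrow> ennreal" where
  "line_integral g \<rho> =
     (\<integral>\<^sup>+l\<in>{0..enn2real (curve_length g 0 1)}. \<rho> (arclength_param g l) \<partial>lborel)"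

(* \<rho> is an upper gradient of u in the metric subspace S; values outside S play no role. *)
definition upper_gradient_on ::
    "'a::metric_space set \<Rightarrow> ('a \<Rightarrow> real) \<Rightarrow> ('a \<Rightarrow> ennreal) \<Rightarrow> bool" where
  "upper_gradient_on S u \<rho> \<longleftrightarrow>
     \<rho> \<in> borel_measurable (restrict_space borel S) \<and>
     (\<forall>g. rectifiable g \<and> path_image g \<subseteq> S \<longrightarrow>
        ennreal \<bar>u (pathstart g) - u (pathfinish g)\<bar> \<le> line_integral g \<rho>)"


subsection \<open>Metric measure spaces\<close>

definition proper_metric :: "'a::metric_space itself \<Rightarrow> bool" where
  "proper_metric _ \<longleftrightarrow> (\<forall>(x::'a) r. compact (cball x r))"

definition quasiconvex :: "'a::metric_space itself \<Rightarrow> bool" where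
  "quasiconvex _ \<longleftrightarrow>
     (\<exists>C\<ge>0. \<forall>x y :: 'a. \<exists>g. path g \<and> pathstart g = x \<and> pathfinish g = y \<and>
        curve_length g 0 1 \<le> ennreal (C * dist x y))"

(* diam X = \<infinity> for unbounded X, whereas the library's diameter is unspecified there. *)
definition ahlfors_regular :: "real \<Rightarrow> 'a::metric_space measure \<Rightarrow> bool" where
  "ahlfors_regular Q M \<longleftrightarrow>
     (\<exists>C\<ge>1. \<forall>x r. 0 < r \<and> (bounded (UNIV :: 'a set) \<longrightarrow> r < diameter (UNIV :: 'a set)) \<longrightarrow>
        ennreal (r powr Q / C) \<le> emeasure M (ball x r) \<and>
        emeasure M (ball x r) \<le> ennreal (C * r powr Q))"

definition continuum :: "'a::topological_space set \<Rightarrow> bool" where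
  "continuum K \<longleftrightarrow> K \<noteq> {} \<and> compact K \<and> connected K"

definition linearly_locally_connected :: "'a::metric_space itself \<Rightarrow> bool" where
  "linearly_locally_connected _ \<longleftrightarrow>
     (\<exists>C\<ge>1. \<forall>(y::'a) r. 0 < r \<longrightarrow>
        (\<forall>u\<in>ball y r. \<forall>v\<in>ball y r.
           \<exists>K. continuum K \<and> u \<in> K \<and> v \<in> K \<and> K \<subseteq> ball y (C * r)) \<and>
        (\<forall>u\<in>- cball y r. \<forall>v\<in>- cball y r.
           \<exists>K. continuum K \<and> u \<in> K \<and> v \<in> K \<and> K \<subseteq> - cball y (r / C)))"

definition mean_on :: "'a measure \<Rightarrow> 'a set \<Rightarrow> ('a \<Rightarrow> real) \<Rightarrow> real" where
  "mean_on M B u = (LINT x:B|M. u x) / measure M B"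

definition weak_poincare :: "real \<Rightarrow> 'a::metric_space measure \<Rightarrow> bool" where
  "weak_poincare p M \<longleftrightarrow>
     (\<exists>C\<ge>1. \<exists>\<tau>\<ge>1. \<forall>x r u \<rho>.
        0 < r \<and> continuous_on (ball x (\<tau> * r)) u \<and> bounded (u ` ball x (\<tau> * r)) \<and>
        upper_gradient_on (ball x (\<tau> * r)) u \<rho> \<longrightarrow>
        (\<integral>\<^sup>+y\<in>ball x r. ennreal \<bar>u y - mean_on M (ball x r) u\<bar> \<partial>M) / emeasure M (ball x r)
        \<le> ennreal (C * diameter (ball x r)) *
           ennpow ((\<integral>\<^sup>+y\<in>ball x (\<tau> * r). ennpow (\<rho> y) p \<partial>M) / emeasure M (ball x (\<tau> * r)))
             (1 / p))"


subsection \<open>Besov spaces\<close>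

definition besov_norm ::
    "'a::metric_space measure \<Rightarrow> real \<Rightarrow> real \<Rightarrow> real \<Rightarrow> ('a \<Rightarrow> real) \<Rightarrow> ennreal" where
  "besov_norm M s p q f =
     ennpow
       (\<integral>\<^sup>+t\<in>{0<..}.
          ennpow
            (ennreal (t powr - s) *
             ennpow
               (\<integral>\<^sup>+x. (\<integral>\<^sup>+y\<in>ball x t. ennreal (\<bar>f x - f y\<bar> powr p) \<partial>M) / emeasure M (ball x t) \<partial>M)
               (1 / p))
            q / ennreal t \<partial>lborel)
       (1 / q)"

(* Given by representatives: the norm is invariant under a.e. changes and adding constants, and
   every function measurable for the completion of M agrees a.e. with a Borel one. *)
definition besov_space ::
    "'a::metric_space measure \<Rightarrow> real \<Rightarrow> real \<Rightarrow> real \<Rightarrow> ('a \<Rightarrow> real) set" where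
  "besov_space M s p q = {f \<in> borel_measurable M. besov_norm M s p q f < \<infinity>}"

definition induced_map_bounded ::
    "'a::metric_space measure \<Rightarrow> 'b::metric_space measure \<Rightarrow> real \<Rightarrow> real \<Rightarrow> real \<Rightarrow> ('a \<Rightarrow> 'b) \<Rightarrow> bool"
  where
  "induced_map_bounded M N s p q \<phi> \<longleftrightarrow>
     (\<exists>C\<ge>0. \<forall>f \<in> besov_space N s p q. continuous_on UNIV f \<longrightarrow>
        besov_norm M s p q (f \<circ> \<phi>) \<le> ennreal C * besov_norm N s p q f)"

definition bi_lipschitz :: "('a::metric_space \<Rightarrow> 'b::metric_space) \<Rightarrow> bool" where
  "bi_lipschitz \<phi> \<longleftrightarrow>
     (\<exists>L\<ge>1. \<forall>x y. dist x y / L \<le> dist (\<phi> x) (\<phi> y) \<and> dist (\<phi> x) (\<phi> y) \<le> L * dist x y)"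

end

theory Submission
  imports Defs
begin

text \<open>Put \<open>p = Q / s\<close> and write \<open>E f t\<close> for the double integral at scale \<open>t\<close>, so that the \<open>q\<close>-th
  power of the Besov norm is the integral of \<open>(E f t / t powr Q) powr (q / p)\<close> against \<open>dt / t\<close>. For a
  bump at scale \<open>\<tau>\<close> the integrand is concentrated at \<open>t \<approx> \<tau>\<close>. Hence \<open>n\<close> bumps at lacunary scales have
  norm to the power \<open>q\<close> of order \<open>n\<close>, whereas \<open>n\<close> disjoint bumps at one scale give order \<open>n powr (q / p)\<close>.

  An average of \<open>n\<close> concentric bumps at dyadic scales has norm of order \<open>n powr (1 / q - 1)\<close>, while any function
  separating two continua of comparable size and distance has energy bounded below. Together with linear
  local connectivity of the target this makes \<open>\<phi>\<close>, and then its inverse, quasisymmetric. If \<open>\<phi>\<close> were not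
  bi-Lipschitz, a volume count and connectedness would produce arbitrarily many well separated balls of one
  common radius whose images have lacunary radii. Transplanting bumps (with \<open>\<phi>\<close> if \<open>p < q\<close>, with its inverse
  if \<open>q < p\<close>) then compares \<open>n\<close> with \<open>n powr (q / p)\<close> in the contradictory direction.\<close>

section \<open>Besov energies and norms\<close>

text \<open>With p = Q / s the norm is invariant under dilations: the energy at scale t is measured
  against t powr Q, the order of the volume of a ball of that radius. Bumps of all radii obey the
  same bounds, so estimating a norm becomes counting bumps. The case q = p is exceptional because n
  and n powr (q / p) then coincide; averages of concentric bumps become small because q > 1.

  In both cases the test functions live on the target and are pulled back by \<phi>; passing to the
  inverse only changes which side carries the balls of common radius.

  The volume count rests on the equality of the two dimensions. A ball of radius r splits into about
  (r / \<rho>) powr Q balls of radius \<rho>. If all their images were much smaller, or all much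
  larger, than \<rho> / r times the image of the big ball, the volumes would not match. So two pairs
  with very different stretch ratios can be moved to one common small radius without losing the
  discrepancy. Quasisymmetry forces points whose images have very different sizes to be far
  apart.\<close>

definition besov_energy :: "'a::metric_space measure \<Rightarrow> real \<Rightarrow> ('a \<Rightarrow> real) \<Rightarrow> real \<Rightarrow> ennreal" where
  "besov_energy M p f t =
     (\<integral>\<^sup>+x. (\<integral>\<^sup>+y\<in>ball x t. ennreal (\<bar>f x - f y\<bar> powr p) \<partial>M) / emeasure M (ball x t) \<partial>M)"

lemma besov_norm_energy:
  "besov_norm M s p q f = ennpow (\<integral>\<^sup>+t\<in>{0<..}.
     ennpow (ennreal (t powr - s) * ennpow (besov_energy M p f t) (1 / p)) q / ennreal t \<partial>lborel) (1 / q)"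
  by (simp add: besov_norm_def besov_energy_def)

lemma ennpow_ennreal: "0 \<le> x \<Longrightarrow> ennpow (ennreal x) a = ennreal (x powr a)"
  by (simp add: ennpow_def)

lemma ennpow_mono:
  assumes "x \<le> y" "0 \<le> a" shows "ennpow x a \<le> ennpow y a"
proof (cases "y = \<infinity>")
  case True then show ?thesis by (simp add: ennpow_def)
next
  case False
  then have "x \<noteq> \<infinity>" using assms by (auto simp: top_unique)
  then show ?thesis using False assms
    by (auto simp: ennpow_def top.not_eq_extremum intro!: ennreal_leI powr_mono2 enn2real_mono)
qed

text \<open>Since Q / p = s, the weight \<open>t powr - s\<close> cancels the growth
  \<open>t powr Q\<close> exactly.\<close>

lemma scaled_energy_root:
  fixes Q s p t h :: real
  assumes "0 < Q" "0 < s" "p = Q / s" "0 < t" "0 \<le> h"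
  shows "t powr - s * (t powr Q * h powr p) powr (1 / p) = h"
proof -
  have p: "p * (1 / p) = 1" "Q * (1 / p) = s" using assms by simp_all
  then have *: "(t powr Q * h powr p) powr (1 / p) = t powr s * h"
    using assms(4,5) by (subst powr_mult) (simp_all only: powr_powr powr_ge_zero powr_one)
  show ?thesis unfolding * using assms(4) by (simp add: powr_minus)
qed

text \<open>The profile \<open>h\<close> is the dimensionless part of the energy; by
  \<open>scaled_energy_root\<close> it is exactly the quantity whose q-th power is integrated
  against dt / t.\<close>

lemma besov_norm_le:
  assumes "0 < Q" "0 < s" "p = Q / s" "0 < q" and h: "\<And>t. 0 < t \<Longrightarrow> 0 \<le> h t"
    and E: "\<And>t. 0 < t \<Longrightarrow> besov_energy M p f t \<le> ennreal (t powr Q * h t powr p)"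
  shows "besov_norm M s p q f \<le> ennpow (\<integral>\<^sup>+t\<in>{0<..}. ennreal (h t powr q / t) \<partial>lborel) (1 / q)"
  unfolding besov_norm_energy
proof (intro ennpow_mono nn_integral_mono)
  fix t :: real
  show "ennpow (ennreal (t powr - s) * ennpow (besov_energy M p f t) (1 / p)) q / ennreal t
      * indicator {0<..} t \<le> ennreal (h t powr q / t) * indicator {0<..} t"
  proof (cases "t > 0")
    case True
    have p: "p > 0" using assms by simp
    have "ennpow (besov_energy M p f t) (1 / p) \<le> ennreal ((t powr Q * h t powr p) powr (1 / p))"
      using ennpow_mono[OF E[OF True], of "1/p"] p True by (simp add: ennpow_ennreal)
    then have "ennreal (t powr - s) * ennpow (besov_energy M p f t) (1 / p)
        \<le> ennreal (t powr - s) * ennreal ((t powr Q * h t powr p) powr (1 / p))"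
      by (intro mult_left_mono) auto
    also have "\<dots> = ennreal (h t)"
      using scaled_energy_root[OF assms(1-3) True h[OF True]] by (simp flip: ennreal_mult)
    finally have "ennpow (ennreal (t powr - s) * ennpow (besov_energy M p f t) (1 / p)) q
        \<le> ennreal (h t powr q)"
      using ennpow_mono[of _ "ennreal (h t)" q] assms(4) h[OF True] by (simp add: ennpow_ennreal)
    then have "ennpow (ennreal (t powr - s) * ennpow (besov_energy M p f t) (1 / p)) q / ennreal t
        \<le> ennreal (h t powr q) / ennreal t"
      by (rule divide_right_mono_ennreal)
    then show ?thesis using True by (simp add: divide_ennreal)
  qed simp
qed (use assms in auto)

text \<open>Each interval \<open>{T i..2 * T i}\<close> has length \<open>T i\<close>, and 1 / t is
  at least 1 / (2 * T i) on it: this is the factor 1 / 2. A single interval suffices for one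
  critical scale, while n disjoint ones make the bound grow linearly in n.\<close>

lemma besov_norm_ge:
  assumes "0 < Q" "0 < s" "p = Q / s" "0 < q" "0 \<le> k" "finite I"
    and T: "\<And>i. i \<in> I \<Longrightarrow> 0 < T i"
    and disj: "disjoint_family_on (\<lambda>i. {T i..2 * T i}) I"
    and E: "\<And>i t. i \<in> I \<Longrightarrow> t \<in> {T i..2 * T i} \<Longrightarrow> ennreal (k * t powr Q) \<le> besov_energy M p f t"
  shows "ennpow (ennreal (card I * k powr (q / p) / 2)) (1 / q) \<le> besov_norm M s p q f"
  unfolding besov_norm_energy
proof (intro ennpow_mono)
  have p: "p > 0" using assms by simp
  let ?g = "\<lambda>t. ennpow (ennreal (t powr - s) * ennpow (besov_energy M p f t) (1 / p)) q / ennreal t * indicator {0<..} t"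
  have *: "(\<Sum>i\<in>I. ennreal (k powr (q / p) / (2 * T i)) * indicator {T i..2 * T i} t) \<le> ?g t" for t
  proof (cases "\<exists>i\<in>I. t \<in> {T i..2 * T i}")
    case True
    then obtain i where i: "i \<in> I" "t \<in> {T i..2 * T i}" by blast
    then have t: "t > 0" using T[OF i(1)] by simp
    have "(\<Sum>j\<in>I. ennreal (k powr (q / p) / (2 * T j)) * indicator {T j..2 * T j} t)
        = (\<Sum>j\<in>I. if j = i then ennreal (k powr (q / p) / (2 * T i)) else 0)"
    proof (intro sum.cong refl)
      fix j assume j: "j \<in> I"
      have "t \<notin> {T j..2 * T j}" if "j \<noteq> i"
        using disj j i that unfolding disjoint_family_on_def by blast
      then show "ennreal (k powr (q / p) / (2 * T j)) * indicator {T j..2 * T j} t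
         = (if j = i then ennreal (k powr (q / p) / (2 * T i)) else 0)" using i by (auto simp: indicator_def)
    qed
    also have "\<dots> = ennreal (k powr (q / p) / (2 * T i))" using i assms by simp
    also have "\<dots> \<le> ennreal (k powr (q / p) / t)"
      using i t by (intro ennreal_leI divide_left_mono) auto
    also have "\<dots> \<le> ?g t"
    proof -
      have "(t powr Q * k) = t powr Q * (k powr (1/p)) powr p" using assms p by (simp add: powr_powr)
      then have eq: "t powr - s * (k * t powr Q) powr (1 / p) = k powr (1/p)"
        using scaled_energy_root[OF assms(1-3) t, of "k powr (1/p)"] by (metis mult.commute powr_ge_zero)
      have "ennreal ((k * t powr Q) powr (1 / p)) \<le> ennpow (besov_energy M p f t) (1 / p)"
        using ennpow_mono[OF E[OF i], of "1/p"] p assms by (simp add: ennpow_ennreal)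
      then have "ennreal (t powr - s) * ennreal ((k * t powr Q) powr (1 / p))
        \<le> ennreal (t powr - s) * ennpow (besov_energy M p f t) (1 / p)"
        by (intro mult_left_mono) auto
      then have "ennreal (k powr (1/p)) \<le> ennreal (t powr - s) * ennpow (besov_energy M p f t) (1 / p)"
        by (simp add: eq flip: ennreal_mult)
      from ennpow_mono[OF this, of q] assms
      have "ennreal (k powr (q/p)) \<le> ennpow (ennreal (t powr - s) * ennpow (besov_energy M p f t) (1 / p)) q"
        by (simp add: ennpow_ennreal powr_powr mult.commute)
      then have "ennreal (k powr (q/p)) / ennreal t
         \<le> ennpow (ennreal (t powr - s) * ennpow (besov_energy M p f t) (1 / p)) q / ennreal t"
        by (rule divide_right_mono_ennreal)
      then show ?thesis using t by (simp add: divide_ennreal)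
    qed
    finally show ?thesis .
  next
    case False
    then have "(\<Sum>i\<in>I. ennreal (k powr (q / p) / (2 * T i)) * indicator {T i..2 * T i} t) = 0"
      by (intro sum.neutral) auto
    then show ?thesis by simp
  qed
  have "ennreal (card I * k powr (q / p) / 2) = (\<Sum>i\<in>I. ennreal (k powr (q / p) / 2))"
    using assms by (simp add: ennreal_of_nat_eq_real_of_nat flip: ennreal_mult)
  also have "\<dots> = (\<Sum>i\<in>I. ennreal (k powr (q / p) / (2 * T i)) * emeasure lborel {T i..2 * T i})"
  proof (intro sum.cong refl)
    fix i assume "i \<in> I"
    from T[OF this] show "ennreal (k powr (q / p) / 2) = ennreal (k powr (q / p) / (2 * T i)) * emeasure lborel {T i..2 * T i}"
      by (simp flip: ennreal_mult)
  qed
  also have "\<dots> = (\<integral>\<^sup>+t. (\<Sum>i\<in>I. ennreal (k powr (q / p) / (2 * T i)) * indicator {T i..2 * T i} t) \<partial>lborel)"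
    by (subst nn_integral_sum) (auto simp: nn_integral_cmult_indicator)
  also have "\<dots> \<le> integral\<^sup>N lborel ?g" by (intro nn_integral_mono *)
  finally show "ennreal (card I * k powr (q / p) / 2) \<le> integral\<^sup>N lborel ?g" .
qed (use assms in auto)

text \<open>As a function of log t this is the exponential of -\<alpha> times the distance from log
  t to log \<tau>. It dominates the normalised energy of a bump of radius \<tau>.\<close>

definition decay :: "real \<Rightarrow> real \<Rightarrow> real \<Rightarrow> real" where
  "decay \<alpha> \<tau> t = min (t / \<tau>) (\<tau> / t) powr \<alpha>"

lemma decay_nonneg: "0 \<le> decay \<alpha> \<tau> t"
  by (simp add: decay_def)

lemma decay_pos: "0 < \<tau> \<Longrightarrow> 0 < t \<Longrightarrow> 0 < decay \<alpha> \<tau> t"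
  by (simp add: decay_def min_def)

lemma decay_le_1: "0 < \<tau> \<Longrightarrow> 0 < t \<Longrightarrow> 0 \<le> \<alpha> \<Longrightarrow> decay \<alpha> \<tau> t \<le> 1"
proof -
  assume a: "0 < \<tau>" "0 < t" "0 \<le> \<alpha>"
  then have "t / \<tau> \<le> 1 \<or> \<tau> / t \<le> 1" by auto
  then have "min (t / \<tau>) (\<tau> / t) \<le> 1" by auto
  then show ?thesis unfolding decay_def using a by (intro powr_le1) auto
qed

text \<open>In the variable log t there is an exponential tail of mass 1 / \<alpha> on either side
  of log \<tau>, so the bound does not depend on \<tau>.\<close>

lemma nn_integral_decay:
  assumes "0 < \<alpha>" "0 < \<tau>"
  shows "(\<integral>\<^sup>+t\<in>{0<..}. ennreal (decay \<alpha> \<tau> t / t) \<partial>lborel) \<le> ennreal (2 / \<alpha>)"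
proof -
  let ?A = "\<lambda>t. \<tau> powr - \<alpha> * t powr (\<alpha> - 1)" and ?B = "\<lambda>t. \<tau> powr \<alpha> * t powr (- \<alpha> - 1)"
  have A: "(?A has_integral \<tau> powr - \<alpha> * (\<tau> powr (\<alpha> - 1 + 1) / (\<alpha> - 1 + 1))) {0..\<tau>}"
    by (intro has_integral_mult_right has_integral_powr_from_0) (use assms in auto)
  have B: "(?B has_integral \<tau> powr \<alpha> * (-(\<tau> powr (- \<alpha> - 1 + 1)) / (- \<alpha> - 1 + 1))) {\<tau>..}"
    by (intro has_integral_mult_right has_integral_powr_to_inf) (use assms in auto)
  have iA: "(\<integral>\<^sup>+t. ennreal (indicator {0..\<tau>} t * ?A t) \<partial>lborel) = ennreal (1 / \<alpha>)"
    using nn_integral_has_integral_lebesgue[OF _ A] assms by (simp flip: powr_add add: mult.assoc)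
  have iB: "(\<integral>\<^sup>+t. ennreal (indicator {\<tau>..} t * ?B t) \<partial>lborel) = ennreal (1 / \<alpha>)"
    using nn_integral_has_integral_lebesgue[OF _ B] assms by (simp flip: powr_add add: mult.assoc)
  have "(\<integral>\<^sup>+t\<in>{0<..}. ennreal (decay \<alpha> \<tau> t / t) \<partial>lborel)
      \<le> (\<integral>\<^sup>+t. ennreal (indicator {0..\<tau>} t * ?A t) + ennreal (indicator {\<tau>..} t * ?B t) \<partial>lborel)"
  proof (intro nn_integral_mono)
    fix t :: real
    show "ennreal (decay \<alpha> \<tau> t / t) * indicator {0<..} t
      \<le> ennreal (indicator {0..\<tau>} t * ?A t) + ennreal (indicator {\<tau>..} t * ?B t)"
    proof (cases "t > 0")
      case True
      show ?thesis
      proof (cases "t \<le> \<tau>")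
        case le: True
        have "decay \<alpha> \<tau> t / t \<le> (t / \<tau>) powr \<alpha> / t"
          unfolding decay_def using True assms by (intro divide_right_mono powr_mono2) auto
        also have "\<dots> = ?A t" using True assms by (simp add: powr_divide powr_minus powr_diff field_simps)
        finally show ?thesis using True le by (intro order_trans[OF _ add_increasing2[OF _ order_refl]]) (auto intro: ennreal_leI)
      next
        case False
        have "decay \<alpha> \<tau> t / t \<le> (\<tau> / t) powr \<alpha> / t"
          unfolding decay_def using True assms by (intro divide_right_mono powr_mono2) auto
        also have "\<dots> = ?B t" using True assms by (simp add: powr_divide powr_minus powr_diff field_simps)
        finally show ?thesis using True False by (auto intro: ennreal_leI)
      qed
    qed simp
  qed
  also have "\<dots> = ennreal (1 / \<alpha>) + ennreal (1 / \<alpha>)"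
    by (subst nn_integral_add) (auto simp: iA iB)
  also have "\<dots> = ennreal (2 / \<alpha>)" using assms by (simp flip: ennreal_plus)
  finally show ?thesis .
qed

text \<open>The numbers log (\<tau> k) are at least log 2 apart, so on each side of t the terms are
  dominated by a geometric series of ratio 2 powr -\<alpha>. The bound is free of n, which is why
  the overlap of lacunary bumps costs only a constant.\<close>

lemma sum_decay_le:
  fixes \<tau> :: "nat \<Rightarrow> real"
  assumes "0 < \<alpha>" "0 < t" "\<And>k. k < n \<Longrightarrow> 0 < \<tau> k" "\<And>k. Suc k < n \<Longrightarrow> 2 * \<tau> k \<le> \<tau> (Suc k)"
  shows "(\<Sum>k<n. decay \<alpha> (\<tau> k) t) \<le> 2 / (1 - 2 powr - \<alpha>)"
proof -
  define g where "g = 1 / (1 - 2 powr - \<alpha>)"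
  have half: "(1 / 2) powr \<alpha> = 2 powr - \<alpha>" by (simp add: powr_divide powr_minus field_simps)
  have a: "0 < 2 powr - \<alpha>" "2 powr - \<alpha> < (1::real)" using assms(1) by (auto simp: powr_less_one)
  then have g0: "g > 0" and "(1 - 2 powr - \<alpha>) * g = 1" by (auto simp: g_def)
  \<comment> \<open>\<open>g\<close> is the sum of the geometric series in the form of a fixed
    point, so that adding one term in either induction below reproduces the same bound.\<close>
  then have g: "1 + 2 powr - \<alpha> * g = g" by (simp add: algebra_simps)
  \<comment> \<open>Truncating each term on one side of \<open>t\<close> makes both halves geometric sums.\<close>
  have up: "(\<Sum>k<n. if \<tau> k \<le> t then (\<tau> k / t) powr \<alpha> else 0) \<le> g * min 1 (\<tau> (n - 1) / t) powr \<alpha>"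
    if "n > 0" "\<And>k. k < n \<Longrightarrow> 0 < \<tau> k" "\<And>k. Suc k < n \<Longrightarrow> 2 * \<tau> k \<le> \<tau> (Suc k)" for n
    using that
  proof (induction n)
    case (Suc n)
    show ?case
    proof (cases "n = 0")
      case True
      then show ?thesis using Suc.prems assms g0 a
        by (auto simp: g_def min_def field_simps)
    next
      case False
      have t: "2 * \<tau> (n - 1) \<le> \<tau> n" "0 < \<tau> (n-1)" "0 < \<tau> n"
        using Suc.prems(2)[of "n-1"] Suc.prems(2)[of n] Suc.prems(3)[of "n - 1"] False by auto
      have IH: "(\<Sum>k<n. if \<tau> k \<le> t then (\<tau> k / t) powr \<alpha> else 0) \<le> g * min 1 (\<tau> (n - 1) / t) powr \<alpha>"
        using Suc False by auto
      show ?thesis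
      proof (cases "\<tau> n \<le> t")
        case True
        have "min 1 (\<tau> (n - 1) / t) powr \<alpha> \<le> (2 powr -1 * (\<tau> n / t)) powr \<alpha>"
          using t True assms by (intro powr_mono2) (auto simp: field_simps)
        also have "\<dots> = 2 powr - \<alpha> * (\<tau> n / t) powr \<alpha>" using t True assms by (subst powr_mult) (auto simp: half)
        finally have "g * min 1 (\<tau> (n - 1) / t) powr \<alpha> \<le> g * (2 powr - \<alpha> * (\<tau> n / t) powr \<alpha>)" using g0 by simp
        then have "(\<Sum>k<Suc n. if \<tau> k \<le> t then (\<tau> k / t) powr \<alpha> else 0)
           \<le> (1 + 2 powr - \<alpha> * g) * (\<tau> n / t) powr \<alpha>" using IH True by (simp add: algebra_simps)
        moreover have "min 1 (\<tau> n / t) = \<tau> n / t" using True assms by simp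
        ultimately show ?thesis by (simp add: g)
      next
        case False
        have "min 1 (\<tau> (n - 1) / t) powr \<alpha> \<le> min 1 (\<tau> n / t) powr \<alpha>"
          using t assms by (intro powr_mono2) (auto simp: min_def field_simps)
        then have "g * min 1 (\<tau> (n - 1) / t) powr \<alpha> \<le> g * min 1 (\<tau> n / t) powr \<alpha>" using g0 by simp
        then show ?thesis using IH False by simp
      qed
    qed
  qed simp
  \<comment> \<open>Above t the first term is the largest. The induction therefore strips index 0
    and applies the hypothesis to a shifted sequence, which is why \<open>\<tau>\<close> is
    generalised.\<close>
  have down: "(\<Sum>k<n. if t < \<tau> k then (t / \<tau> k) powr \<alpha> else 0) \<le> g * min 1 (t / \<tau> 0) powr \<alpha>"
    if "n > 0" "\<And>k. k < n \<Longrightarrow> 0 < \<tau> k" "\<And>k. Suc k < n \<Longrightarrow> 2 * \<tau> k \<le> \<tau> (Suc k)" for n and \<tau> :: "nat \<Rightarrow> real"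
    using that
  proof (induction n arbitrary: \<tau>)
    case (Suc n)
    show ?case
    proof (cases "n = 0")
      case True
      then show ?thesis using Suc.prems assms g0 a
        by (auto simp: g_def min_def field_simps)
    next
      case False
      have t: "2 * \<tau> 0 \<le> \<tau> 1" "0 < \<tau> 0" "0 < \<tau> 1"
        using Suc.prems(2)[of 0] Suc.prems(2)[of 1] Suc.prems(3)[of 0] False by auto
      have IH: "(\<Sum>k<n. if t < \<tau> (Suc k) then (t / \<tau> (Suc k)) powr \<alpha> else 0) \<le> g * min 1 (t / \<tau> 1) powr \<alpha>"
        using Suc.IH[of "\<lambda>k. \<tau> (Suc k)"] Suc.prems False by auto
      show ?thesis
      proof (cases "t < \<tau> 0")
        case True
        have "min 1 (t / \<tau> 1) powr \<alpha> \<le> (2 powr -1 * (t / \<tau> 0)) powr \<alpha>"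
          using t True assms by (intro powr_mono2) (auto simp: field_simps min_def intro: order_trans)
        also have "\<dots> = 2 powr - \<alpha> * (t / \<tau> 0) powr \<alpha>" using t True assms by (subst powr_mult) (auto simp: half)
        finally have "g * min 1 (t / \<tau> 1) powr \<alpha> \<le> g * (2 powr - \<alpha> * (t / \<tau> 0) powr \<alpha>)" using g0 by simp
        then have "(\<Sum>k<Suc n. if t < \<tau> k then (t / \<tau> k) powr \<alpha> else 0)
           \<le> (1 + 2 powr - \<alpha> * g) * (t / \<tau> 0) powr \<alpha>"
          using IH True by (simp add: sum.lessThan_Suc_shift algebra_simps del: sum.lessThan_Suc)
        moreover have "min 1 (t / \<tau> 0) = t / \<tau> 0" using True t by simp
        moreover have "(1 + 2 powr - \<alpha> * g) * (t / \<tau> 0) powr \<alpha> = g * (t / \<tau> 0) powr \<alpha>" by (simp only: g)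
        ultimately show ?thesis by simp
      next
        case False
        have "min 1 (t / \<tau> 1) powr \<alpha> \<le> min 1 (t / \<tau> 0) powr \<alpha>"
          using t assms by (intro powr_mono2) (auto simp: min_def field_simps intro: mult_mono)
        then have "g * min 1 (t / \<tau> 1) powr \<alpha> \<le> g * min 1 (t / \<tau> 0) powr \<alpha>" using g0 by simp
        then show ?thesis using IH False by (simp add: sum.lessThan_Suc_shift del: sum.lessThan_Suc)
      qed
    qed
  qed simp
  show ?thesis
  proof (cases "n = 0")
    case True then show ?thesis using a by simp
  next
    case False
    have m: "min 1 y powr \<alpha> \<le> 1" if "y \<ge> 0" for y :: real
      using that assms(1) by (intro powr_le1) auto
    have "decay \<alpha> (\<tau> k) t = (if \<tau> k \<le> t then (\<tau> k / t) powr \<alpha> else 0) + (if t < \<tau> k then (t / \<tau> k) powr \<alpha> else 0)"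
      if "k < n" for k
    proof -
      have p: "0 < \<tau> k" "0 < t" using that assms by auto
      have "min (t / \<tau> k) (\<tau> k / t) = (if \<tau> k \<le> t then \<tau> k / t else t / \<tau> k)"
      proof (cases "\<tau> k \<le> t")
        case True
        then have "\<tau> k / t \<le> 1" "1 \<le> t / \<tau> k" using p by auto
        then show ?thesis using True by (simp add: min_def)
      next
        case False
        then have "1 \<le> \<tau> k / t" "t / \<tau> k \<le> 1" using p by auto
        then show ?thesis using False by (simp add: min_def)
      qed
      then show ?thesis by (simp add: decay_def)
    qed
    then have "(\<Sum>k<n. decay \<alpha> (\<tau> k) t) = (\<Sum>k<n. if \<tau> k \<le> t then (\<tau> k / t) powr \<alpha> else 0)
       + (\<Sum>k<n. if t < \<tau> k then (t / \<tau> k) powr \<alpha> else 0)"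
      by (simp add: sum.distrib[symmetric])
    also have "\<dots> \<le> g * min 1 (\<tau> (n - 1) / t) powr \<alpha> + g * min 1 (t / \<tau> 0) powr \<alpha>"
      by (intro add_mono up down) (use False assms in auto)
    also have "\<dots> \<le> g * 1 + g * 1"
      using g0 assms(2) assms(3)[of 0] assms(3)[of "n-1"] False by (intro add_mono mult_left_mono m) auto
    finally show ?thesis by (simp add: g_def)
  qed
qed

section \<open>Regular spaces and bump functions\<close>

definition besov_average :: "'a::metric_space measure \<Rightarrow> real \<Rightarrow> ('a \<Rightarrow> real) \<Rightarrow> real \<Rightarrow> 'a \<Rightarrow> ennreal" where
  "besov_average M p f t x =
     (\<integral>\<^sup>+y\<in>ball x t. ennreal (\<bar>f x - f y\<bar> powr p) \<partial>M) / emeasure M (ball x t)"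

lemma besov_energy_average: "besov_energy M p f t = (\<integral>\<^sup>+x. besov_average M p f t x \<partial>M)"
  by (simp add: besov_energy_def besov_average_def)

text \<open>The upper bound is required at every radius, and "r below the diameter" in the lower
  bound is expressed by two points farther apart than r. Bounded and unbounded spaces can then be
  treated alike.\<close>

locale regular_space =
  fixes M :: "'a::metric_space measure" and Q C :: real
  assumes sets_M: "sets M = sets borel" and Q_pos: "0 < Q" and C_ge_1: "1 \<le> C"
    and upper: "\<And>x r. 0 < r \<Longrightarrow> emeasure M (ball x r) \<le> ennreal (C * r powr Q)"
    and lower: "\<And>x r u (v :: 'a). 0 < r \<Longrightarrow> r < dist u v \<Longrightarrow> ennreal (r powr Q / C) \<le> emeasure M (ball x r)"
    and nontrivial: "\<exists>u v :: 'a. u \<noteq> v"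
begin

lemma open_in_sets [measurable]: "open A \<Longrightarrow> A \<in> sets M"
  by (simp add: sets_M)

lemma ball_in_sets [measurable, simp]: "ball x r \<in> sets M"
  by (simp add: sets_M)

lemma continuous_measurable [measurable]:
  "continuous_on UNIV f \<Longrightarrow> f \<in> borel_measurable M" for f :: "'a \<Rightarrow> 'c::topological_space"
  using borel_measurable_continuous_onI measurable_cong_sets[OF sets_M refl, of "borel :: 'c measure"] by blast

lemma emeasure_ball_finite: "emeasure M (ball x r) < \<infinity>"
proof (cases "0 < r")
  case True
  then show ?thesis using upper[OF True, of x] by (simp add: le_less_trans)
next
  case False
  then have *: "ball x r = {}" by (simp add: not_less)
  show ?thesis unfolding * by simp
qed

lemma emeasure_ball: "emeasure M (ball x r) = ennreal (measure M (ball x r))"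
  using emeasure_ball_finite[of x r] by (simp add: emeasure_eq_ennreal_measure)

lemma measure_ball_pos: "0 < r \<Longrightarrow> 0 < measure M (ball x r)"
proof -
  assume r: "0 < r"
  obtain u v :: 'a where uv: "u \<noteq> v" using nontrivial by blast
  define r' where "r' = min r (dist u v / 2)"
  have r': "0 < r'" "r' < dist u v" "r' \<le> r" using r uv by (auto simp: r'_def min_def)
  have "0 < ennreal (r' powr Q / C)" using r' C_ge_1 by (simp add: ennreal_zero_less_divide)
  also have "\<dots> \<le> emeasure M (ball x r')" using lower[OF r'(1,2)] .
  also have "\<dots> \<le> emeasure M (ball x r)" using r' by (intro emeasure_mono) auto
  finally show ?thesis by (simp add: emeasure_ball)
qed

lemma measure_upper: "0 < r \<Longrightarrow> measure M (ball x r) \<le> C * r powr Q"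
  using upper[of r x] C_ge_1 by (simp add: emeasure_ball)

lemma measure_lower: fixes u v :: 'a shows "0 < r \<Longrightarrow> r < dist u v \<Longrightarrow> r powr Q / C \<le> measure M (ball x r)"
  using lower[of r u v x] C_ge_1 by (simp add: emeasure_ball)

lemma measure_mono_finite: "A \<in> sets M \<Longrightarrow> A \<subseteq> B \<Longrightarrow> B \<subseteq> ball x r \<Longrightarrow> B \<in> sets M \<Longrightarrow> measure M A \<le> measure M B"
  by (rule measure_mono_fmeasurable)
     (use emeasure_ball_finite[of x r] in \<open>auto intro!: fmeasurableI intro: le_less_trans[OF emeasure_mono]\<close>)

definition doubling_const :: real where "doubling_const = C * C * 6 powr Q"

lemma doubling_const_ge_1: "1 \<le> doubling_const"
  unfolding doubling_const_def using C_ge_1 Q_pos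
  by (intro mult_ge1_I ge_one_powr_ge_zero) auto

text \<open>The centres \<open>c\<close> and \<open>x\<close> are unrelated, because regularity
  controls volumes by the radius alone; the 6 in the constant is the ratio of 3 * t to t / 2. If no
  two points are more than t / 2 apart, then \<open>ball x t\<close> is already the whole
  space.\<close>

lemma doubling:
  assumes "0 < t" shows "measure M (ball c (3 * t)) \<le> doubling_const * measure M (ball x t)"
proof (cases "\<exists>u v :: 'a. t / 2 < dist u v")
  case True
  then obtain u v :: 'a where uv: "t / 2 < dist u v" by blast
  have "measure M (ball c (3 * t)) \<le> C * (3 * t) powr Q" using assms by (intro measure_upper) auto
  also have "\<dots> = doubling_const * ((t / 2) powr Q / C)"
  proof -
    have "(3 * t) powr Q = (6 * (t / 2)) powr Q" by simp
    also have "\<dots> = 6 powr Q * (t / 2) powr Q" using assms by (subst powr_mult) auto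
    finally show ?thesis using C_ge_1 by (simp add: doubling_const_def)
  qed
  also have "\<dots> \<le> doubling_const * measure M (ball x (t / 2))"
    using assms uv doubling_const_ge_1 by (intro mult_left_mono measure_lower) auto
  also have "\<dots> \<le> doubling_const * measure M (ball x t)"
    using assms doubling_const_ge_1 by (intro mult_left_mono measure_mono_finite[of _ _ x t]) auto
  finally show ?thesis .
next
  case False
  then have "dist x y < t" for y using assms by (smt (verit) field_sum_of_halves)
  then have "measure M (ball c (3 * t)) \<le> measure M (ball x t)"
    by (intro measure_mono_finite[of _ _ x t]) auto
  also have "\<dots> \<le> doubling_const * measure M (ball x t)"
    using doubling_const_ge_1 by (intro mult_le_cancel_right1[THEN iffD2]) (auto simp: not_less)
  finally show ?thesis .
qed

lemma besov_average_le:
  assumes "0 < t" "0 \<le> B" "0 \<le> w" "A \<in> sets M" "A \<subseteq> ball z r"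
    and b: "\<And>y. y \<in> ball x t \<Longrightarrow> \<bar>f x - f y\<bar> powr p \<le> B * indicator A y"
  shows "besov_average M p f t x \<le> ennreal (B * measure M A / measure M (ball x t))"
proof -
  have A: "emeasure M A = ennreal (measure M A)"
    using emeasure_mono[OF assms(5), of M] emeasure_ball_finite[of z r]
    by (intro emeasure_eq_ennreal_measure) (auto simp: top_unique)
  have "(\<integral>\<^sup>+y\<in>ball x t. ennreal (\<bar>f x - f y\<bar> powr p) \<partial>M) \<le> (\<integral>\<^sup>+y. ennreal B * indicator A y \<partial>M)"
  proof (intro nn_integral_mono)
    fix y show "ennreal (\<bar>f x - f y\<bar> powr p) * indicator (ball x t) y \<le> ennreal B * indicator A y"
      using b[of y] assms(2) by (cases "y \<in> ball x t"; cases "y \<in> A") (auto intro: ennreal_leI)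
  qed
  also have "\<dots> = ennreal (B * measure M A)"
    using assms by (simp add: nn_integral_cmult_indicator A ennreal_mult)
  finally have "besov_average M p f t x \<le> ennreal (B * measure M A) / ennreal (measure M (ball x t))"
    unfolding besov_average_def by (simp add: emeasure_ball divide_right_mono_ennreal)
  then show ?thesis using measure_ball_pos[OF assms(1), of x] assms(2) by (simp add: divide_ennreal)
qed

end

definition bump :: "'a::metric_space \<Rightarrow> real \<Rightarrow> 'a \<Rightarrow> real" where
  "bump c \<tau> y = max 0 (min 1 (2 - dist y c / \<tau>))"

lemma bump_bounds: "0 \<le> bump c \<tau> y" "bump c \<tau> y \<le> 1"
  by (auto simp: bump_def)

lemma bump_eq_1: "0 < \<tau> \<Longrightarrow> dist y c \<le> \<tau> \<Longrightarrow> bump c \<tau> y = 1"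
  by (simp add: bump_def min_def field_simps)

lemma bump_eq_0: "0 < \<tau> \<Longrightarrow> 2 * \<tau> \<le> dist y c \<Longrightarrow> bump c \<tau> y = 0"
  by (simp add: bump_def min_def max_def field_simps)

lemma bump_lipschitz: "0 < \<tau> \<Longrightarrow> \<bar>bump c \<tau> x - bump c \<tau> y\<bar> \<le> dist x y / \<tau>"
proof -
  assume \<tau>: "0 < \<tau>"
  have "\<bar>dist x c - dist y c\<bar> \<le> dist x y" using dist_triangle[of x c y] dist_triangle[of y c x] by (auto simp: dist_commute)
  then have "\<bar>dist x c / \<tau> - dist y c / \<tau>\<bar> \<le> dist x y / \<tau>"
    using \<tau> by (simp add: diff_divide_distrib[symmetric] abs_divide divide_right_mono)
  then show ?thesis by (auto simp: bump_def)
qed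

lemma continuous_bump: "continuous_on A (bump c \<tau>)"
  unfolding bump_def divide_inverse by (intro continuous_intros)

section \<open>Energy of a single bump\<close>

context regular_space
begin

definition bump_const :: real where "bump_const = (1 + doubling_const) * C * 3 powr Q"

lemma bump_const_pos: "0 < bump_const"
  unfolding bump_const_def using doubling_const_ge_1 C_ge_1 by auto

text \<open>For t < \<tau> the Lipschitz bound contributes (t / \<tau>) powr p on a ball of volume
  about \<tau> powr Q, which is t powr Q times (t / \<tau>) powr ((1 - s) * p). For t \<ge> \<tau>
  the total is about \<tau> powr Q, which is t powr Q times (\<tau> / t) powr (s * p). The worse of
  the two exponents is \<alpha> = min s (1 - s).

  A measurable majorant \<open>G\<close> of the averages is produced, rather than just a bound of
  the energy, so that integrals of sums over several bumps can be split without measurability of the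
  averages themselves.\<close>

lemma bump_majorant:
  assumes "0 < s" "s < 1" "p = Q / s" "\<alpha> = min s (1 - s)" "0 < \<tau>" "0 < t"
  obtains G where "G \<in> borel_measurable M" "\<And>x. besov_average M p (bump c \<tau>) t x \<le> G x"
    "(\<integral>\<^sup>+x. G x \<partial>M) \<le> ennreal (bump_const * t powr Q * decay \<alpha> \<tau> t powr p)"
proof -
  have p: "p > 0" "Q = s * p" using assms Q_pos by auto
  have pw: "x powr (\<alpha> * p) \<ge> x powr (b * p)" if "0 < x" "x \<le> 1" "\<alpha> \<le> b" for x b :: real
    using that p by (intro powr_mono') auto
  show ?thesis
  proof (cases "t < \<tau>")
    case True
    define G :: "'a \<Rightarrow> ennreal" where "G x = ennreal ((t / \<tau>) powr p) * indicator (ball c (3 * \<tau>)) x" for x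
    show ?thesis
    proof (rule that[of G])
      show "G \<in> borel_measurable M" unfolding G_def by measurable
      fix x
      show "besov_average M p (bump c \<tau>) t x \<le> G x"
      proof (cases "x \<in> ball c (3 * \<tau>)")
        case x: True
        have "besov_average M p (bump c \<tau>) t x \<le> ennreal ((t / \<tau>) powr p * measure M (ball x t) / measure M (ball x t))"
        proof (rule besov_average_le[where z = x and r = t])
          fix y assume y: "y \<in> ball x t"
          have "\<bar>bump c \<tau> x - bump c \<tau> y\<bar> \<le> dist x y / \<tau>" using assms by (intro bump_lipschitz)
          also have "\<dots> \<le> t / \<tau>" using y assms by (intro divide_right_mono) auto
          finally show "\<bar>bump c \<tau> x - bump c \<tau> y\<bar> powr p \<le> (t / \<tau>) powr p * indicator (ball x t) y"
            using y p by (auto intro!: powr_mono2)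
        qed (use assms in auto)
        then show ?thesis using x measure_ball_pos[OF \<open>0 < t\<close>, of x] by (simp add: G_def)
      next
        case False
        have "besov_average M p (bump c \<tau>) t x \<le> ennreal (0 * measure M (ball x t) / measure M (ball x t))"
        proof (rule besov_average_le[where z = x and r = t])
          fix y assume y: "y \<in> ball x t"
          have "dist c x \<ge> 3 * \<tau>" using False by simp
          moreover have "dist c x \<le> dist c y + dist x y" using dist_triangle[of c x y] by (simp add: dist_commute)
          ultimately have "2 * \<tau> \<le> dist y c" "2 * \<tau> \<le> dist x c" using y True assms by (auto simp: dist_commute)
          then show "\<bar>bump c \<tau> x - bump c \<tau> y\<bar> powr p \<le> 0 * indicator (ball x t) y"
            using assms by (simp add: bump_eq_0)
        qed (use assms in auto)
        then show ?thesis by simp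
      qed
    next
      have "(\<integral>\<^sup>+x. G x \<partial>M) = ennreal ((t / \<tau>) powr p * measure M (ball c (3 * \<tau>)))"
        unfolding G_def by (simp add: nn_integral_cmult_indicator emeasure_ball ennreal_mult)
      also have "\<dots> \<le> ennreal ((t / \<tau>) powr p * (C * (3 * \<tau>) powr Q))"
        using assms by (intro ennreal_leI mult_left_mono measure_upper) auto
      also have "\<dots> \<le> ennreal (bump_const * t powr Q * decay \<alpha> \<tau> t powr p)"
      proof (rule ennreal_leI)
        have m: "min (t / \<tau>) (\<tau> / t) = t / \<tau>"
        proof -
          have "t / \<tau> \<le> 1" "1 \<le> \<tau> / t" using assms True by auto
          then show ?thesis by simp
        qed
        have "(t / \<tau>) powr p * (C * (3 * \<tau>) powr Q) = C * 3 powr Q * t powr Q * (t / \<tau>) powr ((1 - s) * p)"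
          using assms(5,6) by (simp add: p(2) powr_mult powr_divide powr_diff left_diff_distrib)
        also have "\<dots> \<le> C * 3 powr Q * t powr Q * (t / \<tau>) powr (\<alpha> * p)"
          using assms True C_ge_1 by (intro mult_left_mono pw) auto
        also have "\<dots> \<le> bump_const * t powr Q * (t / \<tau>) powr (\<alpha> * p)"
          unfolding bump_const_def using C_ge_1 doubling_const_ge_1
          by (intro mult_right_mono) auto
        finally show "(t / \<tau>) powr p * (C * (3 * \<tau>) powr Q) \<le> bump_const * t powr Q * decay \<alpha> \<tau> t powr p"
          by (simp add: decay_def m powr_powr)
      qed
      finally show "(\<integral>\<^sup>+x. G x \<partial>M) \<le> ennreal (bump_const * t powr Q * decay \<alpha> \<tau> t powr p)" .
    qed
  next
    case False
    then have le: "\<tau> \<le> t" by simp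
    let ?m = "\<lambda>x r. measure M (ball x r)"
    \<comment> \<open>A point outside the support sees it as the fraction
      \<open>?m c (2 * \<tau>) / ?m x t\<close> of its ball. Doubling replaces the denominator by
      the volume of \<open>ball c (3 * t)\<close>, which is independent of x and cancels when
      \<open>G\<close> is integrated over that ball.\<close>
    define D where "D = doubling_const * ?m c (2 * \<tau>) / ?m c (3 * t)"
    have mp: "0 < ?m c (2 * \<tau>)" "0 < ?m c (3 * t)" "0 < ?m x t" for x
      using assms by (auto intro: measure_ball_pos)
    have D: "D \<ge> 0" unfolding D_def using doubling_const_ge_1 by simp
    define G :: "'a \<Rightarrow> ennreal" where
      "G x = ennreal D * indicator (ball c (3 * t)) x + indicator (ball c (2 * \<tau>)) x" for x
    show ?thesis
    proof (rule that[of G])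
      show "G \<in> borel_measurable M" unfolding G_def by measurable
      fix x
      show "besov_average M p (bump c \<tau>) t x \<le> G x"
      proof (cases "x \<in> ball c (2 * \<tau>)")
        case x: True
        have "besov_average M p (bump c \<tau>) t x \<le> ennreal (1 * measure M (ball x t) / measure M (ball x t))"
        proof (rule besov_average_le[where z = x and r = t])
          fix y assume y: "y \<in> ball x t"
          have "\<bar>bump c \<tau> x - bump c \<tau> y\<bar> \<le> 1" using bump_bounds[of c \<tau> x] bump_bounds[of c \<tau> y] by auto
          then have "\<bar>bump c \<tau> x - bump c \<tau> y\<bar> powr p \<le> 1" using p by (intro powr_le1) auto
          then show "\<bar>bump c \<tau> x - bump c \<tau> y\<bar> powr p \<le> 1 * indicator (ball x t) y"
            using y by simp
        qed (use assms in auto)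
        then have "besov_average M p (bump c \<tau>) t x \<le> 1" using mp(3)[of x] by simp
        then show ?thesis by (rule order_trans) (use x in \<open>simp add: G_def\<close>)
      next
        case out: False
        then have bx: "bump c \<tau> x = 0" using assms by (intro bump_eq_0) (auto simp: dist_commute)
        show ?thesis
        proof (cases "x \<in> ball c (3 * t)")
          case x: True
          have "besov_average M p (bump c \<tau>) t x \<le> ennreal (1 * ?m c (2 * \<tau>) / ?m x t)"
          proof (rule besov_average_le[where z = c and r = "2 * \<tau>"])
            fix y assume y: "y \<in> ball x t"
            have "bump c \<tau> y powr p \<le> 1" using bump_bounds[of c \<tau> y] p by (intro powr_le1) auto
            moreover have "bump c \<tau> y = 0" if "y \<notin> ball c (2 * \<tau>)"
              using that assms by (intro bump_eq_0) (simp_all add: dist_commute)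
            ultimately show "\<bar>bump c \<tau> x - bump c \<tau> y\<bar> powr p \<le> 1 * indicator (ball c (2 * \<tau>)) y"
              using bump_bounds(1)[of c \<tau> y] by (simp add: bx indicator_def)
          qed (use assms in auto)
          also have "\<dots> \<le> ennreal D"
          proof (rule ennreal_leI)
            have "1 / ?m x t \<le> doubling_const / ?m c (3 * t)"
              using doubling[OF \<open>0 < t\<close>, of c x] mp by (simp add: field_simps)
            from mult_left_mono[OF this, of "?m c (2 * \<tau>)"]
            show "1 * ?m c (2 * \<tau>) / ?m x t \<le> D" by (simp add: D_def mult.commute)
          qed
          finally show ?thesis using x out by (simp add: G_def)
        next
          case False
          have "besov_average M p (bump c \<tau>) t x \<le> ennreal (0 * measure M (ball x t) / measure M (ball x t))"
          proof (rule besov_average_le[where z = x and r = t])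
            fix y assume y: "y \<in> ball x t"
            have "dist c x \<ge> 3 * t" using False by simp
            moreover have "dist c x \<le> dist c y + dist x y" using dist_triangle[of c x y] by (simp add: dist_commute)
            ultimately have "2 * \<tau> \<le> dist y c" using y le assms by (auto simp: dist_commute)
            then show "\<bar>bump c \<tau> x - bump c \<tau> y\<bar> powr p \<le> 0 * indicator (ball x t) y"
              using assms by (simp add: bump_eq_0 bx)
          qed (use assms in auto)
          then show ?thesis by simp
        qed
      qed
    next
      have "(\<integral>\<^sup>+x. G x \<partial>M) = ennreal D * ennreal (?m c (3 * t)) + ennreal (?m c (2 * \<tau>))"
        unfolding G_def by (subst nn_integral_add) (auto simp: nn_integral_cmult_indicator emeasure_ball)
      also have "\<dots> = ennreal ((1 + doubling_const) * ?m c (2 * \<tau>))"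
        using D mp doubling_const_ge_1 by (simp add: D_def algebra_simps flip: ennreal_mult ennreal_plus)
      also have "\<dots> \<le> ennreal ((1 + doubling_const) * (C * (3 * \<tau>) powr Q))"
      proof (intro ennreal_leI mult_left_mono)
        have "?m c (2 * \<tau>) \<le> ?m c (3 * \<tau>)" using assms by (intro measure_mono_finite[of _ _ c "3 * \<tau>"]) auto
        also have "\<dots> \<le> C * (3 * \<tau>) powr Q" using assms by (intro measure_upper) auto
        finally show "?m c (2 * \<tau>) \<le> C * (3 * \<tau>) powr Q" .
      qed (use doubling_const_ge_1 in auto)
      also have "\<dots> \<le> ennreal (bump_const * t powr Q * decay \<alpha> \<tau> t powr p)"
      proof (rule ennreal_leI)
        have m: "min (t / \<tau>) (\<tau> / t) = \<tau> / t"
        proof -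
          have "\<tau> / t \<le> 1" "1 \<le> t / \<tau>" using assms le by auto
          then show ?thesis by simp
        qed
        have "(1 + doubling_const) * (C * (3 * \<tau>) powr Q) = bump_const * t powr Q * (\<tau> / t) powr (s * p)"
          using assms(5,6) by (simp add: p(2)[symmetric] bump_const_def powr_mult powr_divide)
        also have "\<dots> \<le> bump_const * t powr Q * (\<tau> / t) powr (\<alpha> * p)"
          using assms le bump_const_pos by (intro mult_left_mono pw) auto
        finally show "(1 + doubling_const) * (C * (3 * \<tau>) powr Q) \<le> bump_const * t powr Q * decay \<alpha> \<tau> t powr p"
          by (simp add: decay_def m powr_powr)
      qed
      finally show "(\<integral>\<^sup>+x. G x \<partial>M) \<le> ennreal (bump_const * t powr Q * decay \<alpha> \<tau> t powr p)" .
    qed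
  qed
qed

end

text \<open>Jensen's inequality for the values \<open>d i / c i\<close> with weights proportional to
  \<open>c i\<close>. The free choice of the \<open>c i\<close> allows the weights to be adapted to
  the scale t later.\<close>

lemma sum_powr_le:
  fixes c d :: "'i \<Rightarrow> real" and p :: real
  assumes "finite I" "1 \<le> p" "\<And>i. i \<in> I \<Longrightarrow> 0 < c i" "\<And>i. i \<in> I \<Longrightarrow> 0 \<le> d i"
  shows "(\<Sum>i\<in>I. d i) powr p \<le> (\<Sum>i\<in>I. c i) powr (p - 1) * (\<Sum>i\<in>I. c i powr (1 - p) * d i powr p)"
proof -
  \<comment> \<open>The convexity applied is that of powr on the open half line, so vanishing terms
    are removed first.\<close>
  define J where "J = {i \<in> I. 0 < d i}"
  have J: "finite J" "J \<subseteq> I" "\<And>i. i \<in> J \<Longrightarrow> 0 < c i" "\<And>i. i \<in> J \<Longrightarrow> 0 < d i"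
    using assms by (auto simp: J_def)
  have dJ: "(\<Sum>i\<in>I. d i) = (\<Sum>i\<in>J. d i)"
  proof (rule sum.mono_neutral_right[OF assms(1) J(2)], rule ballI)
    fix i assume "i \<in> I - J"
    then have "\<not> 0 < d i" "0 \<le> d i" using assms(4)[of i] by (simp_all add: J_def)
    then show "d i = 0" by linarith
  qed
  show ?thesis
  proof (cases "J = {}")
    case True
    then show ?thesis using dJ assms by (simp add: sum_nonneg)
  next
    case False
    define S where "S = (\<Sum>i\<in>J. c i)"
    have S: "S > 0" unfolding S_def using J False by (intro sum_pos) auto
    have "(\<Sum>i\<in>J. (c i / S) *\<^sub>R (d i / c i)) powr p \<le> (\<Sum>i\<in>J. (c i / S) * (d i / c i) powr p)"
    proof (rule convex_on_sum[OF J(1) False powr_convex[OF assms(2)]])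
      show "(\<Sum>i\<in>J. c i / S) = 1" using S by (simp add: S_def sum_divide_distrib[symmetric])
    next
      fix i assume i: "i \<in> J"
      show "0 \<le> c i / S" "d i / c i \<in> {0<..}" using J(3,4)[OF i] S by simp_all
    qed
    also have "(\<Sum>i\<in>J. (c i / S) *\<^sub>R (d i / c i)) = (\<Sum>i\<in>J. d i) / S"
    proof -
      have "(\<Sum>i\<in>J. (c i / S) *\<^sub>R (d i / c i)) = (\<Sum>i\<in>J. d i / S)"
        using J(3) by (intro sum.cong refl) (auto simp: less_imp_neq[symmetric])
      then show ?thesis by (simp add: sum_divide_distrib)
    qed
    also have "(\<Sum>i\<in>J. (c i / S) * (d i / c i) powr p) = (\<Sum>i\<in>J. c i powr (1 - p) * d i powr p) / S"
    proof -
      have "(c i / S) * (d i / c i) powr p = c i powr (1 - p) * d i powr p / S" if "i \<in> J" for i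
        using J(3,4)[OF that] by (simp add: powr_divide powr_diff)
      then show ?thesis unfolding sum_divide_distrib by (intro sum.cong refl)
    qed
    finally have "((\<Sum>i\<in>J. d i) / S) powr p * S powr p \<le> (\<Sum>i\<in>J. c i powr (1 - p) * d i powr p) / S * S powr p"
      by (intro mult_right_mono) auto
    then have "(\<Sum>i\<in>J. d i) powr p \<le> S powr (p - 1) * (\<Sum>i\<in>J. c i powr (1 - p) * d i powr p)"
      using S J by (simp add: powr_divide powr_diff sum_nonneg less_imp_le mult.commute)
    also have "\<dots> \<le> (\<Sum>i\<in>I. c i) powr (p - 1) * (\<Sum>i\<in>I. c i powr (1 - p) * d i powr p)"
      unfolding S_def using assms J
      by (intro mult_mono powr_mono2 sum_mono2 sum_nonneg) (auto intro: less_imp_le)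
    finally show ?thesis unfolding dJ .
  qed
qed

lemma decay_measurable [measurable]: "decay \<alpha> \<tau> \<in> borel_measurable borel"
  unfolding decay_def by measurable

section \<open>Besov norms of sums of bumps\<close>

context regular_space
begin

lemma besov_energy_le_sum:
  assumes "finite I" and v: "\<And>i. i \<in> I \<Longrightarrow> v i \<in> borel_measurable M"
    and w: "\<And>i. i \<in> I \<Longrightarrow> 0 \<le> w i"
    and le: "\<And>x y. \<bar>f x - f y\<bar> powr p \<le> (\<Sum>i\<in>I. w i * \<bar>v i x - v i y\<bar> powr p)"
    and e: "\<And>i. i \<in> I \<Longrightarrow> 0 \<le> e i"
    and G: "\<And>i. i \<in> I \<Longrightarrow> G i \<in> borel_measurable M"
      "\<And>i x. i \<in> I \<Longrightarrow> besov_average M p (v i) t x \<le> G i x"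
      "\<And>i. i \<in> I \<Longrightarrow> (\<integral>\<^sup>+x. G i x \<partial>M) \<le> ennreal (e i)"
  shows "besov_energy M p f t \<le> ennreal (\<Sum>i\<in>I. w i * e i)"
proof -
  have avg: "besov_average M p f t x \<le> (\<Sum>i\<in>I. ennreal (w i) * G i x)" for x
  proof -
    have "(\<integral>\<^sup>+y\<in>ball x t. ennreal (\<bar>f x - f y\<bar> powr p) \<partial>M)
        \<le> (\<integral>\<^sup>+y. (\<Sum>i\<in>I. ennreal (w i) * (ennreal (\<bar>v i x - v i y\<bar> powr p) * indicator (ball x t) y)) \<partial>M)"
    proof (intro nn_integral_mono)
      fix y
      have "ennreal (\<bar>f x - f y\<bar> powr p) \<le> ennreal (\<Sum>i\<in>I. w i * \<bar>v i x - v i y\<bar> powr p)"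
        by (rule ennreal_leI[OF le])
      also have "\<dots> = (\<Sum>i\<in>I. ennreal (w i) * ennreal (\<bar>v i x - v i y\<bar> powr p))"
        using w by (subst sum_ennreal[symmetric]) (auto simp: ennreal_mult)
      finally show "ennreal (\<bar>f x - f y\<bar> powr p) * indicator (ball x t) y
        \<le> (\<Sum>i\<in>I. ennreal (w i) * (ennreal (\<bar>v i x - v i y\<bar> powr p) * indicator (ball x t) y))"
        by (cases "y \<in> ball x t") auto
    qed
    also have "\<dots> = (\<Sum>i\<in>I. ennreal (w i) * (\<integral>\<^sup>+y\<in>ball x t. ennreal (\<bar>v i x - v i y\<bar> powr p) \<partial>M))"
    proof -
      have [measurable]: "v i \<in> borel_measurable M" if "i \<in> I" for i using v[OF that] .
      show ?thesis by (subst nn_integral_sum) (auto intro!: sum.cong nn_integral_cmult)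
    qed
    finally have "besov_average M p f t x \<le>
       (\<Sum>i\<in>I. ennreal (w i) * (\<integral>\<^sup>+y\<in>ball x t. ennreal (\<bar>v i x - v i y\<bar> powr p) \<partial>M)) / emeasure M (ball x t)"
      unfolding besov_average_def by (rule divide_right_mono_ennreal)
    also have "\<dots> = (\<Sum>i\<in>I. ennreal (w i) * besov_average M p (v i) t x)"
      by (simp add: besov_average_def divide_ennreal_def sum_distrib_right mult.assoc)
    also have "\<dots> \<le> (\<Sum>i\<in>I. ennreal (w i) * G i x)"
      by (intro sum_mono mult_left_mono G) auto
    finally show ?thesis .
  qed
  have "besov_energy M p f t \<le> (\<integral>\<^sup>+x. (\<Sum>i\<in>I. ennreal (w i) * G i x) \<partial>M)"
    unfolding besov_energy_average by (intro nn_integral_mono avg)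
  also have "\<dots> = (\<Sum>i\<in>I. ennreal (w i) * (\<integral>\<^sup>+x. G i x \<partial>M))"
    using G(1) by (subst nn_integral_sum) (auto intro!: sum.cong nn_integral_cmult)
  also have "\<dots> \<le> (\<Sum>i\<in>I. ennreal (w i) * ennreal (e i))"
    by (intro sum_mono mult_left_mono G) auto
  also have "\<dots> = ennreal (\<Sum>i\<in>I. w i * e i)"
    using w e by (subst sum_ennreal[symmetric]) (auto simp: ennreal_mult)
  finally show ?thesis .
qed

lemma besov_energy_le_bumps:
  assumes "0 < s" "s < 1" "p = Q / s" "\<alpha> = min s (1 - s)" "0 < t" "finite I"
    and "\<And>i. i \<in> I \<Longrightarrow> 0 < \<tau> i" "\<And>i. i \<in> I \<Longrightarrow> 0 \<le> w i"
    and le: "\<And>x y. \<bar>f x - f y\<bar> powr p \<le> (\<Sum>i\<in>I. w i * \<bar>bump (c i) (\<tau> i) x - bump (c i) (\<tau> i) y\<bar> powr p)"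
  shows "besov_energy M p f t \<le> ennreal (\<Sum>i\<in>I. w i * (bump_const * t powr Q * decay \<alpha> (\<tau> i) t powr p))"
proof -
  have "\<exists>G. G \<in> borel_measurable M \<and> (\<forall>x. besov_average M p (bump (c i) (\<tau> i)) t x \<le> G x) \<and>
    (\<integral>\<^sup>+x. G x \<partial>M) \<le> ennreal (bump_const * t powr Q * decay \<alpha> (\<tau> i) t powr p)" if i: "i \<in> I" for i
    using bump_majorant[OF assms(1-4) assms(7)[OF i] assms(5), of "c i"] by metis
  then obtain G where G: "\<And>i. i \<in> I \<Longrightarrow> G i \<in> borel_measurable M"
    "\<And>i x. i \<in> I \<Longrightarrow> besov_average M p (bump (c i) (\<tau> i)) t x \<le> G i x"
    "\<And>i. i \<in> I \<Longrightarrow> (\<integral>\<^sup>+x. G i x \<partial>M) \<le> ennreal (bump_const * t powr Q * decay \<alpha> (\<tau> i) t powr p)"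
    by metis
  show ?thesis
    by (rule besov_energy_le_sum[where v = "\<lambda>i. bump (c i) (\<tau> i)" and G = G])
       (use assms G bump_const_pos continuous_bump in \<open>auto intro!: continuous_measurable\<close>)
qed

text \<open>The sum \<open>S t\<close> of the decay profiles controls everything: the normalised
  energy is at most of order \<open>S t powr p\<close>, and \<open>S t\<close> is bounded by a
  constant \<open>L\<close>. With the amplitude a = 1 / n this gives the small averages, with a = 1
  the count of order n.\<close>

lemma besov_norm_lacunary_bumps:
  assumes "0 < s" "s < 1" "p = Q / s" "1 < Q" "1 < q"
  obtains K where "0 < K" "\<And>n a c \<tau>. 0 \<le> a \<Longrightarrow> (\<And>k. k < n \<Longrightarrow> 0 < \<tau> k)
    \<Longrightarrow> (\<And>k. Suc k < n \<Longrightarrow> 2 * \<tau> k \<le> \<tau> (Suc k))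
    \<Longrightarrow> besov_norm M s p q (\<lambda>y. a * (\<Sum>k<n. bump (c k) (\<tau> k) y)) \<le> ennpow (ennreal (K * a powr q * n)) (1 / q)"
proof -
  define \<alpha> where "\<alpha> = min s (1 - s)"
  have \<alpha>: "0 < \<alpha>" using assms by (simp add: \<alpha>_def)
  have sQ: "s < Q" using assms by simp
  then have p: "1 < p" using assms by simp
  define L where "L = 2 / (1 - 2 powr - \<alpha>)"
  have "2 powr - \<alpha> < (1::real)" using \<alpha> by (simp add: powr_less_one)
  then have L: "0 < L" by (simp add: L_def)
  define K where "K = bump_const powr (q / p) * L powr (q - 1) * (2 / \<alpha>)"
  show ?thesis
  proof (rule that[of K])
    show "0 < K" unfolding K_def using bump_const_pos L \<alpha> by auto
  next
    fix n :: nat and a :: real and c :: "nat \<Rightarrow> 'a" and \<tau> :: "nat \<Rightarrow> real"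
    assume a: "0 \<le> a" and \<tau>: "\<And>k. k < n \<Longrightarrow> 0 < \<tau> k" "\<And>k. Suc k < n \<Longrightarrow> 2 * \<tau> k \<le> \<tau> (Suc k)"
    let ?v = "\<lambda>k. bump (c k) (\<tau> k)" and ?f = "\<lambda>y. a * (\<Sum>k<n. bump (c k) (\<tau> k) y)"
    define S where "S t = (\<Sum>k<n. decay \<alpha> (\<tau> k) t)" for t
    have S0: "0 \<le> S t" for t unfolding S_def by (intro sum_nonneg decay_nonneg)
    have SL: "S t \<le> L" if "0 < t" for t unfolding S_def L_def using \<alpha> that \<tau> by (intro sum_decay_le) auto
    define h where "h t = bump_const powr (1 / p) * a * S t" for t
    have h0: "0 \<le> h t" for t unfolding h_def using a S0 by simp
    have "besov_norm M s p q ?f \<le> ennpow (\<integral>\<^sup>+t\<in>{0<..}. ennreal (h t powr q / t) \<partial>lborel) (1 / q)"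
    proof (rule besov_norm_le[OF Q_pos assms(1,3)])
      fix t :: real assume t: "0 < t"
      \<comment> \<open>The weights in Jensen's inequality are the decay profiles at the current
        scale. Then \<open>w k\<close> times the energy of the k-th bump is proportional to
        \<open>decay \<alpha> (\<tau> k) t\<close>, and the sum collapses to a power of
        \<open>S t\<close>.\<close>
      define w where "w k = a powr p * S t powr (p - 1) * decay \<alpha> (\<tau> k) t powr (1 - p)" for k
      have dp: "0 < decay \<alpha> (\<tau> k) t" if "k < n" for k using \<tau> that t by (intro decay_pos) auto
      have "besov_energy M p ?f t
         \<le> ennreal (\<Sum>k<n. w k * (bump_const * t powr Q * decay \<alpha> (\<tau> k) t powr p))"
      proof (rule besov_energy_le_bumps[OF assms(1-3) \<alpha>_def t, where c = c])
        fix x y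
        have "\<bar>?f x - ?f y\<bar> = a * \<bar>\<Sum>k<n. ?v k x - ?v k y\<bar>"
          using a by (simp add: abs_mult sum_subtractf flip: right_diff_distrib)
        also have "\<dots> \<le> a * (\<Sum>k<n. \<bar>?v k x - ?v k y\<bar>)" using a by (intro mult_left_mono sum_abs)
        finally have "\<bar>?f x - ?f y\<bar> powr p \<le> (a * (\<Sum>k<n. \<bar>?v k x - ?v k y\<bar>)) powr p"
          using p by (intro powr_mono2) auto
        also have "\<dots> = a powr p * (\<Sum>k<n. \<bar>?v k x - ?v k y\<bar>) powr p"
          using a by (simp add: powr_mult sum_nonneg)
        also have "\<dots> \<le> a powr p * (S t powr (p - 1) * (\<Sum>k<n. decay \<alpha> (\<tau> k) t powr (1 - p) * \<bar>?v k x - ?v k y\<bar> powr p))"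
          unfolding S_def using p dp by (intro mult_left_mono sum_powr_le) auto
        also have "\<dots> = (\<Sum>k<n. w k * \<bar>?v k x - ?v k y\<bar> powr p)"
          by (simp add: w_def sum_distrib_left mult_ac)
        finally show "\<bar>?f x - ?f y\<bar> powr p \<le> (\<Sum>k<n. w k * \<bar>?v k x - ?v k y\<bar> powr p)" .
      qed (use \<tau> in \<open>auto simp: w_def\<close>)
      also have "(\<Sum>k<n. w k * (bump_const * t powr Q * decay \<alpha> (\<tau> k) t powr p))
          = (\<Sum>k<n. (a powr p * S t powr (p - 1) * bump_const * t powr Q) * decay \<alpha> (\<tau> k) t)"
      proof (intro sum.cong refl)
        fix k assume "k \<in> {..<n}"
        then have *: "decay \<alpha> (\<tau> k) t powr (1 - p) * decay \<alpha> (\<tau> k) t powr p = decay \<alpha> (\<tau> k) t"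
          using dp[of k] by (simp flip: powr_add)
        have "w k * (bump_const * t powr Q * decay \<alpha> (\<tau> k) t powr p)
          = (a powr p * S t powr (p - 1) * bump_const * t powr Q)
            * (decay \<alpha> (\<tau> k) t powr (1 - p) * decay \<alpha> (\<tau> k) t powr p)"
          unfolding w_def by (simp only: mult_ac)
        then show "w k * (bump_const * t powr Q * decay \<alpha> (\<tau> k) t powr p)
          = (a powr p * S t powr (p - 1) * bump_const * t powr Q) * decay \<alpha> (\<tau> k) t"
          unfolding * .
      qed
      also have "\<dots> = a powr p * (S t powr (p - 1) * S t) * bump_const * t powr Q"
        unfolding S_def sum_distrib_left[symmetric] by (simp only: mult_ac)
      also have "S t powr (p - 1) * S t = S t powr p"
        using powr_mult_base[OF S0[of t], of "p - 1"] by (simp add: mult.commute)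
      also have "a powr p * S t powr p * bump_const * t powr Q = t powr Q * h t powr p"
        unfolding h_def using a S0[of t] bump_const_pos p by (simp add: powr_mult powr_powr)
      finally show "besov_energy M p ?f t \<le> ennreal (t powr Q * h t powr p)" .
    qed (use h0 assms in auto)
    also have "\<dots> \<le> ennpow (ennreal (K * a powr q * n)) (1 / q)"
    proof (rule ennpow_mono)
      \<comment> \<open>Bounding \<open>S t powr (q - 1)\<close> by \<open>L powr (q - 1)\<close>
        leaves one factor \<open>S t\<close>, whose integral is a sum of n integrals of equal order.
        This is where linear growth in n comes from.\<close>
      define B where "B = bump_const powr (q / p) * a powr q * L powr (q - 1)"
      have B: "0 \<le> B" unfolding B_def by simp
      have "(\<integral>\<^sup>+t\<in>{0<..}. ennreal (h t powr q / t) \<partial>lborel)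
         \<le> (\<integral>\<^sup>+t. (\<Sum>k<n. ennreal B * (ennreal (decay \<alpha> (\<tau> k) t / t) * indicator {0<..} t)) \<partial>lborel)"
      proof (intro nn_integral_mono)
        fix t :: real
        show "ennreal (h t powr q / t) * indicator {0<..} t
          \<le> (\<Sum>k<n. ennreal B * (ennreal (decay \<alpha> (\<tau> k) t / t) * indicator {0<..} t))"
        proof (cases "t > 0")
          case True
          have "h t powr q = bump_const powr (q / p) * a powr q * S t powr q"
            unfolding h_def using a S0[of t] bump_const_pos by (simp add: powr_mult powr_powr)
          also have "S t powr q = S t powr (q - 1) * S t"
            using powr_mult_base[OF S0[of t], of "q - 1"] by (simp add: mult.commute)
          also have "bump_const powr (q / p) * a powr q * (S t powr (q - 1) * S t)
             \<le> bump_const powr (q / p) * a powr q * (L powr (q - 1) * S t)"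
            using S0[of t] SL[OF True] assms by (intro mult_left_mono mult_right_mono powr_mono2) auto
          also have "\<dots> = B * S t" by (simp add: B_def)
          finally have "h t powr q / t \<le> B * S t / t" using True by (intro divide_right_mono) auto
          also have "\<dots> = (\<Sum>k<n. B * (decay \<alpha> (\<tau> k) t / t))"
            by (simp add: S_def sum_distrib_left sum_divide_distrib)
          finally have "ennreal (h t powr q / t) \<le> (\<Sum>k<n. ennreal (B * (decay \<alpha> (\<tau> k) t / t)))"
            using B True by (subst sum_ennreal) (auto intro!: ennreal_leI simp: decay_nonneg)
          then show ?thesis using True B by (simp add: decay_nonneg flip: ennreal_mult)
        qed simp
      qed
      also have "\<dots> = (\<Sum>k<n. ennreal B * (\<integral>\<^sup>+t\<in>{0<..}. ennreal (decay \<alpha> (\<tau> k) t / t) \<partial>lborel))"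
        by (subst nn_integral_sum) (simp_all add: nn_integral_cmult)
      also have "\<dots> \<le> (\<Sum>k<n. ennreal B * ennreal (2 / \<alpha>))"
        using \<alpha> \<tau> by (intro sum_mono mult_left_mono nn_integral_decay) auto
      also have "\<dots> = ennreal (K * a powr q * n)"
        using B \<alpha> by (simp add: K_def B_def ennreal_of_nat_eq_real_of_nat mult_ac flip: ennreal_mult)
      finally show "(\<integral>\<^sup>+t\<in>{0<..}. ennreal (h t powr q / t) \<partial>lborel) \<le> ennreal (K * a powr q * n)" .
    qed (use assms in auto)
    finally show "besov_norm M s p q ?f \<le> ennpow (ennreal (K * a powr q * n)) (1 / q)" .
  qed
qed

text \<open>With at most two nonzero terms the sum is at most twice the largest one, so the constant
  2 powr p is independent of the number of terms.\<close>

lemma abs_sum_powr_le_card_support: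
  fixes d :: "'i \<Rightarrow> real"
  assumes "finite J" "0 < p" "T \<subseteq> J" "card T \<le> 2" "\<And>j. j \<in> J - T \<Longrightarrow> d j = 0"
  shows "\<bar>\<Sum>j\<in>J. d j\<bar> powr p \<le> (\<Sum>j\<in>J. 2 powr p * \<bar>d j\<bar> powr p)"
proof (cases "T = {}")
  case True
  then have "(\<Sum>j\<in>J. d j) = 0" using assms(5) by (intro sum.neutral) simp
  then show ?thesis by (simp add: sum_nonneg)
next
  case False
  have T: "finite T" using assms(1,3) by (rule finite_subset[rotated])
  have "Max ((\<lambda>j. \<bar>d j\<bar>) ` T) \<in> (\<lambda>j. \<bar>d j\<bar>) ` T" using T False by (intro Max_in) auto
  then obtain m where m: "m \<in> T" "\<bar>d m\<bar> = Max ((\<lambda>j. \<bar>d j\<bar>) ` T)" by auto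
  then have m2: "\<bar>d j\<bar> \<le> \<bar>d m\<bar>" if "j \<in> T" for j using T that by simp
  have "\<bar>\<Sum>j\<in>J. d j\<bar> = \<bar>\<Sum>j\<in>T. d j\<bar>" using assms by (subst sum.mono_neutral_right[of J T]) auto
  also have "\<dots> \<le> (\<Sum>j\<in>T. \<bar>d j\<bar>)" by (rule sum_abs)
  also have "\<dots> \<le> real (card T) * \<bar>d m\<bar>" using m2 by (rule sum_bounded_above)
  also have "\<dots> \<le> 2 * \<bar>d m\<bar>" using assms by (intro mult_right_mono) auto
  finally have "\<bar>\<Sum>j\<in>J. d j\<bar> powr p \<le> (2 * \<bar>d m\<bar>) powr p" using assms by (intro powr_mono2) auto
  also have "\<dots> = 2 powr p * \<bar>d m\<bar> powr p" by (simp add: powr_mult)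
  also have "\<dots> \<le> (\<Sum>j\<in>J. 2 powr p * \<bar>d j\<bar> powr p)"
    using m assms by (intro member_le_sum) auto
  finally show ?thesis .
qed

text \<open>Separation by 4 * \<tau> makes at most one bump nonzero at each point, hence at most two
  are involved in a difference of values. The energies therefore add up to n times that of one bump
  at every scale t simultaneously, and the exponent q / p turns the factor n into n powr (q /
  p).\<close>

lemma besov_norm_disjoint_bumps:
  assumes "0 < s" "s < 1" "p = Q / s" "1 < q"
  obtains K where "0 < K" "\<And>n (c :: nat \<Rightarrow> 'a) \<tau>. 0 < \<tau>
    \<Longrightarrow> (\<And>i j. i < n \<Longrightarrow> j < n \<Longrightarrow> i \<noteq> j \<Longrightarrow> 4 * \<tau> \<le> dist (c i) (c j))
    \<Longrightarrow> besov_norm M s p q (\<lambda>y. \<Sum>k<n. bump (c k) \<tau> y) \<le> ennpow (ennreal (K * n powr (q / p))) (1 / q)"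
proof -
  define \<alpha> where "\<alpha> = min s (1 - s)"
  have \<alpha>: "0 < \<alpha>" using assms by (simp add: \<alpha>_def)
  have p: "0 < p" using assms Q_pos by simp
  define K where "K = (2 powr p * bump_const) powr (q / p) * (2 / \<alpha>)"
  show ?thesis
  proof (rule that[of K])
    show "0 < K" unfolding K_def using bump_const_pos \<alpha> by auto
  next
    fix n :: nat and c :: "nat \<Rightarrow> 'a" and \<tau> :: real
    assume \<tau>: "0 < \<tau>" and sep: "\<And>i j. i < n \<Longrightarrow> j < n \<Longrightarrow> i \<noteq> j \<Longrightarrow> 4 * \<tau> \<le> dist (c i) (c j)"
    let ?v = "\<lambda>k. bump (c k) \<tau>" and ?f = "\<lambda>y. \<Sum>k<n. bump (c k) \<tau> y"
    define B where "B = 2 powr p * n * bump_const"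
    have B0: "0 \<le> B" using bump_const_pos by (simp add: B_def)
    define h where "h t = B powr (1 / p) * decay \<alpha> \<tau> t" for t
    have h0: "0 \<le> h t" for t unfolding h_def by (simp add: decay_nonneg)
    have single: "card {k. k < n \<and> ?v k x \<noteq> 0} \<le> 1" for x
    proof -
      have "i = j" if "i < n" "j < n" "?v i x \<noteq> 0" "?v j x \<noteq> 0" for i j
      proof (rule ccontr)
        assume "i \<noteq> j"
        then have "4 * \<tau> \<le> dist (c i) (c j)" using sep that by auto
        also have "\<dots> \<le> dist x (c i) + dist x (c j)" using dist_triangle2[of "c i" "c j" x] by (simp add: dist_commute)
        also have "\<dots> < 4 * \<tau>" using that bump_eq_0[OF \<tau>, of x "c i"] bump_eq_0[OF \<tau>, of x "c j"] by fastforce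
        finally show False by simp
      qed
      then show ?thesis unfolding One_nat_def by (subst card_le_Suc0_iff_eq) auto
    qed
    have "besov_norm M s p q ?f \<le> ennpow (\<integral>\<^sup>+t\<in>{0<..}. ennreal (h t powr q / t) \<partial>lborel) (1 / q)"
    proof (rule besov_norm_le[OF Q_pos assms(1,3)])
      fix t :: real assume t: "0 < t"
      have "besov_energy M p ?f t
         \<le> ennreal (\<Sum>k<n. 2 powr p * (bump_const * t powr Q * decay \<alpha> \<tau> t powr p))"
      proof (rule besov_energy_le_bumps[OF assms(1-3) \<alpha>_def t, where c = c])
        fix x y
        let ?T = "{k. k < n \<and> ?v k x \<noteq> 0} \<union> {k. k < n \<and> ?v k y \<noteq> 0}"
        have "card ?T \<le> 2" using single[of x] single[of y] card_Un_le[of "{k. k < n \<and> ?v k x \<noteq> 0}" "{k. k < n \<and> ?v k y \<noteq> 0}"] by linarith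
        then have "\<bar>\<Sum>k<n. ?v k x - ?v k y\<bar> powr p \<le> (\<Sum>k<n. 2 powr p * \<bar>?v k x - ?v k y\<bar> powr p)"
          using p by (intro abs_sum_powr_le_card_support[where T = ?T]) auto
        then show "\<bar>?f x - ?f y\<bar> powr p \<le> (\<Sum>k<n. 2 powr p * \<bar>?v k x - ?v k y\<bar> powr p)"
          by (simp add: sum_subtractf)
      qed (use \<tau> in auto)
      also have "(\<Sum>k<n. 2 powr p * (bump_const * t powr Q * decay \<alpha> \<tau> t powr p)) = t powr Q * h t powr p"
        unfolding h_def using B0 p by (simp add: powr_mult powr_powr decay_nonneg) (simp add: B_def)
      finally show "besov_energy M p ?f t \<le> ennreal (t powr Q * h t powr p)" .
    qed (use h0 assms in auto)
    also have "\<dots> \<le> ennpow (ennreal (K * n powr (q / p))) (1 / q)"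
    proof (rule ennpow_mono)
      have "(\<integral>\<^sup>+t\<in>{0<..}. ennreal (h t powr q / t) \<partial>lborel)
         \<le> (\<integral>\<^sup>+t. ennreal (B powr (q / p)) * (ennreal (decay \<alpha> \<tau> t / t) * indicator {0<..} t) \<partial>lborel)"
      proof (intro nn_integral_mono)
        fix t :: real
        show "ennreal (h t powr q / t) * indicator {0<..} t
          \<le> ennreal (B powr (q / p)) * (ennreal (decay \<alpha> \<tau> t / t) * indicator {0<..} t)"
        proof (cases "t > 0")
          case True
          have d: "0 < decay \<alpha> \<tau> t" "decay \<alpha> \<tau> t \<le> 1" using decay_pos decay_le_1 \<tau> True \<alpha> by auto
          have "h t powr q = B powr (q / p) * decay \<alpha> \<tau> t powr q"
            unfolding h_def using B0 by (simp add: powr_mult powr_powr decay_nonneg)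
          also have "decay \<alpha> \<tau> t powr q \<le> decay \<alpha> \<tau> t powr 1" using d assms by (intro powr_mono') auto
          also have "\<dots> = decay \<alpha> \<tau> t" using d by simp
          finally have "h t powr q / t \<le> B powr (q / p) * decay \<alpha> \<tau> t / t"
            using True by (intro divide_right_mono) (auto simp: mult_left_mono)
          then have "ennreal (h t powr q / t) \<le> ennreal (B powr (q / p) * (decay \<alpha> \<tau> t / t))"
            by (intro ennreal_leI) simp
          then show ?thesis using True by (simp add: decay_nonneg flip: ennreal_mult)
        qed simp
      qed
      also have "\<dots> = ennreal (B powr (q / p)) * (\<integral>\<^sup>+t\<in>{0<..}. ennreal (decay \<alpha> \<tau> t / t) \<partial>lborel)"
        by (intro nn_integral_cmult) measurable
      also have "\<dots> \<le> ennreal (B powr (q / p)) * ennreal (2 / \<alpha>)"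
        using \<alpha> \<tau> by (intro mult_left_mono nn_integral_decay) auto
      also have "\<dots> = ennreal (K * n powr (q / p))"
        using \<alpha> bump_const_pos by (simp add: K_def B_def powr_mult mult_ac flip: ennreal_mult)
      finally show "(\<integral>\<^sup>+t\<in>{0<..}. ennreal (h t powr q / t) \<partial>lborel) \<le> ennreal (K * n powr (q / p))" .
    qed (use assms in auto)
    finally show "besov_norm M s p q ?f \<le> ennpow (ennreal (K * n powr (q / p))) (1 / q)" .
  qed
qed

end

section \<open>Packing and lower bounds for the energy\<close>

definition separated :: "real \<Rightarrow> 'a::metric_space set \<Rightarrow> bool" where
  "separated r T \<longleftrightarrow> (\<forall>x\<in>T. \<forall>y\<in>T. x \<noteq> y \<longrightarrow> r \<le> dist x y)"

lemma maximal_separated: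
  fixes S :: "'a::metric_space set"
  assumes "0 < r" and N: "\<And>T. finite T \<Longrightarrow> T \<subseteq> S \<Longrightarrow> separated r T \<Longrightarrow> card T \<le> N"
  obtains T where "finite T" "T \<subseteq> S" "separated r T" "S \<subseteq> (\<Union>x\<in>T. ball x r)"
proof -
  let ?P = "\<lambda>T. finite T \<and> T \<subseteq> S \<and> separated r T"
  have e: "?P {}" by (simp add: separated_def)
  have "\<forall>T. ?P T \<longrightarrow> card T < Suc N" using N by (simp add: less_Suc_eq_le)
  from ex_has_greatest_nat[of ?P, OF e this] obtain T
    where TP: "?P T \<and> (\<forall>T'. ?P T' \<longrightarrow> card T' \<le> card T)" by (rule exE)
  then have T: "?P T" and mx: "\<And>T'. ?P T' \<Longrightarrow> card T' \<le> card T" by simp_all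
  have "S \<subseteq> (\<Union>x\<in>T. ball x r)"
  proof
    fix y assume y: "y \<in> S"
    show "y \<in> (\<Union>x\<in>T. ball x r)"
    proof (rule ccontr)
      assume n: "y \<notin> (\<Union>x\<in>T. ball x r)"
      then have "y \<notin> T" using assms(1) by auto
      moreover have "?P (insert y T)" using n T y by (auto simp: separated_def not_less dist_commute)
      ultimately show False using mx[of "insert y T"] T by simp
    qed
  qed
  with T that show ?thesis by blast
qed

lemma separated_disjoint_balls:
  assumes "separated r T" "2 * \<rho> \<le> r"
  shows "disjoint_family_on (\<lambda>x. ball x \<rho>) T"
  unfolding disjoint_family_on_def
proof (intro ballI impI)
  fix x y assume "x \<in> T" "y \<in> T" "x \<noteq> y"
  then have "2 * \<rho> \<le> dist x y" using assms unfolding separated_def by (meson order_trans)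
  then show "ball x \<rho> \<inter> ball y \<rho> = {}" by (simp add: disjoint_ballI)
qed

section \<open>Volume packing and lower bounds for the energy\<close>

context regular_space
begin

definition packing_const :: real where "packing_const = C * C * 4 powr Q"

lemma packing_const_pos: "0 < packing_const"
  using C_ge_1 by (simp add: packing_const_def)

text \<open>Balls of radius r / 2 about the points are disjoint and lie in a ball of radius 2 * R;
  the ratio of these radii accounts for the 4 in \<open>packing_const\<close>.\<close>

lemma packing:
  fixes S :: "'a set"
  assumes "finite S" "separated r S" "S \<subseteq> ball c R" "0 < r" "r \<le> R"
  shows "card S \<le> packing_const * (R / r) powr Q"
proof (cases "\<exists>x\<in>S. \<exists>y\<in>S. x \<noteq> y")
  case True
  then obtain x y where "x \<in> S" "y \<in> S" "x \<noteq> y" by blast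
  then have xy: "r / 2 < dist x y" using assms unfolding separated_def by fastforce
  have "card S * ((r / 2) powr Q / C) = (\<Sum>x\<in>S. (r / 2) powr Q / C)" by simp
  also have "\<dots> \<le> (\<Sum>x\<in>S. measure M (ball x (r / 2)))"
    using assms xy by (intro sum_mono measure_lower) auto
  also have "\<dots> = measure M (\<Union>x\<in>S. ball x (r / 2))"
    using assms separated_disjoint_balls[of r S "r / 2"] emeasure_ball_finite
    by (intro measure_finite_Union[symmetric]) (auto simp: less_top)
  also have "\<dots> \<le> measure M (ball c (2 * R))"
  proof (rule measure_mono_finite)
    show "(\<Union>x\<in>S. ball x (r / 2)) \<subseteq> ball c (2 * R)"
    proof
      fix z assume "z \<in> (\<Union>x\<in>S. ball x (r / 2))"
      then obtain x where "x \<in> S" "dist x z < r / 2" by auto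
      then show "z \<in> ball c (2 * R)" using assms dist_triangle[of c z x] by (fastforce simp: subset_iff)
    qed
  qed (use assms in auto)
  also have "\<dots> \<le> C * (2 * R) powr Q" using assms by (intro measure_upper) auto
  finally have "card S * ((r / 2) powr Q / C) \<le> C * (2 * R) powr Q" .
  then have "card S \<le> C * C * ((2 * R) powr Q / (r / 2) powr Q)" using assms C_ge_1 by (simp add: field_simps)
  also have "(2 * R) powr Q / (r / 2) powr Q = (4 * (R / r)) powr Q" using assms by (simp flip: powr_divide)
  also have "\<dots> = 4 powr Q * (R / r) powr Q" using assms by (intro powr_mult)
  finally show ?thesis by (simp add: packing_const_def)
next
  \<comment> \<open>With at most one point there is no pair to justify the lower volume bound at
    radius r / 2. The claim then follows from r \<le> R, which makes the right-hand side at least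
    1.\<close>
  case False
  then have "card S \<le> Suc 0" using assms by (subst card_le_Suc0_iff_eq) auto
  moreover have "1 * 1 \<le> packing_const * (R / r) powr Q"
    using assms C_ge_1 Q_pos mult_mono[of 1 C 1 C] unfolding packing_const_def
    by (intro mult_mono ge_one_powr_ge_zero mult_ge1_I) auto
  ultimately show ?thesis by simp
qed

lemma maximal_separated_in_ball:
  fixes S :: "'a set"
  assumes "0 < r" "r \<le> R" "S \<subseteq> ball c R"
  obtains T where "finite T" "T \<subseteq> S" "separated r T" "S \<subseteq> (\<Union>x\<in>T. ball x r)"
    "card T \<le> packing_const * (R / r) powr Q"
proof -
  have "card T \<le> nat \<lfloor>packing_const * (R / r) powr Q\<rfloor>" if "finite T" "T \<subseteq> S" "separated r T" for T
    using packing[of T r c R] that assms by (simp add: le_nat_floor)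
  then obtain T where T: "finite T" "T \<subseteq> S" "separated r T" "S \<subseteq> (\<Union>x\<in>T. ball x r)"
    using maximal_separated[OF assms(1)] by metis
  then show ?thesis using packing[of T r c R] assms by (intro that[of T]) auto
qed

text \<open>Every point of \<open>A i\<close> has all of \<open>Z i\<close> inside its ball of
  radius t, so its average is at least of order m_2 * \<eta> / t powr Q; this is then integrated
  over the sets \<open>A i\<close>. Only these must be disjoint, the sets \<open>Z i\<close> may
  overlap.\<close>

lemma besov_energy_ge_disjoint:
  assumes "finite I" "0 < t" "0 \<le> \<eta>" "0 \<le> m\<^sub>1" "0 \<le> m\<^sub>2"
    and meas: "\<And>i. i \<in> I \<Longrightarrow> A i \<in> sets M" "\<And>i. i \<in> I \<Longrightarrow> Z i \<in> sets M"
    and disj: "disjoint_family_on A I"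
    and far: "\<And>i a z. i \<in> I \<Longrightarrow> a \<in> A i \<Longrightarrow> z \<in> Z i \<Longrightarrow> dist a z < t \<and> \<eta> \<le> \<bar>F a - F z\<bar> powr p"
    and m: "\<And>i. i \<in> I \<Longrightarrow> ennreal m\<^sub>1 \<le> emeasure M (A i)" "\<And>i. i \<in> I \<Longrightarrow> ennreal m\<^sub>2 \<le> emeasure M (Z i)"
  shows "ennreal (card I * (m\<^sub>1 * m\<^sub>2 * \<eta> / (C * t powr Q))) \<le> besov_energy M p F t"
proof -
  define \<kappa> where "\<kappa> = m\<^sub>2 * \<eta> / (C * t powr Q)"
  have \<kappa>: "0 \<le> \<kappa>" using assms C_ge_1 by (simp add: \<kappa>_def)
  have avg: "ennreal \<kappa> \<le> besov_average M p F t a" if i: "i \<in> I" and a: "a \<in> A i" for i a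
  proof -
    have "ennreal (m\<^sub>2 * \<eta>) \<le> ennreal \<eta> * emeasure M (Z i)"
      using m(2)[OF i] assms by (simp add: ennreal_mult mult.commute mult_left_mono)
    also have "\<dots> = (\<integral>\<^sup>+z. ennreal \<eta> * indicator (Z i) z \<partial>M)"
      using meas i by (simp add: nn_integral_cmult_indicator)
    also have "\<dots> \<le> (\<integral>\<^sup>+y\<in>ball a t. ennreal (\<bar>F a - F y\<bar> powr p) \<partial>M)"
    proof (intro nn_integral_mono)
      fix z show "ennreal \<eta> * indicator (Z i) z \<le> ennreal (\<bar>F a - F z\<bar> powr p) * indicator (ball a t) z"
        using far[OF i a, of z] by (cases "z \<in> Z i") (auto intro: ennreal_leI)
    qed
    finally have "ennreal (m\<^sub>2 * \<eta>) / emeasure M (ball a t) \<le> besov_average M p F t a"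
      unfolding besov_average_def by (rule divide_right_mono_ennreal)
    moreover have "\<kappa> \<le> m\<^sub>2 * \<eta> / measure M (ball a t)"
      unfolding \<kappa>_def using assms measure_ball_pos[of t a] measure_upper[of t a] C_ge_1
      by (intro divide_left_mono) auto
    then have "ennreal \<kappa> \<le> ennreal (m\<^sub>2 * \<eta>) / emeasure M (ball a t)"
      using assms measure_ball_pos[of t a] by (simp add: emeasure_ball divide_ennreal ennreal_leI)
    ultimately show ?thesis by simp
  qed
  have "ennreal (card I * (m\<^sub>1 * m\<^sub>2 * \<eta> / (C * t powr Q))) = (\<Sum>i\<in>I. ennreal \<kappa> * ennreal m\<^sub>1)"
    using assms C_ge_1 \<kappa> by (simp add: \<kappa>_def ennreal_of_nat_eq_real_of_nat mult_ac flip: ennreal_mult)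
  also have "\<dots> \<le> (\<Sum>i\<in>I. ennreal \<kappa> * emeasure M (A i))" by (intro sum_mono mult_left_mono m) auto
  also have "\<dots> = (\<integral>\<^sup>+x. (\<Sum>i\<in>I. ennreal \<kappa> * indicator (A i) x) \<partial>M)"
    using meas by (subst nn_integral_sum) (auto simp: nn_integral_cmult_indicator)
  also have "\<dots> \<le> besov_energy M p F t"
    unfolding besov_energy_average
  proof (intro nn_integral_mono)
    fix x
    show "(\<Sum>i\<in>I. ennreal \<kappa> * indicator (A i) x) \<le> besov_average M p F t x"
    proof (cases "\<exists>i\<in>I. x \<in> A i")
      case True
      then obtain i where i: "i \<in> I" "x \<in> A i" by blast
      have "(\<Sum>j\<in>I. ennreal \<kappa> * indicator (A j) x) = (\<Sum>j\<in>I. if j = i then ennreal \<kappa> else 0)"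
      proof (intro sum.cong refl)
        fix j assume j: "j \<in> I"
        have "x \<notin> A j" if "j \<noteq> i" using disj j i that unfolding disjoint_family_on_def by blast
        then show "ennreal \<kappa> * indicator (A j) x = (if j = i then ennreal \<kappa> else 0)" using i by auto
      qed
      also have "\<dots> = ennreal \<kappa>" using i assms by simp
      finally show ?thesis using avg[OF i] by simp
    next
      case False
      then have "(\<Sum>i\<in>I. ennreal \<kappa> * indicator (A i) x) = 0" by (intro sum.neutral) auto
      then show ?thesis by simp
    qed
  qed
  finally show ?thesis .
qed

text \<open>The Besov energy analogue of the fact that continua have positive capacity. At each point of \<open>E\<close>
  the function rises from \<open>1/2\<close> to \<open>1\<close> as the scale \<open>\<rho> / 2^k\<close> decreases, hence somewhere by
  about \<open>2 powr (- k / (2 * p))\<close>. Since \<open>E\<close> is connected, for some \<open>k\<close> at least about \<open>2 powr (k / 2)\<close>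
  disjoint balls of radius \<open>\<rho> / 2^k\<close> are centred at points where this happens at scale \<open>k\<close>.\<close>

lemma besov_energy_ge_connected:
  assumes p: "1 \<le> p" and A: "1 \<le> A" and b: "0 < b"
  obtains \<kappa> where "0 < \<kappa>" "\<And>F E \<rho> e\<^sub>0 e\<^sub>1. continuous_on UNIV F \<Longrightarrow> connected E \<Longrightarrow> e\<^sub>0 \<in> E \<Longrightarrow> e\<^sub>1 \<in> E
    \<Longrightarrow> 0 < \<rho> \<Longrightarrow> \<rho> \<le> dist e\<^sub>0 e\<^sub>1 \<Longrightarrow> (\<And>x. x \<in> E \<Longrightarrow> 1 \<le> F x)
    \<Longrightarrow> (\<And>x. x \<in> E \<Longrightarrow> dist e\<^sub>0 x \<le> \<rho> \<Longrightarrow> b * \<rho> powr Q \<le> measure M (ball x (A * \<rho>) \<inter> {y. F y \<le> 1 / 2}))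
    \<Longrightarrow> \<exists>t\<^sub>0>0. \<forall>t\<in>{t\<^sub>0..2 * t\<^sub>0}. ennreal (\<kappa> * t powr Q) \<le> besov_energy M p F t"
proof -
  \<comment> \<open>This exponent makes the loss from a jump of size 2 powr (-\<epsilon> * k),
    raised to the power p, equal to 2 powr (-k / 2). It is compensated exactly by the number 2 powr
    (k / 2) of balls at scale k.\<close>
  define \<epsilon> where "\<epsilon> = 1 / (2 * p)"
  have \<epsilon>: "0 < \<epsilon>" "\<epsilon> * p = 1 / 2" using p by (auto simp: \<epsilon>_def)
  define \<delta> where "\<delta> = (1 - 2 powr - \<epsilon>) / 4"
  have \<delta>: "0 < \<delta>" using \<epsilon> by (simp add: \<delta>_def powr_less_one)
  \<comment> \<open>The thresholds start at 1 / 2, stay below 3 / 4 and so below the values of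
    \<open>F\<close> on \<open>E\<close>, and have increments \<delta> * 2 powr (-\<epsilon> *
    k).\<close>
  define th where "th k = 1 / 2 + (1 - 2 powr (- \<epsilon> * real k)) / 4" for k :: nat
  have th0: "th 0 = 1 / 2" by (simp add: th_def)
  have th1: "th k < 3 / 4" for k by (simp add: th_def)
  have thS: "th (Suc k) - th k = \<delta> * 2 powr (- \<epsilon> * k)" for k
    by (simp add: th_def \<delta>_def distrib_left powr_diff powr_minus field_simps)
  \<comment> \<open>The bound 1 / (2 * C) ensures that when the sublevel set takes up less than b'
    times the power of the radius, the rest of the ball still has at least that measure.\<close>
  define b' where "b' = min b (1 / (2 * C))"
  have b': "0 < b'" "b' \<le> b" "2 * b' \<le> 1 / C" using b C_ge_1 by (auto simp: b'_def min_def field_simps)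
  define \<gamma> :: real where "\<gamma> = 2 powr - (1 / 2)"
  have \<gamma>: "0 < \<gamma>" "\<gamma> < 1" by (auto simp: \<gamma>_def powr_less_one)
  have \<gamma>k: "2 powr (k / 2) / 2 ^ k = \<gamma> ^ k" for k :: nat
  proof -
    have "\<gamma> ^ k = \<gamma> powr k" using \<gamma> by (simp add: powr_realpow)
    also have "\<dots> = 2 powr (k / 2 - k)" by (simp add: \<gamma>_def powr_powr)
    also have "\<dots> = 2 powr (k / 2) / 2 powr k" by (rule powr_diff)
    also have "\<dots> = 2 powr (k / 2) / 2 ^ k" by (simp add: powr_realpow)
    finally show ?thesis by simp
  qed
  \<comment> \<open>At most \<open>c\<^sub>0 * 2 powr (k / 2)\<close> intervals of length
    \<open>4 * R k\<close> for each k have total length at most \<rho> / 2: the lengths form a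
    geometric series of ratio \<gamma>, which the factor 1 - \<gamma> sums out.\<close>
  define c\<^sub>0 where "c\<^sub>0 = (1 - \<gamma>) / (8 * A)"
  have c\<^sub>0: "0 < c\<^sub>0" using \<gamma> A by (simp add: c\<^sub>0_def)
  define \<kappa> where "\<kappa> = c\<^sub>0 * b' * b' * 2 powr - Q * \<delta> powr p * (4 * A) powr (- 2 * Q) / C"
  show ?thesis
  proof (rule that[of \<kappa>])
    show "0 < \<kappa>" using c\<^sub>0 b' \<delta> A C_ge_1 by (simp add: \<kappa>_def)
  next
    fix F :: "'a \<Rightarrow> real" and E \<rho> and e\<^sub>0 e\<^sub>1 :: 'a
    assume F: "continuous_on UNIV F" and E: "connected E" "e\<^sub>0 \<in> E" "e\<^sub>1 \<in> E"
      and \<rho>: "0 < \<rho>" "\<rho> \<le> dist e\<^sub>0 e\<^sub>1" and F1: "\<And>x. x \<in> E \<Longrightarrow> 1 \<le> F x"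
      and low: "\<And>x. x \<in> E \<Longrightarrow> dist e\<^sub>0 x \<le> \<rho> \<Longrightarrow> b * \<rho> powr Q \<le> measure M (ball x (A * \<rho>) \<inter> {y. F y \<le> 1 / 2})"
    note [measurable] = continuous_measurable[OF F]
    have space: "space M = UNIV" using sets_eq_imp_space_eq[OF sets_M] by simp
    have Fle: "{y. F y \<le> u} \<in> sets M" and Fgr: "{y. u < F y} \<in> sets M" for u
      using measurable_sets[OF continuous_measurable[OF F], of "{..u}"]
        measurable_sets[OF continuous_measurable[OF F], of "{u<..}"]
      by (auto simp: space vimage_def)
    define rr where "rr k = \<rho> / 2 ^ k" for k :: nat
    define R where "R k = A * rr k" for k
    have rr: "0 < rr k" "rr (Suc k) = rr k / 2" for k using \<rho> by (auto simp: rr_def)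
    have R: "0 < R k" "R (Suc k) = R k / 2" "rr k \<le> R k" for k
      using rr A by (auto simp: R_def)
    define P where "P k x \<longleftrightarrow> b' * rr k powr Q \<le> measure M (ball x (R k) \<inter> {y. F y \<le> th k})" for k x
    \<comment> \<open>\<open>P\<close> holds at scale 0 by hypothesis, and fails once the ball is so
      small that continuity keeps \<open>F\<close> above 3 / 4 on it. Somewhere in between it
      switches, and there \<open>F\<close> exhibits both low and high values at comparable
      scales.\<close>
    have stop: "\<exists>k. P k x \<and> \<not> P (Suc k) x" if x: "x \<in> E" "dist e\<^sub>0 x \<le> \<rho>" for x
    proof (rule ccontr)
      assume n: "\<nexists>k. P k x \<and> \<not> P (Suc k) x"
      have "P 0 x" unfolding P_def th0
        using low[OF x] mult_right_mono[OF b'(2), of "\<rho> powr Q"] by (simp add: R_def rr_def)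
      with n have all: "P k x" for k by (induction k) auto
      have "open {y. 3 / 4 < F y}" using F by (rule open_Collect_less[OF continuous_on_const])
      moreover have "x \<in> {y. 3 / 4 < F y}" using F1[OF x(1)] by simp
      ultimately obtain d where d: "0 < d" "ball x d \<subseteq> {y. 3 / 4 < F y}" using openE by blast
      obtain k :: nat where "A * \<rho> / d < 2 ^ k" using real_arch_pow[of 2 "A * \<rho> / d"] by auto
      then have "R k < d" using d by (simp add: R_def rr_def field_simps)
      then have "ball x (R k) \<subseteq> {y. 3 / 4 < F y}" using subset_ball[of "R k" d x] d by auto
      then have "ball x (R k) \<inter> {y. F y \<le> th k} = {}" using th1[of k] by fastforce
      then have "b' * rr k powr Q \<le> 0" using all[of k] by (simp add: P_def)
      then show False using b' rr(1)[of k] by (simp add: mult_le_0_iff)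
    qed
    \<comment> \<open>Connectedness of \<open>E\<close> enters only through the radii:
      \<open>E\<close> meets every sphere about \<open>e\<^sub>0\<close> of radius at most \<rho>.
      Counting balls is thereby reduced to measuring sets of radii on the line.\<close>
    have "\<exists>x k. x \<in> E \<and> dist e\<^sub>0 x = u \<and> P k x \<and> \<not> P (Suc k) x" if u: "u \<in> {0..\<rho>}" for u
    proof -
      have "connected (dist e\<^sub>0 ` E)" using E by (intro connected_continuous_image continuous_intros)
      moreover have "dist e\<^sub>0 e\<^sub>0 \<in> dist e\<^sub>0 ` E" "dist e\<^sub>0 e\<^sub>1 \<in> dist e\<^sub>0 ` E" using E by blast+
      ultimately have "u \<in> dist e\<^sub>0 ` E" using connectedD_interval[of "dist e\<^sub>0 ` E" "dist e\<^sub>0 e\<^sub>0" "dist e\<^sub>0 e\<^sub>1" u] u \<rho> by simp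
      then obtain x where "x \<in> E" "dist e\<^sub>0 x = u" by blast
      then show ?thesis using stop[of x] u by auto
    qed
    then obtain x K where xK: "\<And>u. u \<in> {0..\<rho>} \<Longrightarrow> x u \<in> E \<and> dist e\<^sub>0 (x u) = u \<and> P (K u) (x u) \<and> \<not> P (Suc (K u)) (x u)"
      by metis
    define S where "S k = {u \<in> {0..\<rho>}. K u = k}" for k
    \<comment> \<open>Otherwise every \<open>S k\<close> would be covered by few intervals, and
      countably many intervals of total length at most \<rho> / 2 would cover the interval from 0 to
      \<rho>.\<close>
    have "\<exists>k T. finite T \<and> T \<subseteq> S k \<and> separated (2 * R k) T \<and> c\<^sub>0 * 2 powr (k / 2) \<le> card T"
    proof (rule ccontr)
      assume "\<not> ?thesis"
      then have few: "card T < c\<^sub>0 * 2 powr (k / 2)" if "finite T" "T \<subseteq> S k" "separated (2 * R k) T" for k T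
        using that by (meson not_le)
      have "\<exists>T. finite T \<and> T \<subseteq> S k \<and> separated (2 * R k) T \<and> S k \<subseteq> (\<Union>u\<in>T. ball u (2 * R k))" for k
      proof -
        have "card T \<le> nat \<lfloor>c\<^sub>0 * 2 powr (k / 2)\<rfloor>" if "finite T" "T \<subseteq> S k" "separated (2 * R k) T" for T
          using few[OF that] by (simp add: le_nat_floor)
        then show ?thesis using maximal_separated[of "2 * R k" "S k"] R(1)[of k] by (metis mult_pos_pos zero_less_numeral)
      qed
      then obtain T where T: "\<And>k. finite (T k)" "\<And>k. T k \<subseteq> S k" "\<And>k. separated (2 * R k) (T k)"
        "\<And>k. S k \<subseteq> (\<Union>u\<in>T k. ball u (2 * R k))" by metis
      have "ennreal \<rho> = emeasure lborel {0..\<rho>}" using \<rho> by simp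
      also have "\<dots> \<le> emeasure lborel (\<Union>k. \<Union>u\<in>T k. ball u (2 * R k))"
      proof (rule emeasure_mono)
        show "{0..\<rho>} \<subseteq> (\<Union>k. \<Union>u\<in>T k. ball u (2 * R k))" using T(4) by (force simp: S_def)
      qed (simp add: borel_open open_UN)
      also have "\<dots> \<le> (\<Sum>k. emeasure lborel (\<Union>u\<in>T k. ball u (2 * R k)))"
        by (intro emeasure_subadditive_countably) (use T(1) in auto)
      also have "\<dots> \<le> (\<Sum>k. ennreal (\<rho> * (1 - \<gamma>) / 2 * \<gamma> ^ k))"
      proof (rule suminf_le)
        fix k
        have "emeasure lborel (\<Union>u\<in>T k. ball u (2 * R k)) \<le> (\<Sum>u\<in>T k. emeasure lborel (ball u (2 * R k)))"
          using T(1) by (intro emeasure_subadditive_finite) auto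
        also have "\<dots> = (\<Sum>u\<in>T k. ennreal (4 * R k))"
        proof (intro sum.cong refl)
          fix u :: real
          have "ball u (2 * R k) = {u - 2 * R k<..<u + 2 * R k}" by (rule ball_eq_greaterThanLessThan)
          then show "emeasure lborel (ball u (2 * R k)) = ennreal (4 * R k)" using R(1)[of k] by simp
        qed
        also have "\<dots> = ennreal (card (T k) * (4 * R k))"
          using R(1)[of k] by (simp add: ennreal_of_nat_eq_real_of_nat flip: ennreal_mult)
        also have "\<dots> \<le> ennreal (c\<^sub>0 * 2 powr (k / 2) * (4 * R k))"
          using few[OF T(1-3)] R(1)[of k] by (intro ennreal_leI mult_right_mono) (auto intro: less_imp_le)
        also have "c\<^sub>0 * 2 powr (k / 2) * (4 * R k) = \<rho> * (1 - \<gamma>) / 2 * \<gamma> ^ k"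
          unfolding \<gamma>k[symmetric] using A by (simp add: c\<^sub>0_def R_def rr_def)
        finally show "emeasure lborel (\<Union>u\<in>T k. ball u (2 * R k)) \<le> ennreal (\<rho> * (1 - \<gamma>) / 2 * \<gamma> ^ k)" .
      qed auto
      also have "\<dots> = ennreal (\<rho> / 2)"
      proof -
        have "(\<lambda>k. \<rho> * (1 - \<gamma>) / 2 * \<gamma> ^ k) sums (\<rho> * (1 - \<gamma>) / 2 * (1 / (1 - \<gamma>)))"
          using \<gamma> by (intro sums_mult geometric_sums) auto
        moreover have "\<rho> * (1 - \<gamma>) / 2 * (1 / (1 - \<gamma>)) = \<rho> / 2" using \<gamma> by (simp add: field_simps)
        ultimately have "(\<lambda>k. \<rho> * (1 - \<gamma>) / 2 * \<gamma> ^ k) sums (\<rho> / 2)" by (simp only:)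
        then show ?thesis using \<gamma> \<rho>
          by (subst suminf_ennreal2) (auto simp: sums_iff)
      qed
      finally show False using \<rho> by simp
    qed
    then obtain k T where T: "finite T" "T \<subseteq> S k" "separated (2 * R k) T" "c\<^sub>0 * 2 powr (k / 2) \<le> card T"
      by blast
    show "\<exists>t\<^sub>0>0. \<forall>t\<in>{t\<^sub>0..2 * t\<^sub>0}. ennreal (\<kappa> * t powr Q) \<le> besov_energy M p F t"
    \<comment> \<open>Points of concentric balls of radii \<open>R (Suc k)\<close> and
      \<open>R k\<close> are closer than \<open>2 * R k\<close>, so every t from there on sees the
      whole jump.\<close>
    proof (intro exI[of _ "2 * R k"] conjI ballI)
      show "0 < 2 * R k" using R(1)[of k] by simp
      fix t assume t: "t \<in> {2 * R k..2 * (2 * R k)}"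
      then have t0: "0 < t" using R(1)[of k] by auto
      define m\<^sub>1 where "m\<^sub>1 = b' * rr (Suc k) powr Q"
      define m\<^sub>2 where "m\<^sub>2 = b' * rr k powr Q"
      define \<eta> where "\<eta> = \<delta> powr p * 2 powr - (k / 2)"
      let ?A = "\<lambda>u. ball (x u) (R (Suc k)) \<inter> {y. th (Suc k) < F y}"
      let ?Z = "\<lambda>u. ball (x u) (R k) \<inter> {y. F y \<le> th k}"
      have xT: "x u \<in> E" "dist e\<^sub>0 (x u) = u" "P k (x u)" "\<not> P (Suc k) (x u)" if "u \<in> T" for u
        using xK[of u] T(2) that by (auto simp: S_def)
      have finm: "emeasure M (ball z r \<inter> B) = ennreal (measure M (ball z r \<inter> B))" if "B \<in> sets M" for B z r
      proof (rule emeasure_eq_ennreal_measure)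
        have "emeasure M (ball z r \<inter> B) \<le> emeasure M (ball z r)" by (intro emeasure_mono) auto
        then show "emeasure M (ball z r \<inter> B) \<noteq> top" using emeasure_ball_finite[of z r] by (auto simp: top_unique)
      qed
      have "ennreal (card T * (m\<^sub>1 * m\<^sub>2 * \<eta> / (C * t powr Q))) \<le> besov_energy M p F t"
      proof (rule besov_energy_ge_disjoint[where A = ?A and Z = ?Z])
        show "disjoint_family_on ?A T"
          unfolding disjoint_family_on_def
        proof (intro ballI impI)
          fix u w assume uw: "u \<in> T" "w \<in> T" "u \<noteq> w"
          have "2 * R k \<le> dist u w" using T(3) uw by (auto simp: separated_def)
          also have "\<dots> \<le> dist (x u) (x w)"
            using xT(2)[OF uw(1)] xT(2)[OF uw(2)] dist_triangle[of e\<^sub>0 "x u" "x w"] dist_triangle[of e\<^sub>0 "x w" "x u"]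
            by (simp add: dist_real_def dist_commute)
          finally have "ball (x u) (R (Suc k)) \<inter> ball (x w) (R (Suc k)) = {}"
            using R(1)[of k] R(2)[of k] by (intro disjoint_ballI) simp
          then show "?A u \<inter> ?A w = {}" by blast
        qed
      next
        fix u a z assume u: "u \<in> T" and a: "a \<in> ?A u" and z: "z \<in> ?Z u"
        have "dist a z < 2 * R k" using a z R(1,2)[of k] dist_triangle[of a z "x u"] by (simp add: dist_commute)
        moreover have "\<eta> \<le> \<bar>F a - F z\<bar> powr p"
        proof -
          have "\<delta> * 2 powr (- \<epsilon> * k) \<le> \<bar>F a - F z\<bar>" using a z thS[of k] by auto
          then have "(\<delta> * 2 powr (- \<epsilon> * k)) powr p \<le> \<bar>F a - F z\<bar> powr p" using p \<delta> by (intro powr_mono2) auto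
          also have "(\<delta> * 2 powr (- \<epsilon> * k)) powr p = \<delta> powr p * 2 powr (- \<epsilon> * k * p)"
            using \<delta> by (simp add: powr_mult powr_powr)
          also have "- \<epsilon> * k * p = - (\<epsilon> * p) * k" by (simp add: mult_ac)
          also have "\<dots> = - (k / 2)" unfolding \<epsilon>(2) by simp
          also have "\<delta> powr p * 2 powr - (k / 2) = \<eta>" by (simp add: \<eta>_def)
          finally show ?thesis .
        qed
        ultimately show "dist a z < t \<and> \<eta> \<le> \<bar>F a - F z\<bar> powr p" using t by auto
      next
        fix u assume u: "u \<in> T"
        show "ennreal m\<^sub>2 \<le> emeasure M (?Z u)"
          using xT(3)[OF u] unfolding finm[OF Fle] by (auto simp: P_def m\<^sub>2_def intro: ennreal_leI)
        have "m\<^sub>1 \<le> measure M (?A u)"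
        proof -
          let ?B = "ball (x u) (R (Suc k))"
          \<comment> \<open>The lower volume bound at this radius needs two points farther apart;
            \<open>e\<^sub>0\<close> and \<open>e\<^sub>1\<close> serve.\<close>
          have half: "rr (Suc k) < \<rho>" using \<rho> less_1_mult'[of "2::real" "2 ^ k"] by (simp add: rr_def field_simps)
          have "2 * m\<^sub>1 \<le> rr (Suc k) powr Q / C"
            using mult_right_mono[OF b'(3), of "rr (Suc k) powr Q"] by (simp add: m\<^sub>1_def)
          also have "\<dots> \<le> measure M (ball (x u) (rr (Suc k)))"
            using half \<rho> rr(1) by (intro measure_lower[of _ e\<^sub>0 e\<^sub>1]) auto
          also have "\<dots> \<le> measure M ?B" using R(3)[of "Suc k"] by (intro measure_mono_finite[of _ _ "x u" "R (Suc k)"]) auto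
          also have "\<dots> = measure M (?B \<inter> {y. F y \<le> th (Suc k)} \<union> ?A u)"
            by (rule arg_cong[of _ _ "measure M"]) auto
          also have "\<dots> \<le> measure M (?B \<inter> {y. F y \<le> th (Suc k)}) + measure M (?A u)"
            using Fle Fgr by (intro measure_Un_le) auto
          finally show ?thesis using xT(4)[OF u] by (simp add: P_def m\<^sub>1_def)
        qed
        then show "ennreal m\<^sub>1 \<le> emeasure M (?A u)" unfolding finm[OF Fgr] by (rule ennreal_leI)
      qed (use T(1) t0 Fle Fgr b' in \<open>auto simp: m\<^sub>1_def m\<^sub>2_def \<eta>_def\<close>)
      moreover have "\<kappa> * t powr Q \<le> card T * (m\<^sub>1 * m\<^sub>2 * \<eta> / (C * t powr Q))"
      proof -
        have "t / (4 * A) \<le> rr k" using t A by (simp add: R_def field_simps)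
        then have "(t / (4 * A)) powr (2 * Q) \<le> rr k powr (2 * Q)" using t0 A Q_pos by (intro powr_mono2) auto
        moreover have "(t / (4 * A)) powr (2 * Q) = t powr (2 * Q) / (4 * A) powr (2 * Q)"
          by (rule powr_divide)
        moreover have "(4 * A) powr (- 2 * Q) = inverse ((4 * A) powr (2 * Q))"
          using powr_minus[of "4 * A" "2 * Q"] by simp
        ultimately have "t powr (2 * Q) * (4 * A) powr (- 2 * Q) \<le> rr k powr (2 * Q)"
          by (simp only: divide_inverse)
        then have "(c\<^sub>0 * b' * b' * 2 powr - Q * \<delta> powr p / C / t powr Q) * (t powr (2 * Q) * (4 * A) powr (- 2 * Q))
            \<le> (c\<^sub>0 * b' * b' * 2 powr - Q * \<delta> powr p / C / t powr Q) * rr k powr (2 * Q)"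
          using c\<^sub>0 b' C_ge_1 by (intro mult_left_mono) auto
        also have "(c\<^sub>0 * b' * b' * 2 powr - Q * \<delta> powr p / C / t powr Q) * (t powr (2 * Q) * (4 * A) powr (- 2 * Q))
            = \<kappa> * t powr Q"
        proof -
          have "t powr (2 * Q) = t powr Q * t powr Q" by (simp flip: powr_add)
          then show ?thesis using t0 by (simp add: \<kappa>_def)
        qed
        also have "(c\<^sub>0 * b' * b' * 2 powr - Q * \<delta> powr p / C / t powr Q) * rr k powr (2 * Q)
            = c\<^sub>0 * 2 powr (k / 2) * (m\<^sub>1 * m\<^sub>2 * \<eta> / (C * t powr Q))"
        proof -
          have "rr k powr (2 * Q) = rr k powr Q * rr k powr Q" by (simp flip: powr_add)
          moreover have "rr (Suc k) powr Q = rr k powr Q * 2 powr - Q"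
            unfolding rr(2) powr_minus powr_divide[of "rr k" 2 Q] by (rule divide_inverse)
          moreover have "c\<^sub>0 * 2 powr (k / 2) * (b' * (rr k powr Q * 2 powr - Q) * (b' * rr k powr Q) * (\<delta> powr p * 2 powr - (k / 2)) / (C * t powr Q))
              = c\<^sub>0 * b' * b' * 2 powr - Q * \<delta> powr p / C / t powr Q * (rr k powr Q * rr k powr Q) * (2 powr (k / 2) * 2 powr - (k / 2))"
            by (simp add: mult_ac)
          moreover have "2 powr (k / 2) * 2 powr - (k / 2) = (1::real)" by (simp flip: powr_add)
          ultimately show ?thesis unfolding m\<^sub>1_def m\<^sub>2_def \<eta>_def by (simp only: mult_1_right)
        qed
        also have "\<dots> \<le> card T * (m\<^sub>1 * m\<^sub>2 * \<eta> / (C * t powr Q))"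
          using T(4) b' C_ge_1 by (intro mult_right_mono) (auto simp: m\<^sub>1_def m\<^sub>2_def \<eta>_def)
        finally show ?thesis .
      qed
      ultimately show "ennreal (\<kappa> * t powr Q) \<le> besov_energy M p F t"
        by (meson ennreal_leI order_trans)
    qed
  qed
qed

end

section \<open>Quasisymmetric homeomorphisms\<close>

text \<open>Only boundedness of the distortion for each ratio \<open>K\<close> is demanded, with no
  decay of \<open>H\<close> as \<open>K\<close> tends to 0. For homeomorphisms between regular
  spaces with connected domain the decay is recovered in \<open>shrink\<close>.\<close>

definition quasisymmetric :: "('a::metric_space \<Rightarrow> 'b::metric_space) \<Rightarrow> bool" where
  "quasisymmetric f \<longleftrightarrow>
     (\<forall>K. \<exists>H. \<forall>x a b. dist x a \<le> K * dist x b \<longrightarrow> dist (f x) (f a) \<le> H * dist (f x) (f b))"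

lemma quasisymmetricE:
  assumes "quasisymmetric f"
  obtains H where "1 \<le> H" "\<And>x a b. dist x a \<le> K * dist x b \<Longrightarrow> dist (f x) (f a) \<le> H * dist (f x) (f b)"
proof -
  obtain H where H: "\<And>x a b. dist x a \<le> K * dist x b \<Longrightarrow> dist (f x) (f a) \<le> H * dist (f x) (f b)"
    using assms unfolding quasisymmetric_def by metis
  have "dist (f x) (f a) \<le> max 1 H * dist (f x) (f b)" if "dist x a \<le> K * dist x b" for x a b
    using H[OF that] mult_right_mono[of H "max 1 H" "dist (f x) (f b)"] by simp
  then show ?thesis using that[of "max 1 H"] by simp
qed

lemma connected_sphere_point:
  fixes x w :: "'a::metric_space"
  assumes "connected (UNIV :: 'a set)" "0 \<le> r" "r \<le> dist x w"
  obtains b where "dist x b = r"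
proof -
  have "connected (range (dist x))" using assms(1) by (intro connected_continuous_image continuous_intros)
  moreover have "dist x x \<in> range (dist x)" "dist x w \<in> range (dist x)" by blast+
  ultimately have "r \<in> range (dist x)"
    using connectedD_interval[of "range (dist x)" "dist x x" "dist x w" r] assms by simp
  then show ?thesis using that by blast
qed

lemma connected_sphere_point':
  fixes x u v :: "'a::metric_space"
  assumes "connected (UNIV :: 'a set)" "0 \<le> r" "2 * r \<le> dist u v"
  obtains b where "dist x b = r"
proof -
  have "r \<le> dist x u \<or> r \<le> dist x v" using assms dist_triangle3[of u v x] by linarith
  then show ?thesis using connected_sphere_point[OF assms(1,2)] that by metis
qed

section \<open>Quasisymmetric maps between regular spaces of equal dimension\<close>

locale qs_homeo =
  X: regular_space M Q C + Y: regular_space N Q C'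
  for M :: "'a::metric_space measure" and N :: "'b::metric_space measure" and Q C C' +
  fixes f :: "'a \<Rightarrow> 'b" and g :: "'b \<Rightarrow> 'a"
  assumes homeo: "homeomorphism UNIV UNIV f g"
    and connected: "connected (UNIV :: 'a set)"
    and qs: "quasisymmetric f"
begin

lemma gf [simp]: "g (f x) = x" and fg [simp]: "f (g y) = y"
  using homeo by (auto simp: homeomorphism_def)

lemma inj_f: "inj f"
  by (metis gf injI)

lemma f_eq_iff [simp]: "f x = f y \<longleftrightarrow> x = y"
  by (metis gf)

text \<open>Points at distances \<open>4 ^ j * dist x b\<close>, \<open>j \<le> n\<close>, from \<open>x\<close> have images that are
  separated on the scale of \<open>dist (f x) (f b)\<close>, so \<open>n\<close> is controlled by packing.\<close>

lemma shrink:
  assumes "0 < \<epsilon>"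
  obtains \<delta> where "0 < \<delta>" "\<And>x a b. dist x b \<le> \<delta> * dist x a \<Longrightarrow> dist (f x) (f b) \<le> \<epsilon> * dist (f x) (f a)"
proof -
  obtain H where H: "1 \<le> H" "\<And>x a b. dist x a \<le> 2 * dist x b \<Longrightarrow> dist (f x) (f a) \<le> H * dist (f x) (f b)"
    using quasisymmetricE[OF qs] by metis
  \<comment> \<open>If the conclusion failed, n + 1 points of mutual distance at least d / H^2 would
    lie in a ball of radius 2 * H * D with D < d / \<epsilon>. This n exceeds the packing bound for
    the resulting ratio 2 * H^3 / \<epsilon>.\<close>
  obtain n :: nat where n: "Y.packing_const * (2 * H ^ 3 / \<epsilon>) powr Q < n" using reals_Archimedean2 by blast
  show ?thesis
  proof (rule that[of "1 / 4 ^ n"])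
    fix x a b :: 'a assume le: "dist x b \<le> 1 / 4 ^ n * dist x a"
    show "dist (f x) (f b) \<le> \<epsilon> * dist (f x) (f a)"
    proof (rule ccontr)
      assume "\<not> dist (f x) (f b) \<le> \<epsilon> * dist (f x) (f a)"
      then have far: "\<epsilon> * dist (f x) (f a) < dist (f x) (f b)" by simp
      define l where "l = dist x b"
      define D where "D = dist (f x) (f a)"
      define d where "d = dist (f x) (f b)"
      have dp: "0 < d" using far assms zero_le_dist[of "f x" "f a"] unfolding d_def
        by (metis le_less_trans less_eq_real_def mult_nonneg_nonneg)
      then have "x \<noteq> b" by (auto simp: d_def)
      then have l: "0 < l" by (simp add: l_def)
      have la: "4 ^ n * l \<le> dist x a" using le by (simp add: l_def field_simps)
      then have "0 < dist x a" using l by (smt (verit) mult_pos_pos zero_less_power)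
      then have D: "0 < D" by (auto simp: D_def)
      have "\<exists>z. dist x z = 4 ^ j * l" if "j \<le> n" for j
      proof -
        have "(4::real) ^ j * l \<le> 4 ^ n * l" using that l by (intro mult_right_mono power_increasing) auto
        then have "4 ^ j * l \<le> dist x a" using la by linarith
        moreover have "0 \<le> 4 ^ j * l" using l by simp
        ultimately show ?thesis using connected_sphere_point[OF connected] by metis
      qed
      then obtain z where z: "\<And>j. j \<le> n \<Longrightarrow> dist x (z j) = 4 ^ j * l" by metis
      \<comment> \<open>The factor 4 between consecutive distances makes \<open>z j\<close> at least
        half as far from \<open>z i\<close> as from \<open>x\<close>. One factor \<open>H\<close>
        comes from comparison centred at \<open>z j\<close>, the other from comparison centred at
        \<open>x\<close>.\<close>
      have sep: "d / H\<^sup>2 \<le> dist (f (z i)) (f (z j))" if ij: "i < j" "j \<le> n" for i j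
      proof -
        have "4 * 4 ^ i \<le> (4::real) ^ j" using ij power_increasing[of "Suc i" j "4::real"] by simp
        then have "4 * (4 ^ i * l) \<le> 4 ^ j * l" using mult_right_mono[of "4 * 4 ^ i" "4 ^ j" l] l by simp
        then have "4 * dist x (z i) \<le> dist x (z j)" using z[of i] z[of j] ij by simp
        then have "dist (z j) x \<le> 2 * dist (z j) (z i)"
          using dist_triangle[of x "z j" "z i"] zero_le_dist[of "z i" "z j"]
            dist_commute[of "z j" x] dist_commute[of "z j" "z i"] by linarith
        from H(2)[OF this] have 1: "dist (f x) (f (z j)) \<le> H * dist (f (z i)) (f (z j))" by (simp add: dist_commute)
        have "1 * l \<le> 4 ^ j * l" using l by (intro mult_right_mono) auto
        then have "dist x b \<le> 2 * dist x (z j)" using z[of j] ij l unfolding l_def by linarith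
        from H(2)[OF this] have 2: "d \<le> H * dist (f x) (f (z j))" by (simp add: d_def)
        have "d \<le> H * (H * dist (f (z i)) (f (z j)))"
          using order_trans[OF 2 mult_left_mono[OF 1, of H]] H(1) by simp
        then show ?thesis using H(1) by (simp add: field_simps power2_eq_square)
      qed
      have sp: "0 < d / H\<^sup>2" using dp H(1) by simp
      have sep': "d / H\<^sup>2 \<le> dist (f (z i)) (f (z j))" if "i \<noteq> j" "j \<le> n" "i \<le> n" for i j
        using sep[of i j] sep[of j i] that by (cases "i < j") (auto simp: dist_commute)
      have inj: "inj_on (\<lambda>j. f (z j)) {..n}"
        by (rule inj_onI) (use sep' sp in fastforce)
      have "real (card ((\<lambda>j. f (z j)) ` {..n})) \<le> Y.packing_const * ((2 * H * D) / (d / H\<^sup>2)) powr Q"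
      proof (rule Y.packing)
        show "separated (d / H\<^sup>2) ((\<lambda>j. f (z j)) ` {..n})"
          unfolding separated_def using sep' by auto metis
        show "(\<lambda>j. f (z j)) ` {..n} \<subseteq> ball (f x) (2 * H * D)"
        proof clarify
          fix j assume j: "j \<le> n"
          have "(4::real) ^ j * l \<le> 4 ^ n * l" using j l by (intro mult_right_mono power_increasing) auto
          then have "dist x (z j) \<le> 2 * dist x a" using z[OF j] la zero_le_dist[of x a] by linarith
          from H(2)[OF this] have "dist (f x) (f (z j)) \<le> H * D" by (simp add: D_def)
          also have "\<dots> < 2 * H * D" using H(1) D by simp
          finally show "f (z j) \<in> ball (f x) (2 * H * D)" by simp
        qed
        have "dist x b \<le> 2 * dist x a"
        proof -
          have "1 * l \<le> 4 ^ n * l" using l by (intro mult_right_mono) auto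
          then show ?thesis using la zero_le_dist[of x a] unfolding l_def by linarith
        qed
        from H(2)[OF this] have "d \<le> H * D" by (simp add: d_def D_def)
        moreover have "d / H\<^sup>2 \<le> d" using H(1) dp by (simp add: field_simps)
        moreover have "H * D \<le> 2 * H * D" using H(1) D by simp
        ultimately show "d / H\<^sup>2 \<le> 2 * H * D" by linarith
      qed (use sp in auto)
      also have "card ((\<lambda>j. f (z j)) ` {..n}) = Suc n" using inj by (simp add: card_image)
      also have "(2 * H * D) / (d / H\<^sup>2) = 2 * H ^ 3 * (D / d)" by (simp add: power2_eq_square power3_eq_cube)
      also have "\<dots> powr Q \<le> (2 * H ^ 3 / \<epsilon>) powr Q"
      proof (intro powr_mono2)
        have "D / d \<le> 1 / \<epsilon>" using far assms dp by (simp add: D_def d_def field_simps)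
        from mult_left_mono[OF this, of "2 * H ^ 3"] H(1) show "2 * H ^ 3 * (D / d) \<le> 2 * H ^ 3 / \<epsilon>" by simp
      qed (use X.Q_pos H(1) D dp in auto)
      finally have "Suc n \<le> Y.packing_const * (2 * H ^ 3 / \<epsilon>) powr Q"
        using Y.packing_const_pos by (simp add: mult_left_mono)
      with n show False by simp
    qed
  qed simp
qed

text \<open>If \<open>g u\<close> were much farther from \<open>g y\<close> than \<open>g v\<close>
  is, \<open>shrink\<close> would make the distance from y to v at most \<epsilon> times that from y
  to u. With \<epsilon> = 1 / (2 * max K 1) this contradicts the ratio bound
  \<open>K\<close>.\<close>

lemma quasisymmetric_inverse: "quasisymmetric g"
  unfolding quasisymmetric_def
proof
  fix K :: real
  define \<epsilon> where "\<epsilon> = 1 / (2 * max K 1)"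
  have \<epsilon>: "0 < \<epsilon>" "\<epsilon> * max K 1 = 1 / 2" by (auto simp: \<epsilon>_def)
  obtain \<delta> where \<delta>: "0 < \<delta>" "\<And>x a b. dist x b \<le> \<delta> * dist x a \<Longrightarrow> dist (f x) (f b) \<le> \<epsilon> * dist (f x) (f a)"
    using shrink[OF \<epsilon>(1)] by metis
  have "dist (g y) (g u) \<le> 1 / \<delta> * dist (g y) (g v)" if le: "dist y u \<le> K * dist y v" for y u v
  proof (rule ccontr)
    assume "\<not> ?thesis"
    then have lt: "dist (g y) (g v) < \<delta> * dist (g y) (g u)" using \<delta>(1) by (simp add: field_simps)
    then have "dist y v \<le> \<epsilon> * dist y u" using \<delta>(2)[of "g y" "g v" "g u"] by simp
    also have "\<dots> \<le> \<epsilon> * (max K 1 * dist y v)"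
      using le mult_right_mono[of K "max K 1" "dist y v"] \<epsilon>(1) by (intro mult_left_mono) auto
    also have "\<dots> = dist y v / 2" using \<epsilon>(2) by (simp flip: mult.assoc)
    finally have "y = v" by simp
    then have "y = u" using le by simp
    then show False using lt by simp
  qed
  then show "\<exists>H. \<forall>x a b. dist x a \<le> K * dist x b \<longrightarrow> dist (g x) (g a) \<le> H * dist (g x) (g b)" by blast
qed

text \<open>A point whose preimage lies outside \<open>ball x r\<close> is, by the distortion bound,
  at least 1 / H times as far from \<open>f x\<close> as \<open>f b\<close> is.\<close>

lemma ball_subset_image:
  assumes "\<And>x a b. dist x a \<le> 1 * dist x b \<Longrightarrow> dist (f x) (f a) \<le> H * dist (f x) (f b)" "1 \<le> H" "dist x b = r"
  shows "ball (f x) (dist (f x) (f b) / H) \<subseteq> f ` ball x r"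
proof
  fix y assume y: "y \<in> ball (f x) (dist (f x) (f b) / H)"
  have "dist x (g y) < r"
  proof (rule ccontr)
    assume "\<not> dist x (g y) < r"
    then have "dist (f x) (f b) \<le> H * dist (f x) y" using assms(1)[of x b "g y"] assms(3) by simp
    then show False using y assms(2) by (simp add: field_simps)
  qed
  then show "y \<in> f ` ball x r" by (intro image_eqI[of _ _ "g y"]) auto
qed

text \<open>About (r / \<rho>) powr Q balls of radius \<rho> cover the ball of radius r. Were all
  their images of radius below a small multiple of D * \<rho> / r, their total volume would be a
  small multiple of D powr Q, less than the volume of the ball inside the image of the large
  one.\<close>

lemma expanded_pair_at_small_scale:
  obtains c where "0 < c" "\<And>x b \<rho>. 0 < \<rho> \<Longrightarrow> 2 * \<rho> \<le> dist x b \<Longrightarrow>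
    \<exists>x' b'. dist x' b' = \<rho> \<and> c * \<rho> / dist x b * dist (f x) (f b) \<le> dist (f x') (f b')"
proof -
  obtain H where H: "1 \<le> H" "\<And>x a b. dist x a \<le> 1 * dist x b \<Longrightarrow> dist (f x) (f a) \<le> H * dist (f x) (f b)"
    using quasisymmetricE[OF qs] by metis
  define P where "P = X.packing_const"
  have P: "0 < P" using X.packing_const_pos by (simp add: P_def)
  have C': "1 \<le> C'" by (rule Y.C_ge_1)
  have Q: "0 < Q" by (rule X.Q_pos)
  \<comment> \<open>Chosen so that the covering volume P * C' * (2 * H * c) powr Q is half of the
    lower bound for the ball of radius 1 / (2 * H), in units of D. The final 2 * H is the
    enlargement from the size at one partner point to a covering ball.\<close>
  define c where "c = (1 / (2 * P * C' * C')) powr (1 / Q) / (2 * H) / (2 * H)"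
  have c: "0 < c" using P C' H(1) by (simp add: c_def)
  have cQ: "P * C' * (2 * H * c) powr Q < (1 / (2 * H)) powr Q / C'"
  proof -
    have "2 * H * c = (1 / (2 * P * C' * C')) powr (1 / Q) * (1 / (2 * H))" using H(1) by (simp add: c_def)
    then have "(2 * H * c) powr Q = ((1 / (2 * P * C' * C')) powr (1 / Q)) powr Q * (1 / (2 * H)) powr Q"
      by (simp only: powr_mult)
    also have "\<dots> = 1 / (2 * P * C' * C') * (1 / (2 * H)) powr Q" using Q P C' by (simp add: powr_powr)
    finally have *: "P * C' * (2 * H * c) powr Q = (1 / (2 * H)) powr Q / C' * (1 / 2)" using P C' by simp
    have "0 < (1 / (2 * H)) powr Q / C'" using H(1) C' by simp
    then show ?thesis unfolding * by (subst mult_less_cancel_left2) auto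
  qed
  show ?thesis
  proof (rule that[OF c])
    fix x b :: 'a and \<rho> :: real assume \<rho>: "0 < \<rho>" "2 * \<rho> \<le> dist x b"
    define r where "r = dist x b"
    define D where "D = dist (f x) (f b)"
    have r: "0 < r" "\<rho> \<le> r" using \<rho> by (auto simp: r_def)
    then have D: "0 < D" by (auto simp: r_def D_def)
    obtain T where T: "finite T" "T \<subseteq> ball x r" "ball x r \<subseteq> (\<Union>s\<in>T. ball s \<rho>)" "card T \<le> P * (r / \<rho>) powr Q"
      unfolding P_def using X.maximal_separated_in_ball[OF \<rho>(1) r(2) order_refl, of x] by metis
    have "\<exists>b. dist s b = \<rho>" for s :: 'a
      using connected_sphere_point'[OF connected _ \<rho>(2), of s] \<rho>(1) by auto
    then obtain \<beta> :: "'a \<Rightarrow> 'a" where \<beta>: "\<And>s. dist s (\<beta> s) = \<rho>" by metis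
    have "\<exists>s. c * \<rho> / r * D \<le> dist (f s) (f (\<beta> s))"
    proof (rule ccontr)
      assume "\<not> ?thesis"
      then have small: "dist (f s) (f (\<beta> s)) < c * \<rho> / r * D" for s by (simp add: not_le)
      define w where "w = H * (c * \<rho> / r * D)"
      have w: "0 < w" using H(1) c \<rho> r D by (simp add: w_def)
      have sub: "f ` ball s \<rho> \<subseteq> ball (f s) (2 * w)" for s
      proof clarify
        fix y assume "y \<in> ball s \<rho>"
        then have "dist (f s) (f y) \<le> H * dist (f s) (f (\<beta> s))" using H(2)[of s y "\<beta> s"] \<beta>[of s] by simp
        also have "\<dots> \<le> w" unfolding w_def using small[of s] H(1) by (intro mult_left_mono) auto
        finally show "f y \<in> ball (f s) (2 * w)" using w by simp
      qed
      have "(D / (2 * H)) powr Q / C' \<le> measure N (ball (f x) (D / (2 * H)))"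
      proof (rule Y.measure_lower)
        have "D * 1 < D * (2 * H)" using D H(1) by (intro mult_strict_left_mono) auto
        then show "D / (2 * H) < dist (f x) (f b)" using D H(1) by (simp add: D_def[symmetric] field_simps)
      qed (use D H(1) in auto)
      also have "\<dots> \<le> measure N (\<Union>s\<in>T. ball (f s) (2 * w))"
      proof (rule measure_mono_fmeasurable)
        have "ball (f x) (D / (2 * H)) \<subseteq> ball (f x) (D / H)"
          using D H(1) by (intro subset_ball) (simp add: field_simps)
        also have "\<dots> \<subseteq> f ` ball x r" unfolding D_def by (rule ball_subset_image[OF H(2,1)]) (simp_all add: r_def)
        also have "\<dots> \<subseteq> (\<Union>s\<in>T. ball (f s) (2 * w))" using T(3) sub by blast
        finally show "ball (f x) (D / (2 * H)) \<subseteq> (\<Union>s\<in>T. ball (f s) (2 * w))" .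
        show "(\<Union>s\<in>T. ball (f s) (2 * w)) \<in> fmeasurable N"
          using T(1) Y.emeasure_ball_finite by (intro fmeasurable.finite_UN) (auto intro!: fmeasurableI)
      qed auto
      also have "\<dots> \<le> (\<Sum>s\<in>T. measure N (ball (f s) (2 * w)))"
        using T(1) by (intro measure_UNION_le) auto
      also have "\<dots> \<le> (\<Sum>s\<in>T. C' * (2 * w) powr Q)" using w by (intro sum_mono Y.measure_upper) auto
      also have "\<dots> = card T * (C' * (2 * w) powr Q)" by simp
      also have "\<dots> \<le> P * (r / \<rho>) powr Q * (C' * (2 * w) powr Q)" using T(4) C' by (intro mult_right_mono) auto
      also have "\<dots> = P * C' * ((r / \<rho>) * (2 * w)) powr Q" by (subst powr_mult) (simp add: mult_ac)
      also have "(r / \<rho>) * (2 * w) = (2 * H * c) * D" using r \<rho> by (simp add: w_def)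
      also have "P * C' * ((2 * H * c) * D) powr Q = P * C' * (2 * H * c) powr Q * D powr Q"
        by (subst powr_mult) simp
      also have "\<dots> < (1 / (2 * H)) powr Q / C' * D powr Q" using cQ D by (intro mult_strict_right_mono) auto
      also have "\<dots> = (D / (2 * H)) powr Q / C'" using powr_mult[of "1 / (2 * H)" D Q] by simp
      finally show False by simp
    qed
    then show "\<exists>x' b'. dist x' b' = \<rho> \<and> c * \<rho> / dist x b * dist (f x) (f b) \<le> dist (f x') (f b')"
      using \<beta> unfolding r_def D_def by blast
  qed
qed

text \<open>Dual to the previous count: if all images of balls of radius \<rho> were too large, the
  disjoint balls inside them would not fit into the image of a comparable large ball.\<close>

lemma contracted_pair_at_small_scale:
  obtains c where "0 < c" "\<And>x b \<rho>. 0 < \<rho> \<Longrightarrow> 2 * \<rho> \<le> dist x b \<Longrightarrow>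
    \<exists>x' b'. dist x' b' = \<rho> \<and> dist (f x') (f b') \<le> c * \<rho> / dist x b * dist (f x) (f b)"
proof -
  obtain H where H: "1 \<le> H" "\<And>x a b. dist x a \<le> 2 * dist x b \<Longrightarrow> dist (f x) (f a) \<le> H * dist (f x) (f b)"
    using quasisymmetricE[OF qs] by metis
  have H1: "dist (f x) (f a) \<le> H * dist (f x) (f b)" if "dist x a \<le> 1 * dist x b" for x a b
    using H(2)[of x a b] that zero_le_dist[of x b] by linarith
  have C: "1 \<le> C" "1 \<le> C'" by (rule X.C_ge_1 Y.C_ge_1)+
  have Q: "0 < Q" by (rule X.Q_pos)
  \<comment> \<open>The 8 * H is 4 * (2 * H): the 4 comes from the count (r / (4 * \<rho>)) powr Q
    of disjoint balls and 2 * H from their inner radius. The remaining 2 * H is the radius, relative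
    to D, of the ball that contains them all.\<close>
  define c where "c = (2 * C * C * C' * C') powr (1 / Q) * (2 * H) * (8 * H)"
  have c: "0 < c" using C H(1) by (simp add: c_def)
  have cQ: "C' * (2 * H) powr Q < (c / (8 * H)) powr Q / (C * C * C')"
  proof -
    have "c / (8 * H) = (2 * C * C * C' * C') powr (1 / Q) * (2 * H)" using H(1) by (simp add: c_def)
    then have "(c / (8 * H)) powr Q = ((2 * C * C * C' * C') powr (1 / Q)) powr Q * (2 * H) powr Q"
      by (simp only: powr_mult)
    also have "\<dots> = 2 * C * C * C' * C' * (2 * H) powr Q" using Q C by (simp add: powr_powr)
    finally have "(c / (8 * H)) powr Q / (C * C * C') = 2 * (C' * (2 * H) powr Q)" using C by simp
    moreover have "0 < C' * (2 * H) powr Q" using H(1) C by simp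
    ultimately show ?thesis by linarith
  qed
  show ?thesis
  proof (rule that[OF c])
    fix x b :: 'a and \<rho> :: real assume \<rho>: "0 < \<rho>" "2 * \<rho> \<le> dist x b"
    define r where "r = dist x b"
    define D where "D = dist (f x) (f b)"
    have r: "0 < r" "2 * \<rho> \<le> r" using \<rho> by (auto simp: r_def)
    then have D: "0 < D" by (auto simp: r_def D_def)
    \<comment> \<open>One net does both jobs: balls of radius 2 * \<rho> about it cover, so it has
      many points, while balls of radius \<rho> are disjoint, so their images are.\<close>
    obtain T where T: "finite T" "T \<subseteq> ball x r" "separated (2 * \<rho>) T" "ball x r \<subseteq> (\<Union>s\<in>T. ball s (2 * \<rho>))"
      using X.maximal_separated_in_ball[OF _ r(2) order_refl, of x] \<rho>(1) by (metis mult_pos_pos zero_less_numeral)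
    have "\<exists>b. dist s b = \<rho>" for s :: 'a
      using connected_sphere_point'[OF connected _ \<rho>(2), of s] \<rho>(1) by auto
    then obtain \<beta> :: "'a \<Rightarrow> 'a" where \<beta>: "\<And>s. dist s (\<beta> s) = \<rho>" by metis
    have "\<exists>s. dist (f s) (f (\<beta> s)) \<le> c * \<rho> / r * D"
    proof (rule ccontr)
      assume "\<not> ?thesis"
      then have big: "c * \<rho> / r * D < dist (f s) (f (\<beta> s))" for s by (simp add: not_le)
      define w where "w = c * \<rho> / r * D / (2 * H)"
      have w: "0 < w" using H(1) c \<rho> r D by (simp add: w_def)
      have sub: "ball (f s) w \<subseteq> f ` ball s \<rho>" for s
      proof -
        have "w \<le> dist (f s) (f (\<beta> s)) / (2 * H)" unfolding w_def using big[of s] H(1) by (intro divide_right_mono) auto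
        also have "\<dots> \<le> dist (f s) (f (\<beta> s)) / H" using H(1) by (intro divide_left_mono) auto
        finally have "ball (f s) w \<subseteq> ball (f s) (dist (f s) (f (\<beta> s)) / H)" by (rule subset_ball)
        also have "\<dots> \<subseteq> f ` ball s \<rho>" by (rule ball_subset_image[OF H1 H(1) \<beta>])
        finally show ?thesis .
      qed
      have "(r / 2) powr Q / C \<le> measure M (ball x (r / 2))"
        using r by (intro X.measure_lower[of _ x b]) (auto simp: r_def)
      also have "\<dots> \<le> measure M (\<Union>s\<in>T. ball s (2 * \<rho>))"
      proof (rule measure_mono_fmeasurable)
        show "ball x (r / 2) \<subseteq> (\<Union>s\<in>T. ball s (2 * \<rho>))" using T(4) subset_ball[of "r / 2" r x] r by auto
        show "(\<Union>s\<in>T. ball s (2 * \<rho>)) \<in> fmeasurable M"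
          using T(1) X.emeasure_ball_finite by (intro fmeasurable.finite_UN) (auto intro!: fmeasurableI)
      qed auto
      also have "\<dots> \<le> (\<Sum>s\<in>T. measure M (ball s (2 * \<rho>)))"
        using T(1) by (intro measure_UNION_le) auto
      also have "\<dots> \<le> (\<Sum>s\<in>T. C * (2 * \<rho>) powr Q)" using \<rho> by (intro sum_mono X.measure_upper) auto
      finally have "(r / 2) powr Q / C \<le> card T * (C * (2 * \<rho>) powr Q)" by simp
      then have "(r / 2) powr Q / (2 * \<rho>) powr Q / (C * C) \<le> card T" using C \<rho> by (simp add: field_simps)
      also have "(r / 2) powr Q / (2 * \<rho>) powr Q = (r / (4 * \<rho>)) powr Q" using powr_divide[of "r / 2" "2 * \<rho>" Q] by simp
      finally have "(r / (4 * \<rho>)) powr Q / (C * C) * (w powr Q / C') \<le> card T * (w powr Q / C')"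
        using C by (intro mult_right_mono) auto
      also have "\<dots> = (\<Sum>s\<in>T. w powr Q / C')" by simp
      also have "\<dots> \<le> (\<Sum>s\<in>T. measure N (ball (f s) w))"
      proof (intro sum_mono Y.measure_lower[OF w])
        fix s show "w < dist (f s) (f (\<beta> s))"
        proof -
          have "w \<le> c * \<rho> / r * D" unfolding w_def using H(1) c \<rho> r D by (simp add: field_simps)
          then show ?thesis using big[of s] by linarith
        qed
      qed
      also have "\<dots> = measure N (\<Union>s\<in>T. ball (f s) w)"
      proof (rule measure_finite_Union[symmetric])
        have "ball s \<rho> \<inter> ball t \<rho> = {}" if "s \<in> T" "t \<in> T" "s \<noteq> t" for s t
          using separated_disjoint_balls[OF T(3) order_refl] that unfolding disjoint_family_on_def by blast
        then have *: "f ` ball s \<rho> \<inter> f ` ball t \<rho> = {}" if "s \<in> T" "t \<in> T" "s \<noteq> t" for s t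
          using that by (auto simp: image_Int[OF inj_f, symmetric])
        show "disjoint_family_on (\<lambda>s. ball (f s) w) T"
          unfolding disjoint_family_on_def
        proof (intro ballI impI)
          fix s t assume st: "s \<in> T" "t \<in> T" "s \<noteq> t"
          show "ball (f s) w \<inter> ball (f t) w = {}" using Int_mono[OF sub[of s] sub[of t]] *[OF st] by simp
        qed
      qed (use T(1) Y.emeasure_ball_finite in \<open>auto simp: less_top\<close>)
      also have "\<dots> \<le> measure N (ball (f x) (2 * H * D))"
      proof (rule Y.measure_mono_finite)
        show "(\<Union>s\<in>T. ball (f s) w) \<subseteq> ball (f x) (2 * H * D)"
        proof clarify
          fix s y assume s: "s \<in> T" and y: "y \<in> ball (f s) w"
          then have "g y \<in> ball s \<rho>" using sub by force
          then have "dist x (g y) \<le> 2 * dist x b"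
            using T(2) s r(2) dist_triangle[of x "g y" s] \<rho> by (fastforce simp: r_def subset_iff)
          from H(2)[OF this] have "dist (f x) y \<le> H * D" by (simp add: D_def)
          also have "\<dots> < 2 * H * D" using H(1) D by simp
          finally show "y \<in> ball (f x) (2 * H * D)" by simp
        qed
      qed (use T(1) in auto)
      also have "\<dots> \<le> C' * (2 * H * D) powr Q" using H(1) D by (intro Y.measure_upper) auto
      also have "\<dots> = C' * (2 * H) powr Q * D powr Q" by (subst powr_mult) simp
      also have "\<dots> < (c / (8 * H)) powr Q / (C * C * C') * D powr Q" using cQ D by (intro mult_strict_right_mono) auto
      also have "\<dots> = (c / (8 * H) * D) powr Q / (C * C * C')" by (subst powr_mult) simp
      also have "c / (8 * H) * D = (r / (4 * \<rho>)) * w" using r \<rho> H(1) by (simp add: w_def field_simps)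
      also have "((r / (4 * \<rho>)) * w) powr Q / (C * C * C') = (r / (4 * \<rho>)) powr Q / (C * C) * (w powr Q / C')"
        by (subst powr_mult) simp
      finally show False by simp
    qed
    then show "\<exists>x' b'. dist x' b' = \<rho> \<and> dist (f x') (f b') \<le> c * \<rho> / dist x b * dist (f x) (f b)"
      using \<beta> unfolding r_def D_def by blast
  qed
qed

text \<open>The partner \<open>\<beta> x\<close> is an arbitrary choice, so the size of the image
  pair need not be continuous in x and the intermediate value theorem does not apply. It changes at
  most by the factor 2 * H within distance \<rho>, however. A gap between T and 2 * H * T would thus
  make both the set below and the set above it open, contradicting connectedness.\<close>

lemma intermediate_scale:
  assumes H: "1 \<le> H" "\<And>x a b. dist x a \<le> 2 * dist x b \<Longrightarrow> dist (f x) (f a) \<le> H * dist (f x) (f b)"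
    and \<beta>: "\<And>x. dist x (\<beta> x) = \<rho>" and \<rho>: "0 < \<rho>"
    and lo: "dist (f x\<^sub>1) (f (\<beta> x\<^sub>1)) \<le> T" and hi: "T < dist (f x\<^sub>2) (f (\<beta> x\<^sub>2))"
  obtains x where "T < dist (f x) (f (\<beta> x))" "dist (f x) (f (\<beta> x)) \<le> 2 * H * T"
proof -
  define \<gamma> where "\<gamma> x = dist (f x) (f (\<beta> x))" for x
  have cmp: "\<gamma> x' \<le> 2 * H * \<gamma> x" if "dist x x' < \<rho>" for x x'
  proof -
    have 1: "dist x x' \<le> 2 * dist x (\<beta> x)" using that \<beta>[of x] \<rho> by simp
    have 2: "dist x (\<beta> x') \<le> 2 * dist x (\<beta> x)"
      using that \<beta>[of x] \<beta>[of x'] dist_triangle[of x "\<beta> x'" x'] by simp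
    have "\<gamma> x' \<le> dist (f x) (f x') + dist (f x) (f (\<beta> x'))"
      unfolding \<gamma>_def using dist_triangle3[of "f x'" "f (\<beta> x')" "f x"] by simp
    also have "\<dots> \<le> H * \<gamma> x + H * \<gamma> x" unfolding \<gamma>_def by (intro add_mono H(2) 1 2)
    finally show ?thesis by simp
  qed
  have T: "0 \<le> T" using lo zero_le_dist order_trans by blast
  have "\<exists>x. T < \<gamma> x \<and> \<gamma> x \<le> 2 * H * T"
  proof (rule ccontr)
    assume n: "\<nexists>x. T < \<gamma> x \<and> \<gamma> x \<le> 2 * H * T"
    let ?U = "{x. \<gamma> x \<le> T}" and ?V = "{x. 2 * H * T < \<gamma> x}"
    have TH: "T \<le> 2 * H * T" using H(1) T mult_right_mono[of 1 "2 * H" T] by simp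
    have "open ?U"
      unfolding open_contains_ball
    proof (intro ballI exI[of _ \<rho>] conjI \<rho> subsetI)
      fix x x' assume "x \<in> ?U" "x' \<in> ball x \<rho>"
      then have "\<gamma> x' \<le> 2 * H * \<gamma> x" "2 * H * \<gamma> x \<le> 2 * H * T" using cmp[of x x'] H(1) by auto
      then have "\<gamma> x' \<le> 2 * H * T" by (rule order_trans)
      then show "x' \<in> ?U" using n not_le by blast
    qed
    moreover have "open ?V"
      unfolding open_contains_ball
    proof (intro ballI exI[of _ \<rho>] conjI \<rho> subsetI)
      fix x x' assume x: "x \<in> ?V" "x' \<in> ball x \<rho>"
      then have "\<gamma> x \<le> 2 * H * \<gamma> x'" using cmp[of x' x] by (auto simp: dist_commute)
      then have "2 * H * T < 2 * H * \<gamma> x'" using x by simp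
      then have "T < \<gamma> x'" using H(1) by simp
      then show "x' \<in> ?V" using n not_le by blast
    qed
    moreover have "?U \<inter> ?V \<inter> UNIV = {}" using TH by auto
    moreover have "UNIV \<subseteq> ?U \<union> ?V" using n not_le by blast
    ultimately have "?U \<inter> UNIV = {} \<or> ?V \<inter> UNIV = {}" using connectedD[OF connected] by metis
    moreover have "x\<^sub>1 \<in> ?U" using lo by (simp add: \<gamma>_def)
    moreover have "x\<^sub>2 \<in> ?V" using hi n not_le unfolding \<gamma>_def by blast
    ultimately show False by blast
  qed
  then show ?thesis using that by (auto simp: \<gamma>_def)
qed

text \<open>Two pairs of very different stretch ratio are moved to a common radius \<rho>, and
  \<open>intermediate_scale\<close> fills in a geometric progression of image sizes. Separation
  comes for free: if \<open>u i\<close> and \<open>u j\<close> were within K * \<rho>, quasisymmetry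
  would make their image sizes comparable.\<close>

lemma lacunary_pairs:
  assumes unb: "\<And>L. \<exists>x b x' b'. x \<noteq> b \<and> x' \<noteq> b' \<and>
      L * (dist (f x) (f b) / dist x b) < dist (f x') (f b') / dist x' b'"
    and "0 < \<rho>\<^sub>0" "1 \<le> \<Lambda>"
  obtains \<rho> u b where "0 < \<rho>" "\<rho> \<le> \<rho>\<^sub>0" "\<And>j. dist (u j) (b j) = \<rho>"
    "\<And>i j. i < j \<Longrightarrow> j < (n::nat) \<Longrightarrow> \<Lambda> * dist (f (u i)) (f (b i)) \<le> dist (f (u j)) (f (b j))"
    "\<And>i j. i < j \<Longrightarrow> j < n \<Longrightarrow> K * \<rho> < dist (u i) (u j)"
proof -
  obtain H where H: "1 \<le> H" "\<And>x a b. dist x a \<le> 2 * dist x b \<Longrightarrow> dist (f x) (f a) \<le> H * dist (f x) (f b)"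
    using quasisymmetricE[OF qs] by metis
  obtain H' where H': "1 \<le> H'" "\<And>x a b. dist x a \<le> (K + 1) * dist x b \<Longrightarrow> dist (f x) (f a) \<le> H' * dist (f x) (f b)"
    using quasisymmetricE[OF qs] by metis
  obtain c\<^sub>1 where c\<^sub>1: "0 < c\<^sub>1" "\<And>x b \<rho>. 0 < \<rho> \<Longrightarrow> 2 * \<rho> \<le> dist x b \<Longrightarrow>
    \<exists>x' b'. dist x' b' = \<rho> \<and> dist (f x') (f b') \<le> c\<^sub>1 * \<rho> / dist x b * dist (f x) (f b)"
    using contracted_pair_at_small_scale by metis
  obtain c\<^sub>2 where c\<^sub>2: "0 < c\<^sub>2" "\<And>x b \<rho>. 0 < \<rho> \<Longrightarrow> 2 * \<rho> \<le> dist x b \<Longrightarrow>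
    \<exists>x' b'. dist x' b' = \<rho> \<and> c\<^sub>2 * \<rho> / dist x b * dist (f x) (f b) \<le> dist (f x') (f b')"
    using expanded_pair_at_small_scale by metis
  \<comment> \<open>Exceeding 2 * H' is what forces the centres apart, as 2 * H' bounds the ratio of
    image sizes at centres within K * \<rho>.\<close>
  define \<Lambda>' where "\<Lambda>' = max \<Lambda> (2 * H' + 1)"
  have \<Lambda>': "1 \<le> \<Lambda>'" "\<Lambda> \<le> \<Lambda>'" "2 * H' < \<Lambda>'" using assms(3) by (auto simp: \<Lambda>'_def)
  \<comment> \<open>The factor 2 * H absorbs the uncertainty left by
    \<open>intermediate_scale\<close>, so that consecutive levels still differ by
    \<Lambda>'.\<close>
  define G where "G = 2 * H * \<Lambda>'"
  have G: "1 \<le> G" using H(1) \<Lambda>'(1) mult_mono[of 1 "2 * H" 1 \<Lambda>'] by (simp add: G_def)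
  \<comment> \<open>Moving the two pairs to radius \<rho> costs c_1 and c_2, replacing the partner
    points by \<beta> costs \<open>H\<close> twice, and n levels need the room
    \<open>G ^ n\<close>.\<close>
  define L where "L = H * H * c\<^sub>1 * G ^ n / c\<^sub>2"
  obtain x b x' b' where ne: "x \<noteq> b" "x' \<noteq> b'"
    and L: "L * (dist (f x) (f b) / dist x b) < dist (f x') (f b') / dist x' b'" using unb by blast
  define \<rho> where "\<rho> = min \<rho>\<^sub>0 (min (dist x b / 2) (dist x' b' / 2))"
  have \<rho>: "0 < \<rho>" "\<rho> \<le> \<rho>\<^sub>0" "2 * \<rho> \<le> dist x b" "2 * \<rho> \<le> dist x' b'"
    using ne assms(2) by (auto simp: \<rho>_def min_def)
  obtain x\<^sub>1 b\<^sub>1 where 1: "dist x\<^sub>1 b\<^sub>1 = \<rho>" "dist (f x\<^sub>1) (f b\<^sub>1) \<le> c\<^sub>1 * \<rho> / dist x b * dist (f x) (f b)"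
    using c\<^sub>1(2)[OF \<rho>(1,3)] by blast
  obtain x\<^sub>2 b\<^sub>2 where 2: "dist x\<^sub>2 b\<^sub>2 = \<rho>" "c\<^sub>2 * \<rho> / dist x' b' * dist (f x') (f b') \<le> dist (f x\<^sub>2) (f b\<^sub>2)"
    using c\<^sub>2(2)[OF \<rho>(1,4)] by blast
  have "\<exists>b. dist s b = \<rho>" for s :: 'a
    using connected_sphere_point'[OF connected _ \<rho>(3), of s] \<rho>(1) by auto
  then obtain \<beta> :: "'a \<Rightarrow> 'a" where \<beta>: "\<And>s. dist s (\<beta> s) = \<rho>" by metis
  define \<gamma> where "\<gamma> x = dist (f x) (f (\<beta> x))" for x
  have \<gamma>p: "0 < \<gamma> x" for x using \<beta>[of x] \<rho>(1) by (auto simp: \<gamma>_def)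
  have \<gamma>1: "\<gamma> x\<^sub>1 \<le> H * (c\<^sub>1 * \<rho> / dist x b * dist (f x) (f b))"
  proof -
    have "\<gamma> x\<^sub>1 \<le> H * dist (f x\<^sub>1) (f b\<^sub>1)" unfolding \<gamma>_def using H(2)[of x\<^sub>1 "\<beta> x\<^sub>1" b\<^sub>1] 1(1) \<beta>[of x\<^sub>1] \<rho>(1) by simp
    also have "\<dots> \<le> H * (c\<^sub>1 * \<rho> / dist x b * dist (f x) (f b))" using 1(2) H(1) by (intro mult_left_mono) auto
    finally show ?thesis .
  qed
  have \<gamma>2: "c\<^sub>2 * \<rho> / dist x' b' * dist (f x') (f b') \<le> H * \<gamma> x\<^sub>2"
  proof -
    have "dist (f x\<^sub>2) (f b\<^sub>2) \<le> H * \<gamma> x\<^sub>2" unfolding \<gamma>_def using H(2)[of x\<^sub>2 b\<^sub>2 "\<beta> x\<^sub>2"] 2(1) \<beta>[of x\<^sub>2] \<rho>(1) by simp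
    then show ?thesis using 2(2) by linarith
  qed
  have top: "\<gamma> x\<^sub>1 * G ^ n < \<gamma> x\<^sub>2"
  proof -
    have "H * (\<gamma> x\<^sub>1 * G ^ n) \<le> H * (H * (c\<^sub>1 * \<rho> / dist x b * dist (f x) (f b)) * G ^ n)"
      using \<gamma>1 H(1) G by (intro mult_left_mono mult_right_mono) auto
    also have "\<dots> = c\<^sub>2 * \<rho> * (L * (dist (f x) (f b) / dist x b))" using c\<^sub>2(1) by (simp add: L_def)
    also have "\<dots> < c\<^sub>2 * \<rho> * (dist (f x') (f b') / dist x' b')" using L c\<^sub>2(1) \<rho>(1) by (intro mult_strict_left_mono) auto
    also have "\<dots> = c\<^sub>2 * \<rho> / dist x' b' * dist (f x') (f b')" by simp
    also have "\<dots> \<le> H * \<gamma> x\<^sub>2" by (rule \<gamma>2)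
    finally show ?thesis using H(1) by simp
  qed
  have "\<exists>y. j < n \<longrightarrow> \<gamma> x\<^sub>1 * G ^ j < \<gamma> y \<and> \<gamma> y \<le> 2 * H * (\<gamma> x\<^sub>1 * G ^ j)" for j
  proof (cases "j < n")
    case True
    have "\<gamma> x\<^sub>1 * 1 \<le> \<gamma> x\<^sub>1 * G ^ j" using \<gamma>p[of x\<^sub>1] G by (intro mult_left_mono one_le_power) auto
    moreover have "\<gamma> x\<^sub>1 * G ^ j \<le> \<gamma> x\<^sub>1 * G ^ n" using \<gamma>p[of x\<^sub>1] G True by (intro mult_left_mono power_increasing) auto
    ultimately show ?thesis
      using intermediate_scale[OF H \<beta> \<rho>(1), of x\<^sub>1 "\<gamma> x\<^sub>1 * G ^ j" x\<^sub>2] top unfolding \<gamma>_def by force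
  qed simp
  then obtain u where u: "\<And>j. j < n \<Longrightarrow> \<gamma> x\<^sub>1 * G ^ j < \<gamma> (u j)" "\<And>j. j < n \<Longrightarrow> \<gamma> (u j) \<le> 2 * H * (\<gamma> x\<^sub>1 * G ^ j)"
    by metis
  have lac: "\<Lambda>' * \<gamma> (u i) \<le> \<gamma> (u j)" if "i < j" "j < n" for i j
  proof -
    have "\<Lambda>' * \<gamma> (u i) \<le> \<Lambda>' * (2 * H * (\<gamma> x\<^sub>1 * G ^ i))" using u(2)[of i] that \<Lambda>'(1) by (intro mult_left_mono) auto
    also have "\<dots> = \<gamma> x\<^sub>1 * G ^ Suc i" by (simp add: G_def)
    also have "\<dots> \<le> \<gamma> x\<^sub>1 * G ^ j" using \<gamma>p[of x\<^sub>1] G that by (intro mult_left_mono power_increasing) auto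
    also have "\<dots> \<le> \<gamma> (u j)" using u(1)[of j] that by simp
    finally show ?thesis .
  qed
  show ?thesis
  proof (rule that[of \<rho> u "\<lambda>j. \<beta> (u j)"])
    fix i j assume ij: "i < j" "j < n"
    show "\<Lambda> * dist (f (u i)) (f (\<beta> (u i))) \<le> dist (f (u j)) (f (\<beta> (u j)))"
      using lac[OF ij] mult_right_mono[OF \<Lambda>'(2), of "\<gamma> (u i)"] \<gamma>p[of "u i"] unfolding \<gamma>_def by linarith
    show "K * \<rho> < dist (u i) (u j)"
    proof (rule ccontr)
      assume "\<not> K * \<rho> < dist (u i) (u j)"
      then have le: "dist (u i) (u j) \<le> K * \<rho>" by simp
      have a: "dist (u i) (u j) \<le> (K + 1) * dist (u i) (\<beta> (u i))" using le \<beta>[of "u i"] \<rho>(1) by (simp add: distrib_right)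
      have b: "dist (u i) (\<beta> (u j)) \<le> (K + 1) * dist (u i) (\<beta> (u i))"
        using le \<beta>[of "u i"] \<beta>[of "u j"] dist_triangle[of "u i" "\<beta> (u j)" "u j"] by (simp add: distrib_right)
      have "\<gamma> (u j) \<le> dist (f (u i)) (f (u j)) + dist (f (u i)) (f (\<beta> (u j)))"
        unfolding \<gamma>_def using dist_triangle3[of "f (u j)" "f (\<beta> (u j))" "f (u i)"] by simp
      also have "\<dots> \<le> H' * \<gamma> (u i) + H' * \<gamma> (u i)" unfolding \<gamma>_def by (intro add_mono H'(2) a b)
      also have "\<dots> = 2 * H' * \<gamma> (u i)" by simp
      also have "\<dots> < \<Lambda>' * \<gamma> (u i)" using \<Lambda>'(3) \<gamma>p[of "u i"] by (intro mult_strict_right_mono)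
      also have "\<dots> \<le> \<gamma> (u j)" by (rule lac[OF ij])
      finally show False by simp
    qed
  qed (use \<rho> \<beta> in auto)
qed

end

section \<open>Quasisymmetry from boundedness of the composition operator\<close>

text \<open>Passes to q-th powers, in which norms of bump sums are counts. Membership in the Besov
  space is supplied by the finite upper bound.\<close>

lemma induced_map_boundedE:
  assumes "induced_map_bounded M N s p q \<phi>" "sets N = sets borel" "0 < q"
  obtains K where "0 < K" "\<And>f B\<^sub>1 B\<^sub>2. continuous_on UNIV f \<Longrightarrow> 0 \<le> B\<^sub>1 \<Longrightarrow> 0 \<le> B\<^sub>2
    \<Longrightarrow> ennpow (ennreal B\<^sub>1) (1 / q) \<le> besov_norm M s p q (f \<circ> \<phi>)
    \<Longrightarrow> besov_norm N s p q f \<le> ennpow (ennreal B\<^sub>2) (1 / q) \<Longrightarrow> B\<^sub>1 \<le> K * B\<^sub>2"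
proof -
  obtain c where c: "0 \<le> c" "\<And>f. f \<in> besov_space N s p q \<Longrightarrow> continuous_on UNIV f \<Longrightarrow>
      besov_norm M s p q (f \<circ> \<phi>) \<le> ennreal c * besov_norm N s p q f"
    using assms(1) unfolding induced_map_bounded_def by blast
  show ?thesis
  proof (rule that[of "(c + 1) powr q"])
    show "0 < (c + 1) powr q" using c(1) by simp
    fix f :: "'b \<Rightarrow> real" and B\<^sub>1 B\<^sub>2 :: real
    assume f: "continuous_on UNIV f" and B: "0 \<le> B\<^sub>1" "0 \<le> B\<^sub>2"
      and lo: "ennpow (ennreal B\<^sub>1) (1 / q) \<le> besov_norm M s p q (f \<circ> \<phi>)"
      and hi: "besov_norm N s p q f \<le> ennpow (ennreal B\<^sub>2) (1 / q)"
    have "f \<in> borel_measurable N"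
      using borel_measurable_continuous_onI[OF f] measurable_cong_sets[OF assms(2) refl] by blast
    moreover have "besov_norm N s p q f < \<infinity>" using hi B by (simp add: ennpow_ennreal le_less_trans)
    ultimately have "f \<in> besov_space N s p q" by (simp add: besov_space_def)
    then have "ennreal (B\<^sub>1 powr (1 / q)) \<le> ennreal c * besov_norm N s p q f"
      using lo c(2)[OF _ f] B by (simp add: ennpow_ennreal order_trans)
    also have "\<dots> \<le> ennreal c * ennreal (B\<^sub>2 powr (1 / q))"
      using hi B by (intro mult_left_mono) (auto simp: ennpow_ennreal)
    also have "\<dots> = ennreal (c * B\<^sub>2 powr (1 / q))" using c(1) by (simp add: ennreal_mult)
    finally have "B\<^sub>1 powr (1 / q) \<le> c * B\<^sub>2 powr (1 / q)" using c(1) by (simp add: ennreal_le_iff)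
    also have "\<dots> \<le> (c + 1) * B\<^sub>2 powr (1 / q)" by (intro mult_right_mono) auto
    finally have "(B\<^sub>1 powr (1 / q)) powr q \<le> ((c + 1) * B\<^sub>2 powr (1 / q)) powr q"
      using assms(3) by (intro powr_mono2) auto
    then show "B\<^sub>1 \<le> (c + 1) powr q * B\<^sub>2"
      using assms(3) B c(1) by (simp add: powr_mult powr_powr)
  qed
qed

lemma besov_energy_reflect: "besov_energy M p (\<lambda>x. 1 - F x) t = besov_energy M p F t"
proof -
  have "\<bar>(1 - F x) - (1 - F y)\<bar> = \<bar>F x - F y\<bar>" for x y by simp
  then show ?thesis unfolding besov_energy_def by (simp only:)
qed

lemma besov_norm_ge_single:
  fixes Q s p q :: real
  assumes "0 < Q" "0 < s" "p = Q / s" "0 < q" "0 \<le> k" "0 < T"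
    and "\<forall>t\<in>{T..2 * T}. ennreal (k * t powr Q) \<le> besov_energy M p f t"
  shows "ennpow (ennreal (k powr (q / p) / 2)) (1 / q) \<le> besov_norm M s p q f"
  using besov_norm_ge[OF assms(1-5), of "{()}" "\<lambda>_. T" M f] assms(6,7)
  by (simp add: disjoint_family_on_def)

lemma linearly_locally_connectedE:
  assumes "linearly_locally_connected TYPE('b::metric_space)"
  obtains c where "1 \<le> c"
    "\<And>y r u v. 0 < r \<Longrightarrow> u \<in> ball (y :: 'b) r \<Longrightarrow> v \<in> ball y r
       \<Longrightarrow> \<exists>K. continuum K \<and> u \<in> K \<and> v \<in> K \<and> K \<subseteq> ball y (c * r)"
    "\<And>y r u v. 0 < r \<Longrightarrow> u \<in> - cball (y :: 'b) r \<Longrightarrow> v \<in> - cball y r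
       \<Longrightarrow> \<exists>K. continuum K \<and> u \<in> K \<and> v \<in> K \<and> K \<subseteq> - cball y (r / c)"
proof -
  define P where "P c y r \<longleftrightarrow> (\<forall>u\<in>ball (y :: 'b) r. \<forall>v\<in>ball y r. \<exists>K. continuum K \<and> u \<in> K \<and> v \<in> K \<and> K \<subseteq> ball y (c * r))"
    for c y r
  define P' where "P' c y r \<longleftrightarrow> (\<forall>u\<in>- cball (y :: 'b) r. \<forall>v\<in>- cball y r. \<exists>K. continuum K \<and> u \<in> K \<and> v \<in> K \<and> K \<subseteq> - cball y (r / c))"
    for c y r
  have "\<exists>c\<ge>1. \<forall>y r. 0 < r \<longrightarrow> P c y r \<and> P' c y r"
    using assms unfolding linearly_locally_connected_def P_def P'_def .
  then obtain c where c: "1 \<le> c" "\<And>y r. 0 < r \<Longrightarrow> P c y r" "\<And>y r. 0 < r \<Longrightarrow> P' c y r" by blast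
  show ?thesis
    by (rule that[OF c(1)]) (use c(2)[unfolded P_def] c(3)[unfolded P'_def] in metis)+
qed

text \<open>If the image of \<open>a\<close> is far out compared with that of \<open>b\<close>, two
  continua in the target, one near \<open>\<phi> x\<close> and one far from it, are separated by
  many concentric rings, and an average of n bumps separates them at small norm. Their preimages
  have size and mutual distance controlled by \<open>dist x b\<close>, so the pullback has energy
  bounded below.

  The hypothesis \<open>far\<close> provides a second point \<open>a'\<close>, without which the
  preimage of the outer continuum could degenerate to a point.\<close>

lemma quasisymmetric_of_bounded_composition:
  fixes \<phi> :: "'a::metric_space \<Rightarrow> 'b::metric_space"
  assumes "regular_space M Q C" "regular_space N Q C'" "1 < Q" "homeomorphism UNIV UNIV \<phi> \<psi>"
    and LLC: "linearly_locally_connected TYPE('b)"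
    and s: "0 < s" "s < 1" and q: "1 < q" and p: "p = Q / s"
    and bdd: "induced_map_bounded M N s p q \<phi>"
    and far: "\<And>K. \<exists>H. \<forall>x a b. x \<noteq> b \<longrightarrow> dist x a \<le> K * dist x b \<longrightarrow> H * dist (\<phi> x) (\<phi> b) \<le> dist (\<phi> x) (\<phi> a)
      \<longrightarrow> (\<exists>a'. dist x b \<le> dist a a' \<and> dist (\<phi> x) (\<phi> a) \<le> dist (\<phi> x) (\<phi> a'))"
  shows "quasisymmetric \<phi>"
proof -
  interpret X: regular_space M Q C by fact
  interpret Y: regular_space N Q C' by fact
  have h [simp]: "\<psi> (\<phi> x) = x" "\<phi> (\<psi> y) = y" and cont: "continuous_on UNIV \<phi>" "continuous_on UNIV \<psi>" for x y
    using assms(4) by (auto simp: homeomorphism_def)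
  have p1: "1 < p" using assms(3) s p by (simp add: less_divide_eq)
  have q0: "0 < q" using q by simp
  show ?thesis
  proof (rule Y.besov_norm_lacunary_bumps[OF s p assms(3) q])
    fix K\<^sub>U assume K\<^sub>U: "0 < K\<^sub>U" "\<And>n a c \<tau>. 0 \<le> a \<Longrightarrow> (\<And>k. k < n \<Longrightarrow> 0 < \<tau> k)
      \<Longrightarrow> (\<And>k. Suc k < n \<Longrightarrow> 2 * \<tau> k \<le> \<tau> (Suc k))
      \<Longrightarrow> besov_norm N s p q (\<lambda>y. a * (\<Sum>k<n. bump (c k) (\<tau> k) y)) \<le> ennpow (ennreal (K\<^sub>U * a powr q * n)) (1 / q)"
    show ?thesis
    proof (rule induced_map_boundedE[OF bdd Y.sets_M q0])
      fix K\<^sub>B assume K\<^sub>B: "0 < K\<^sub>B" "\<And>f B\<^sub>1 B\<^sub>2. continuous_on UNIV f \<Longrightarrow> 0 \<le> B\<^sub>1 \<Longrightarrow> 0 \<le> B\<^sub>2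
        \<Longrightarrow> ennpow (ennreal B\<^sub>1) (1 / q) \<le> besov_norm M s p q (f \<circ> \<phi>)
        \<Longrightarrow> besov_norm N s p q f \<le> ennpow (ennreal B\<^sub>2) (1 / q) \<Longrightarrow> B\<^sub>1 \<le> K\<^sub>B * B\<^sub>2"
      show ?thesis
      proof (rule linearly_locally_connectedE[OF LLC])
        fix Cl assume Cl: "1 \<le> Cl"
        "\<And>y r u v. 0 < r \<Longrightarrow> u \<in> ball (y :: 'b) r \<Longrightarrow> v \<in> ball y r
           \<Longrightarrow> \<exists>E. continuum E \<and> u \<in> E \<and> v \<in> E \<and> E \<subseteq> ball y (Cl * r)"
        "\<And>y r u v. 0 < r \<Longrightarrow> u \<in> - cball (y :: 'b) r \<Longrightarrow> v \<in> - cball y r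
           \<Longrightarrow> \<exists>E. continuum E \<and> u \<in> E \<and> v \<in> E \<and> E \<subseteq> - cball y (r / Cl)"
        show ?thesis
          unfolding quasisymmetric_def
        proof
          fix K\<^sub>0 :: real
          define K where "K = max K\<^sub>0 1"
          have K: "1 \<le> K" "K\<^sub>0 \<le> K" by (auto simp: K_def)
          obtain H\<^sub>0 where H\<^sub>0: "\<And>x a b. x \<noteq> b \<Longrightarrow> dist x a \<le> K * dist x b \<Longrightarrow> H\<^sub>0 * dist (\<phi> x) (\<phi> b) \<le> dist (\<phi> x) (\<phi> a)
            \<Longrightarrow> \<exists>a'. dist x b \<le> dist a a' \<and> dist (\<phi> x) (\<phi> a) \<le> dist (\<phi> x) (\<phi> a')"
            using far[of K] by blast
          \<comment> \<open>Half of the lower volume bound at radius \<rho> / 2; that radius is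
            strictly below dist x b = \<rho>, as the bound requires.\<close>
          define b\<^sub>0 where "b\<^sub>0 = (1 / 2) powr Q / (2 * C)"
          have b\<^sub>0: "0 < b\<^sub>0" using X.C_ge_1 by (simp add: b\<^sub>0_def)
          have pK: "1 \<le> p" "1 \<le> K + 2" using p1 K by auto
          show "\<exists>H. \<forall>x a b. dist x a \<le> K\<^sub>0 * dist x b \<longrightarrow> dist (\<phi> x) (\<phi> a) \<le> H * dist (\<phi> x) (\<phi> b)"
          proof (rule X.besov_energy_ge_connected[OF pK b\<^sub>0])
            fix \<kappa> assume \<kappa>: "0 < \<kappa>" "\<And>F E \<rho> e\<^sub>0 e\<^sub>1. continuous_on UNIV F \<Longrightarrow> connected E \<Longrightarrow> e\<^sub>0 \<in> E \<Longrightarrow> e\<^sub>1 \<in> E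
              \<Longrightarrow> 0 < \<rho> \<Longrightarrow> \<rho> \<le> dist e\<^sub>0 e\<^sub>1 \<Longrightarrow> (\<And>x. x \<in> E \<Longrightarrow> 1 \<le> F x)
              \<Longrightarrow> (\<And>x. x \<in> E \<Longrightarrow> dist e\<^sub>0 x \<le> \<rho> \<Longrightarrow> b\<^sub>0 * \<rho> powr Q \<le> measure M (ball x ((K + 2) * \<rho>) \<inter> {y. F y \<le> 1 / 2}))
              \<Longrightarrow> \<exists>t\<^sub>0>0. \<forall>t\<in>{t\<^sub>0..2 * t\<^sub>0}. ennreal (\<kappa> * t powr Q) \<le> besov_energy M p F t"
            define \<theta> where "\<theta> = \<kappa> powr (q / p) / 2"
            have \<theta>: "0 < \<theta>" using \<kappa>(1) by (simp add: \<theta>_def)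
            \<comment> \<open>The average has q-th norm power of order n powr (1 - q), so large n
              pushes it below the threshold \<theta> even after applying the operator bound.\<close>
            obtain n :: nat where n: "(K\<^sub>B * K\<^sub>U / \<theta>) powr (1 / (q - 1)) < n" using reals_Archimedean2 by blast
            then have n0: "0 < real n" by (rule le_less_trans[OF powr_ge_zero])
            have small: "K\<^sub>B * (K\<^sub>U * (1 / n) powr q * n) < \<theta>"
            proof -
              have "((K\<^sub>B * K\<^sub>U / \<theta>) powr (1 / (q - 1))) powr (q - 1) < n powr (q - 1)"
                using n q by (intro powr_less_mono2) auto
              then have "K\<^sub>B * K\<^sub>U / \<theta> < n powr (q - 1)" using q K\<^sub>B(1) K\<^sub>U(1) \<theta> by (simp add: powr_powr)
              then have "K\<^sub>B * K\<^sub>U / n powr (q - 1) < \<theta>" using \<theta> n0 by (simp add: field_simps)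
              moreover have "(1 / n) powr q * n = 1 / n powr (q - 1)"
                using n0 by (simp add: powr_divide powr_diff)
              ultimately show ?thesis by (simp add: mult.assoc)
            qed
            \<comment> \<open>The inner continuum lies within \<tau> = 2 * Cl * r of
              \<open>\<phi> x\<close>, and the outer one avoids radius R / (2 * Cl). Fitting n
              doublings of \<tau> between these requires R \<ge> 2 ^ n * 4 * Cl^2 * r.\<close>
            define H where "H = max H\<^sub>0 (2 ^ n * 4 * Cl * Cl)"
            have "dist (\<phi> x) (\<phi> a) \<le> H * dist (\<phi> x) (\<phi> b)" if le0: "dist x a \<le> K\<^sub>0 * dist x b" for x a b
            proof (rule ccontr)
              assume "\<not> ?thesis"
              then have big: "H * dist (\<phi> x) (\<phi> b) < dist (\<phi> x) (\<phi> a)" by simp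
              have le: "dist x a \<le> K * dist x b" using le0 mult_right_mono[OF K(2), of "dist x b"] by simp
              have xb: "x \<noteq> b" using le big by auto
              define \<rho> where "\<rho> = dist x b"
              define r where "r = dist (\<phi> x) (\<phi> b)"
              define R where "R = dist (\<phi> x) (\<phi> a)"
              have \<rho>: "0 < \<rho>" using xb by (simp add: \<rho>_def)
              have r: "0 < r" using xb h(1) by (metis r_def zero_less_dist_iff)
              have "H\<^sub>0 * r \<le> H * r" "2 ^ n * 4 * Cl * Cl * r \<le> H * r"
                using r by (auto intro!: mult_right_mono simp: H_def)
              then have HR: "H\<^sub>0 * r \<le> R" "2 ^ n * 4 * Cl * Cl * r \<le> R"
                using big unfolding r_def[symmetric] R_def[symmetric] by linarith+
              obtain a' where a': "\<rho> \<le> dist a a'" "R \<le> dist (\<phi> x) (\<phi> a')"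
                using H\<^sub>0[OF xb le] HR(1) unfolding \<rho>_def r_def R_def by blast
              have "0 < 2 ^ n * 4 * Cl * Cl * r" using r Cl(1) by simp
              then have R: "0 < R" using HR(2) by linarith
              obtain E where E: "continuum E" "\<phi> x \<in> E" "\<phi> b \<in> E" "E \<subseteq> ball (\<phi> x) (Cl * (2 * r))"
                using Cl(2)[of "2 * r" "\<phi> x" "\<phi> x" "\<phi> b"] r by (auto simp: r_def)
              have RR: "\<phi> a \<in> - cball (\<phi> x) (R / 2)" "\<phi> a' \<in> - cball (\<phi> x) (R / 2)"
                using R a'(2) by (simp_all add: R_def[symmetric])
              obtain E' where E': "continuum E'" "\<phi> a \<in> E'" "\<phi> a' \<in> E'" "E' \<subseteq> - cball (\<phi> x) (R / 2 / Cl)"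
                using Cl(3)[OF _ RR] R by auto
              define \<tau> where "\<tau> = Cl * (2 * r)"
              have \<tau>: "0 < \<tau>" "2 ^ n * \<tau> \<le> R / 2 / Cl" using r Cl(1) HR(2) by (auto simp: \<tau>_def field_simps)
              define v where "v y = 1 / n * (\<Sum>k<n. bump (\<phi> x) (2 ^ k * \<tau>) y)" for y
              have cv: "continuous_on UNIV v" unfolding v_def by (intro continuous_intros continuous_bump)
              define F where "F = v \<circ> \<phi>"
              have cF: "continuous_on UNIV F" unfolding F_def using cv cont(1) by (intro continuous_on_compose continuous_on_subset[OF cv]) auto
              have v1: "v y = 1" if "y \<in> E" for y
              proof -
                have "bump (\<phi> x) (2 ^ k * \<tau>) y = 1" for k
                proof (rule bump_eq_1)
                  have "dist y (\<phi> x) \<le> 1 * \<tau>" using E(4) that by (auto simp: \<tau>_def dist_commute subset_iff intro: less_imp_le)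
                  also have "\<dots> \<le> 2 ^ k * \<tau>" using \<tau>(1) by (intro mult_right_mono) auto
                  finally show "dist y (\<phi> x) \<le> 2 ^ k * \<tau>" .
                qed (use \<tau> in auto)
                then show ?thesis using n0 by (simp add: v_def)
              qed
              have v0: "v y = 0" if "y \<in> E'" for y
              proof -
                have "bump (\<phi> x) (2 ^ k * \<tau>) y = 0" if "k < n" for k
                proof (rule bump_eq_0)
                  have "2 * (2 ^ k * \<tau>) = 2 ^ Suc k * \<tau>" by simp
                  also have "\<dots> \<le> 2 ^ n * \<tau>" using \<tau>(1) that by (intro mult_right_mono power_increasing) auto
                  also have "\<dots> \<le> R / 2 / Cl" by (rule \<tau>(2))
                  also have "\<dots> \<le> dist y (\<phi> x)" using E'(4) \<open>y \<in> E'\<close> by (fastforce simp: dist_commute)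
                  finally show "2 * (2 ^ k * \<tau>) \<le> dist y (\<phi> x)" .
                qed (use \<tau> in auto)
                then show ?thesis by (simp add: v_def)
              qed
              have conn: "connected (\<psi> ` E)" "connected (\<psi> ` E')"
                using E(1) E'(1) cont(2) unfolding continuum_def
                by (auto intro!: connected_continuous_image continuous_on_subset[OF cont(2)])
              have mem: "x \<in> \<psi> ` E" "b \<in> \<psi> ` E" "a \<in> \<psi> ` E'" "a' \<in> \<psi> ` E'"
                using E(2,3) E'(2,3) by (metis h(1) imageI)+
              have mF: "{y. F y \<le> 1 / 2} \<in> sets M" "{y. 1 - F y \<le> 1 / 2} \<in> sets M"
                unfolding X.sets_M by (intro borel_closed closed_Collect_le continuous_intros cF)+
              \<comment> \<open>On at least half of \<open>?W\<close> either F \<le> 1 / 2 or 1 - F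
                \<le> 1 / 2. This decides whether the lower bound is applied to the inner continuum
                with \<open>F\<close> or to the outer one with 1 - F; both functions have the same
                energy.\<close>
              let ?W = "ball x \<rho>"
              have W: "2 * (b\<^sub>0 * \<rho> powr Q) \<le> measure M ?W"
              proof -
                have "2 * (b\<^sub>0 * \<rho> powr Q) = (\<rho> / 2) powr Q / C"
                  using powr_mult[of "1 / 2" \<rho> Q] X.C_ge_1 by (simp add: b\<^sub>0_def)
                also have "\<dots> \<le> measure M (ball x (\<rho> / 2))" using \<rho> by (intro X.measure_lower[of _ x b]) (auto simp: \<rho>_def)
                also have "\<dots> \<le> measure M ?W" using \<rho> by (intro X.measure_mono_finite[of _ _ x \<rho>]) auto
                finally show ?thesis .
              qed
              also have "measure M ?W = measure M (?W \<inter> {y. F y \<le> 1 / 2} \<union> ?W \<inter> {y. 1 - F y \<le> 1 / 2})"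
                by (rule arg_cong[of _ _ "measure M"]) auto
              also have "\<dots> \<le> measure M (?W \<inter> {y. F y \<le> 1 / 2}) + measure M (?W \<inter> {y. 1 - F y \<le> 1 / 2})"
                using mF by (intro measure_Un_le) auto
              finally consider "b\<^sub>0 * \<rho> powr Q \<le> measure M (?W \<inter> {y. F y \<le> 1 / 2})"
                | "b\<^sub>0 * \<rho> powr Q \<le> measure M (?W \<inter> {y. 1 - F y \<le> 1 / 2})" by linarith
              then have "\<exists>t\<^sub>0>0. \<forall>t\<in>{t\<^sub>0..2 * t\<^sub>0}. ennreal (\<kappa> * t powr Q) \<le> besov_energy M p F t"
              proof cases
                case 1
                show ?thesis
                proof (rule \<kappa>(2)[OF cF conn(1) mem(1,2) \<rho>])
                  show "\<rho> \<le> dist x b" by (simp add: \<rho>_def)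
                  show "1 \<le> F y" if "y \<in> \<psi> ` E" for y using that v1 by (auto simp: F_def)
                  fix y assume y: "y \<in> \<psi> ` E" "dist x y \<le> \<rho>"
                  have "?W \<subseteq> ball y ((K + 2) * \<rho>)"
                  proof
                    fix z assume "z \<in> ?W"
                    then have "dist y z < 2 * \<rho>" using y(2) dist_triangle3[of y z x] by (simp add: dist_commute)
                    also have "\<dots> \<le> (K + 2) * \<rho>" using K \<rho> by (intro mult_right_mono) auto
                    finally show "z \<in> ball y ((K + 2) * \<rho>)" by simp
                  qed
                  then have "measure M (?W \<inter> {y. F y \<le> 1 / 2}) \<le> measure M (ball y ((K + 2) * \<rho>) \<inter> {y. F y \<le> 1 / 2})"
                    using mF by (intro X.measure_mono_finite[of _ _ y "(K + 2) * \<rho>"]) auto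
                  with 1 show "b\<^sub>0 * \<rho> powr Q \<le> measure M (ball y ((K + 2) * \<rho>) \<inter> {y. F y \<le> 1 / 2})" by linarith
                qed
              next
                case 2
                have "\<exists>t\<^sub>0>0. \<forall>t\<in>{t\<^sub>0..2 * t\<^sub>0}. ennreal (\<kappa> * t powr Q) \<le> besov_energy M p (\<lambda>y. 1 - F y) t"
                proof (rule \<kappa>(2)[OF _ conn(2) mem(3,4) \<rho> a'(1)])
                  show "continuous_on UNIV (\<lambda>y. 1 - F y)" by (intro continuous_intros cF)
                  show "1 \<le> 1 - F y" if "y \<in> \<psi> ` E'" for y using that v0 by (auto simp: F_def)
                  fix y assume y: "y \<in> \<psi> ` E'" "dist a y \<le> \<rho>"
                  \<comment> \<open>Here y is within \<rho> of \<open>a\<close>, which is within K *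
                    \<rho> of \<open>x\<close>. The sum \<rho> + K * \<rho> + \<rho> explains the
                    dilation K + 2.\<close>
                  have "?W \<subseteq> ball y ((K + 2) * \<rho>)"
                  proof
                    fix z assume "z \<in> ?W"
                    then have "dist y z < \<rho> + K * \<rho> + \<rho>"
                      using y(2) le dist_triangle3[of y z x] dist_triangle3[of x y a] by (simp add: dist_commute \<rho>_def)
                    also have "\<dots> = (K + 2) * \<rho>" by (simp add: algebra_simps)
                    finally show "z \<in> ball y ((K + 2) * \<rho>)" by simp
                  qed
                  then have "measure M (?W \<inter> {y. 1 - F y \<le> 1 / 2}) \<le> measure M (ball y ((K + 2) * \<rho>) \<inter> {y. 1 - F y \<le> 1 / 2})"
                    using mF by (intro X.measure_mono_finite[of _ _ y "(K + 2) * \<rho>"]) auto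
                  with 2 show "b\<^sub>0 * \<rho> powr Q \<le> measure M (ball y ((K + 2) * \<rho>) \<inter> {y. 1 - F y \<le> 1 / 2})" by linarith
                qed
                then show ?thesis by (simp only: besov_energy_reflect)
              qed
              then obtain t\<^sub>0 where "0 < t\<^sub>0" "\<forall>t\<in>{t\<^sub>0..2 * t\<^sub>0}. ennreal (\<kappa> * t powr Q) \<le> besov_energy M p F t" by blast
              then have "ennpow (ennreal \<theta>) (1 / q) \<le> besov_norm M s p q F"
                unfolding \<theta>_def using q s \<kappa>(1) X.Q_pos p by (intro besov_norm_ge_single) auto
              moreover have "besov_norm N s p q v \<le> ennpow (ennreal (K\<^sub>U * (1 / n) powr q * n)) (1 / q)"
                unfolding v_def using \<tau>(1) by (intro K\<^sub>U(2)) auto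
              ultimately have "\<theta> \<le> K\<^sub>B * (K\<^sub>U * (1 / n) powr q * n)"
                using K\<^sub>B(2)[OF cv, of \<theta>] \<theta> K\<^sub>U(1) by (simp add: F_def)
              with small show False by simp
            qed
            then show "\<exists>H. \<forall>x a b. dist x a \<le> K\<^sub>0 * dist x b \<longrightarrow> dist (\<phi> x) (\<phi> a) \<le> H * dist (\<phi> x) (\<phi> b)" by blast
          qed
        qed
      qed
    qed
  qed
qed

text \<open>The two sets to be avoided, the image of a ball about \<open>a\<close> and a ball about
  \<open>\<phi> x\<close>, are both bounded and cannot cover an unbounded target. This is where
  bounded images of bounded sets enter.\<close>

lemma far_point_unbounded:
  fixes \<phi> :: "'a::metric_space \<Rightarrow> 'b::metric_space"
  assumes "surj \<phi>" "\<not> bounded (UNIV :: 'b set)" "\<And>A. bounded A \<Longrightarrow> bounded (\<phi> ` A)"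
  shows "\<exists>a'. dist x b \<le> dist a a' \<and> dist (\<phi> x) (\<phi> a) \<le> dist (\<phi> x) (\<phi> a')"
proof -
  have "bounded (\<phi> ` cball a (dist x b) \<union> cball (\<phi> x) (dist (\<phi> x) (\<phi> a)))" using assms(3) by simp
  then obtain y where y: "y \<notin> \<phi> ` cball a (dist x b)" "y \<notin> cball (\<phi> x) (dist (\<phi> x) (\<phi> a))"
    using assms(2) by (metis UNIV_eq_I UnI1 UnI2)
  obtain a' where "y = \<phi> a'" using assms(1) by blast
  then show ?thesis using y by (intro exI[of _ a']) (auto simp: not_le intro: less_imp_le)
qed

text \<open>A large \<open>H\<close> forces the images of \<open>x\<close> and \<open>b\<close>
  close together, hence \<open>x\<close> and \<open>b\<close>, hence also \<open>x\<close> and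
  \<open>a\<close> and then their images, by uniform continuity in both directions. Any point of the
  target far from \<open>\<phi> x\<close> then has a preimage far from \<open>a\<close>.\<close>

lemma far_point_compact:
  fixes \<phi> :: "'a::metric_space \<Rightarrow> 'b::metric_space"
  assumes "compact (UNIV :: 'a set)" "compact (UNIV :: 'b set)" "homeomorphism UNIV UNIV \<phi> \<psi>"
    and "\<exists>u v :: 'b. u \<noteq> v"
  shows "\<exists>H. \<forall>x a b. x \<noteq> b \<longrightarrow> dist x a \<le> K * dist x b \<longrightarrow> H * dist (\<phi> x) (\<phi> b) \<le> dist (\<phi> x) (\<phi> a)
      \<longrightarrow> (\<exists>a'. dist x b \<le> dist a a' \<and> dist (\<phi> x) (\<phi> a) \<le> dist (\<phi> x) (\<phi> a'))"
proof -
  have h [simp]: "\<psi> (\<phi> x) = x" "\<phi> (\<psi> y) = y" and cont: "continuous_on UNIV \<phi>" "continuous_on UNIV \<psi>" for x y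
    using assms(3) by (auto simp: homeomorphism_def)
  obtain u v :: 'b where uv: "u \<noteq> v" using assms(4) by blast
  define D where "D = dist u v"
  have D: "0 < D" using uv by (simp add: D_def)
  have "uniformly_continuous_on UNIV \<phi>" using compact_uniformly_continuous[OF cont(1) assms(1)] .
  then obtain d\<^sub>1 where d\<^sub>1: "0 < d\<^sub>1" "\<And>x x'. dist x' x < d\<^sub>1 \<Longrightarrow> dist (\<phi> x') (\<phi> x) < D / 8"
    using D unfolding uniformly_continuous_on_def by (metis UNIV_I divide_pos_pos zero_less_numeral)
  define d\<^sub>3 where "d\<^sub>3 = d\<^sub>1 / max K 1"
  have d\<^sub>3: "0 < d\<^sub>3" "max K 1 * d\<^sub>3 = d\<^sub>1" using d\<^sub>1(1) by (auto simp: d\<^sub>3_def)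
  have "uniformly_continuous_on UNIV \<psi>" using compact_uniformly_continuous[OF cont(2) assms(2)] .
  then obtain d\<^sub>4 where d\<^sub>4: "0 < d\<^sub>4" "\<And>x x'. dist x' x < d\<^sub>4 \<Longrightarrow> dist (\<psi> x') (\<psi> x) < d\<^sub>3"
    using d\<^sub>3(1) unfolding uniformly_continuous_on_def by (metis UNIV_I)
  obtain B where B: "\<And>y y' :: 'b. dist y y' \<le> B"
    using compact_imp_bounded[OF assms(2)] unfolding bounded_two_points by auto
  \<comment> \<open>Since distances in the target are at most \<open>B\<close>, this value forces
    the distance from \<open>\<phi> x\<close> to \<open>\<phi> b\<close> below
    \<open>d\<^sub>4\<close>.\<close>
  define H where "H = (B + 1) / d\<^sub>4"
  have B0: "0 \<le> B" using B[of u u] by simp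
  have "\<exists>a'. dist x b \<le> dist a a' \<and> dist (\<phi> x) (\<phi> a) \<le> dist (\<phi> x) (\<phi> a')"
    if xb: "x \<noteq> b" and le: "dist x a \<le> K * dist x b" and HR: "H * dist (\<phi> x) (\<phi> b) \<le> dist (\<phi> x) (\<phi> a)" for x a b
  proof -
    have "H * dist (\<phi> x) (\<phi> b) < B + 1" using HR B[of "\<phi> x" "\<phi> a"] by linarith
    then have "(B + 1) * (dist (\<phi> x) (\<phi> b) / d\<^sub>4) < (B + 1) * 1" by (simp add: H_def)
    then have "dist (\<phi> x) (\<phi> b) / d\<^sub>4 < 1" using B0 by (subst (asm) mult_less_cancel_left_pos) auto
    then have "dist (\<phi> x) (\<phi> b) < d\<^sub>4" using d\<^sub>4(1) by simp
    then have xb3: "dist x b < d\<^sub>3" using d\<^sub>4(2)[of "\<phi> x" "\<phi> b"] by simp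
    then have "max K 1 * dist x b < max K 1 * d\<^sub>3" by (intro mult_strict_left_mono) auto
    then have m: "max K 1 * dist x b < d\<^sub>1" using d\<^sub>3(2) by simp
    moreover have "K * dist x b \<le> max K 1 * dist x b" "1 * dist x b \<le> max K 1 * dist x b"
      by (intro mult_right_mono; simp)+
    ultimately have "dist x a < d\<^sub>1" "dist x b < d\<^sub>1" using le by linarith+
    then have R: "dist (\<phi> x) (\<phi> a) < D / 8" using d\<^sub>1(2)[of x a] by simp
    have "D / 2 \<le> dist (\<phi> x) u \<or> D / 2 \<le> dist (\<phi> x) v"
      using dist_triangle3[of u v "\<phi> x"] unfolding D_def by linarith
    then obtain y where y: "D / 2 \<le> dist (\<phi> x) y" by blast
    have "D / 8 \<le> dist (\<phi> a) y" using y R dist_triangle[of "\<phi> x" y "\<phi> a"] D by simp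
    then have "d\<^sub>1 \<le> dist a (\<psi> y)" using d\<^sub>1(2)[of a "\<psi> y"] by (force simp: not_less)
    then show ?thesis using y R D \<open>dist x b < d\<^sub>1\<close> by (intro exI[of _ "\<psi> y"]) simp
  qed
  then show ?thesis by blast
qed

section \<open>Comparability of stretch ratios\<close>

text \<open>In a bounded space the upper bound must be extended to radii beyond the diameter. This
  amounts to finiteness of the total mass, obtained from compactness.\<close>

lemma regular_space_of_ahlfors_regular:
  fixes M :: "'a::metric_space measure"
  assumes AR: "ahlfors_regular Q M" and M: "sets M = sets borel" and Q: "0 < Q"
    and nontriv: "\<exists>u v :: 'a. u \<noteq> v" and cpt: "bounded (UNIV :: 'a set) \<Longrightarrow> compact (UNIV :: 'a set)"
  shows "\<exists>C. regular_space M Q C"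
proof -
  let ?D = "diameter (UNIV :: 'a set)"
  obtain c where c: "1 \<le> c" "\<And>x r. 0 < r \<Longrightarrow> bounded (UNIV :: 'a set) \<longrightarrow> r < ?D \<Longrightarrow>
     ennreal (r powr Q / c) \<le> emeasure M (ball x r) \<and> emeasure M (ball x r) \<le> ennreal (c * r powr Q)"
    using AR unfolding ahlfors_regular_def by blast
  have lower: "ennreal (r powr Q / c') \<le> emeasure M (ball x r)" if "0 < r" "r < dist u v" "c \<le> c'" for x r c' and u v :: 'a
  proof -
    have "bounded (UNIV :: 'a set) \<longrightarrow> r < ?D"
      using diameter_bounded_bound[of "UNIV :: 'a set" u v] that by auto
    then have "ennreal (r powr Q / c) \<le> emeasure M (ball x r)" using c(2)[OF that(1)] by blast
    moreover have "r powr Q / c' \<le> r powr Q / c" using c(1) that by (intro divide_left_mono) auto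
    ultimately show ?thesis by (meson ennreal_leI order_trans)
  qed
  show ?thesis
  proof (cases "bounded (UNIV :: 'a set)")
    case False
    have "regular_space M Q c"
      by unfold_locales (use M Q c nontriv lower False in auto)
    then show ?thesis ..
  next
    case True
    obtain u v :: 'a where uv: "u \<noteq> v" using nontriv by blast
    have D: "0 < ?D" using diameter_bounded_bound[OF True, of u v] less_le_trans[of 0 "dist u v"] uv by simp
    \<comment> \<open>Half the diameter is used because regularity is given only for radii strictly
      below the diameter.\<close>
    have cover: "(UNIV :: 'a set) \<subseteq> (\<Union>x\<in>UNIV. ball x (?D / 2))" using D by auto
    obtain T where T: "T \<subseteq> UNIV" "finite T" "(UNIV :: 'a set) \<subseteq> (\<Union>x\<in>T. ball x (?D / 2))"
      by (rule compactE_image[OF cpt[OF True] open_ball cover])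
    have balls: "(\<lambda>x. ball x (?D / 2)) ` T \<subseteq> sets M" by (simp add: M image_subset_iff)
    have "emeasure M (\<Union>x\<in>T. ball x (?D / 2)) \<le> (\<Sum>x\<in>T. emeasure M (ball x (?D / 2)))"
      by (rule emeasure_subadditive_finite[OF T(2) balls])
    also have "\<dots> \<le> (\<Sum>x\<in>T. ennreal (c * (?D / 2) powr Q))"
      using D by (intro sum_mono) (simp add: c(2))
    also have "\<dots> < \<infinity>" by (simp add: ennreal_mult_less_top of_nat_less_top)
    finally have fin: "emeasure M UNIV < \<infinity>" using T(3) by (simp add: top.extremum_unique)
    define m where "m = measure M UNIV"
    have m: "emeasure M UNIV = ennreal m" "0 \<le> m"
      using fin by (auto simp: m_def emeasure_eq_ennreal_measure)
    define c' where "c' = max c (m / ?D powr Q)"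
    have c': "1 \<le> c'" "c \<le> c'" "m \<le> c' * ?D powr Q"
    proof -
      show "1 \<le> c'" "c \<le> c'" using c(1) by (auto simp: c'_def)
      have "m / ?D powr Q \<le> c'" by (simp add: c'_def)
      then show "m \<le> c' * ?D powr Q" using D by (simp add: pos_divide_le_eq)
    qed
    have "emeasure M (ball x r) \<le> ennreal (c' * r powr Q)" if r: "0 < r" for x r
    proof (cases "r < ?D")
      case True
      then have "emeasure M (ball x r) \<le> ennreal (c * r powr Q)" using c(2)[OF r] by blast
      also have "\<dots> \<le> ennreal (c' * r powr Q)" using c'(2) by (intro ennreal_leI mult_right_mono) auto
      finally show ?thesis .
    next
      case False
      have "emeasure M (ball x r) \<le> emeasure M UNIV"
        using sets_eq_imp_space_eq[OF M] M by (intro emeasure_mono) (auto simp: sets.top[of M, simplified])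
      also have "\<dots> \<le> ennreal (c' * ?D powr Q)" using m c'(3) by (simp add: ennreal_leI)
      also have "\<dots> \<le> ennreal (c' * r powr Q)"
        using False D c'(1) Q by (intro ennreal_leI mult_left_mono powr_mono2) auto
      finally show ?thesis .
    qed
    then have "regular_space M Q c'"
      by unfold_locales (use M Q c' nontriv lower in auto)
    then show ?thesis ..
  qed
qed

lemma powr_unbounded:
  fixes a B :: real
  assumes "0 < a" and le: "\<And>n::nat. 0 < n \<Longrightarrow> n powr a \<le> B"
  shows False
proof -
  obtain n :: nat where n: "max 1 B powr (1 / a) < n" using reals_Archimedean2 by blast
  then have "0 < real n" by (rule le_less_trans[OF powr_ge_zero])
  have "(max 1 B powr (1 / a)) powr a < n powr a" using n assms(1) by (intro powr_less_mono2) auto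
  then have "max 1 B < n powr a" using assms(1) by (simp add: powr_powr)
  then show False using le[of n] \<open>0 < real n\<close> by simp
qed

text \<open>When t is at most a multiple of r, the bound from
  \<open>besov_energy_ge_disjoint\<close> for two balls of radius r and a jump of size 1 is of the
  critical order t powr Q.\<close>

lemma (in regular_space) comparable_scale_energy:
  assumes "0 < c" "0 < t" "0 < r" "t \<le> c * r"
  shows "1 / (c powr Q * c powr Q * C * C * C) * t powr Q
    \<le> (r powr Q / C) * (r powr Q / C) * 1 / (C * t powr Q)"
proof -
  have "t powr Q \<le> (c * r) powr Q" using assms Q_pos by (intro powr_mono2) auto
  also have "\<dots> = c powr Q * r powr Q" by (rule powr_mult)
  finally have "t powr Q * t powr Q \<le> (c powr Q * r powr Q) * (c powr Q * r powr Q)" by (intro mult_mono) auto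
  then have "t powr Q * t powr Q / (c powr Q * c powr Q) \<le> r powr Q * r powr Q"
    using assms by (simp add: divide_le_eq mult_ac)
  then have "t powr Q * t powr Q / (c powr Q * c powr Q) / (C * C * C * t powr Q) \<le> r powr Q * r powr Q / (C * C * C * t powr Q)"
    using C_ge_1 by (intro divide_right_mono) auto
  then show ?thesis using assms by (simp add: field_simps)
qed

section \<open>Test functions on lacunary pairs and comparability of stretch ratios\<close>

definition stretch_ratio :: "('a::metric_space \<Rightarrow> 'b::metric_space) \<Rightarrow> 'a \<Rightarrow> 'a \<Rightarrow> real" where
  "stretch_ratio f x b = dist (f x) (f b) / dist x b"

context qs_homeo
begin

text \<open>Bumps at lacunary scales in the target with \<open>n\<close> disjoint preimages of one common scale: the
  \<open>q\<close>-th power of the norm is of order \<open>n\<close> in the target and \<open>n powr (q / p)\<close> in the domain.\<close>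

lemma stretch_ratio_comparable_if_less:
  assumes s: "0 < s" "s < 1" and p: "p = Q / s" and Q: "1 < Q" and q: "1 < q" "p < q"
    and bdd: "induced_map_bounded M N s p q f"
  shows "\<exists>L. \<forall>x b x' b'. x \<noteq> b \<longrightarrow> x' \<noteq> b' \<longrightarrow> stretch_ratio f x' b' \<le> L * stretch_ratio f x b"
proof (rule ccontr)
  assume "\<not> ?thesis"
  then have unb: "\<exists>x b x' b'. x \<noteq> b \<and> x' \<noteq> b' \<and> L * (dist (f x) (f b) / dist x b) < dist (f x') (f b') / dist x' b'" for L
    unfolding stretch_ratio_def by (metis not_le)
  have p0: "0 < p" using p s Q by simp
  obtain H where H: "1 \<le> H" "\<And>x a b. dist x a \<le> 1 * dist x b \<Longrightarrow> dist (f x) (f a) \<le> H * dist (f x) (f b)"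
    using quasisymmetricE[OF qs] by metis
  \<comment> \<open>The bumps are supported within 2 * H times an image size; \<open>G\<close>
    bounds the radius of the preimages of these supports in units of \<rho>.\<close>
  obtain G where G: "1 \<le> G" "\<And>x a b. dist x a \<le> (2 * H) * dist x b \<Longrightarrow> dist (g x) (g a) \<le> G * dist (g x) (g b)"
    using quasisymmetricE[OF quasisymmetric_inverse] by metis
  obtain u\<^sub>0 v\<^sub>0 :: 'a where uv: "u\<^sub>0 \<noteq> v\<^sub>0" using X.nontrivial by blast
  define \<rho>\<^sub>0 where "\<rho>\<^sub>0 = dist u\<^sub>0 v\<^sub>0 / (4 * (G + 2))"
  have \<rho>\<^sub>0: "0 < \<rho>\<^sub>0" using uv G(1) by (simp add: \<rho>\<^sub>0_def)
  define c where "c = 2 * (G + 4)"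
  define \<kappa> where "\<kappa> = 1 / (c powr Q * c powr Q * C * C * C)"
  have \<kappa>: "0 < \<kappa>" using X.C_ge_1 G(1) by (simp add: \<kappa>_def c_def)
  show False
  proof (rule Y.besov_norm_lacunary_bumps[OF s p Q q(1)])
    fix K\<^sub>U assume K\<^sub>U: "0 < K\<^sub>U" "\<And>n a c \<tau>. 0 \<le> a \<Longrightarrow> (\<And>k. k < n \<Longrightarrow> 0 < \<tau> k)
      \<Longrightarrow> (\<And>k. Suc k < n \<Longrightarrow> 2 * \<tau> k \<le> \<tau> (Suc k))
      \<Longrightarrow> besov_norm N s p q (\<lambda>y. a * (\<Sum>k<n. bump (c k) (\<tau> k) y)) \<le> ennpow (ennreal (K\<^sub>U * a powr q * n)) (1 / q)"
    have q0: "0 < q" using q by simp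
    show False
    proof (rule induced_map_boundedE[OF bdd Y.sets_M q0])
      fix K\<^sub>B assume K\<^sub>B: "0 < K\<^sub>B" "\<And>f' B\<^sub>1 B\<^sub>2. continuous_on UNIV f' \<Longrightarrow> 0 \<le> B\<^sub>1 \<Longrightarrow> 0 \<le> B\<^sub>2
        \<Longrightarrow> ennpow (ennreal B\<^sub>1) (1 / q) \<le> besov_norm M s p q (f' \<circ> f)
        \<Longrightarrow> besov_norm N s p q f' \<le> ennpow (ennreal B\<^sub>2) (1 / q) \<Longrightarrow> B\<^sub>1 \<le> K\<^sub>B * B\<^sub>2"
      \<comment> \<open>The preimage of the k-th support reaches G * \<rho> from \<open>u k\<close>
        and the ball about \<open>w j\<close> reaches (G + 3) * \<rho> from \<open>u j\<close>.
        Separation by (2 * G + 5) * \<rho> keeps them apart for distinct k and j.\<close>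
      have main: "(n * \<kappa>) powr (q / p) / 2 \<le> K\<^sub>B * (K\<^sub>U * 1 powr q * n)" for n :: nat
      proof (rule lacunary_pairs[OF unb \<rho>\<^sub>0, of 2 n "2 * G + 5"])
        fix \<rho> u b
        assume \<rho>: "0 < \<rho>" "\<rho> \<le> \<rho>\<^sub>0" and ub: "\<And>j. dist (u j) (b j) = \<rho>"
          and lac: "\<And>i j. i < j \<Longrightarrow> j < n \<Longrightarrow> 2 * dist (f (u i)) (f (b i)) \<le> dist (f (u j)) (f (b j))"
          and sep: "\<And>i j. i < j \<Longrightarrow> j < n \<Longrightarrow> (2 * G + 5) * \<rho> < dist (u i) (u j)"
        define \<gamma> where "\<gamma> j = dist (f (u j)) (f (b j))" for j
        have \<gamma>: "0 < \<gamma> j" for j using ub[of j] \<rho>(1) by (auto simp: \<gamma>_def)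
        have sep': "(2 * G + 5) * \<rho> < dist (u i) (u j)" if "i \<noteq> j" "i < n" "j < n" for i j
          using sep[of i j] sep[of j i] that by (cases "i < j") (auto simp: dist_commute)
        have \<rho>4: "\<rho> * (4 * (G + 2)) \<le> dist u\<^sub>0 v\<^sub>0" using \<rho>(2) G(1) by (simp add: \<rho>\<^sub>0_def pos_le_divide_eq)
        have G\<rho>: "0 < G * \<rho>" using G(1) \<rho>(1) by simp
        \<comment> \<open>A ball of radius \<rho> about such a point avoids the preimage of the j-th
          support as well. The choice of \<open>\<rho>\<^sub>0\<close> guarantees that the sphere is
          nonempty.\<close>
        have "\<exists>w. dist (u j) w = (G + 2) * \<rho>" for j
        proof (rule connected_sphere_point'[OF connected])
          show "2 * ((G + 2) * \<rho>) \<le> dist u\<^sub>0 v\<^sub>0" using \<rho>4 G\<rho> \<rho>(1) by (simp add: algebra_simps)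
        qed (use G(1) \<rho>(1) in auto)
        then obtain w where w: "\<And>j. dist (u j) (w j) = (G + 2) * \<rho>" by metis
        have \<rho>uv: "\<rho> < dist u\<^sub>0 v\<^sub>0" using \<rho>4 G\<rho> \<rho>(1) by (simp add: algebra_simps)
        define v where "v y = 1 * (\<Sum>k<n. bump (f (u k)) (H * \<gamma> k) y)" for y
        have cv: "continuous_on UNIV v" unfolding v_def by (intro continuous_intros continuous_bump)
        \<comment> \<open>The supports in the target may be nested, so \<open>v\<close> can exceed 1
          here; nonnegativity of the other bumps makes the lower bound enough.\<close>
        have v1: "1 \<le> v (f x)" if "x \<in> ball (u j) \<rho>" "j < n" for x j
        proof -
          have "dist (f (u j)) (f x) \<le> H * \<gamma> j" unfolding \<gamma>_def using that ub[of j] by (intro H(2)) simp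
          then have "bump (f (u j)) (H * \<gamma> j) (f x) = 1"
            using H(1) \<gamma>[of j] by (intro bump_eq_1) (auto simp: dist_commute)
          moreover have "bump (f (u j)) (H * \<gamma> j) (f x) \<le> (\<Sum>k<n. bump (f (u k)) (H * \<gamma> k) (f x))"
            using that(2) by (intro member_le_sum) (auto simp: bump_bounds)
          ultimately show ?thesis by (simp add: v_def)
        qed
        have v0: "v (f x) = 0" if x: "x \<in> ball (w j) \<rho>" and j: "j < n" for x j
        proof -
          have "bump (f (u k)) (H * \<gamma> k) (f x) = 0" if k: "k < n" for k
          proof (rule ccontr)
            assume "bump (f (u k)) (H * \<gamma> k) (f x) \<noteq> 0"
            moreover have "0 < H * \<gamma> k" using H(1) \<gamma>[of k] by simp
            ultimately have "\<not> 2 * (H * \<gamma> k) \<le> dist (f x) (f (u k))" using bump_eq_0 by metis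
            then have "dist (f (u k)) (f x) \<le> 2 * H * dist (f (u k)) (f (b k))" by (simp add: \<gamma>_def dist_commute)
            from G(2)[OF this] have near: "dist (u k) x \<le> G * \<rho>" by (simp add: ub)
            have xw: "dist (w j) x < \<rho>" using x by simp
            show False
            proof (cases "k = j")
              case True
              have "dist (u j) (w j) \<le> dist (u j) x + dist (w j) x" by (metis dist_commute dist_triangle)
              then show False using near xw w[of j] True \<rho>(1) by (simp add: distrib_right)
            next
              case False
              have "dist (u k) (u j) \<le> dist (u k) x + dist (w j) x + dist (u j) (w j)"
                by (smt (verit) dist_commute dist_triangle)
              then show False using near xw w[of j] sep'[OF False k j] \<rho>(1) G\<rho> by (simp add: distrib_right)
            qed
          qed
          then show ?thesis by (simp add: v_def)
        qed
        define t\<^sub>0 where "t\<^sub>0 = (G + 4) * \<rho>"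
        have t\<^sub>0: "0 < t\<^sub>0" using G(1) \<rho>(1) by (simp add: t\<^sub>0_def)
        have low: "ennreal (n * \<kappa> * t powr Q) \<le> besov_energy M p (v \<circ> f) t" if t: "t \<in> {t\<^sub>0..2 * t\<^sub>0}" for t
        proof -
          have tp: "0 < t" using t t\<^sub>0 by auto
          have "ennreal (card {..<n} * ((\<rho> powr Q / C) * (\<rho> powr Q / C) * 1 / (C * t powr Q))) \<le> besov_energy M p (v \<circ> f) t"
          proof (rule X.besov_energy_ge_disjoint[where A = "\<lambda>j. ball (u j) \<rho>" and Z = "\<lambda>j. ball (w j) \<rho>"])
            show "disjoint_family_on (\<lambda>j. ball (u j) \<rho>) {..<n}"
              unfolding disjoint_family_on_def
            proof (intro ballI impI)
              fix i j assume "i \<in> {..<n}" "j \<in> {..<n}" "i \<noteq> j"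
              then have "(2 * G + 5) * \<rho> < dist (u i) (u j)" using sep' by simp
              then have "\<rho> + \<rho> \<le> dist (u i) (u j)" using G\<rho> \<rho>(1) by (simp add: algebra_simps)
              then show "ball (u i) \<rho> \<inter> ball (u j) \<rho> = {}" by (rule disjoint_ballI)
            qed
            fix j a z assume j: "j \<in> {..<n}" and a: "a \<in> ball (u j) \<rho>" and z: "z \<in> ball (w j) \<rho>"
            have "dist a z \<le> dist (u j) a + dist (u j) (w j) + dist (w j) z"
              by (smt (verit) dist_commute dist_triangle)
            also have "\<dots> < t\<^sub>0" using a z w[of j] by (simp add: t\<^sub>0_def algebra_simps)
            finally have "dist a z < t" using t by simp
            moreover have "1 \<le> \<bar>(v \<circ> f) a - (v \<circ> f) z\<bar> powr p"
              using v1[OF a] v0[OF z] j p0 by (simp add: ge_one_powr_ge_zero)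
            ultimately show "dist a z < t \<and> 1 \<le> \<bar>(v \<circ> f) a - (v \<circ> f) z\<bar> powr p" ..
          qed (use tp X.C_ge_1 X.lower[OF \<rho>(1) \<rho>uv] in auto)
          moreover have "\<kappa> * t powr Q \<le> (\<rho> powr Q / C) * (\<rho> powr Q / C) * 1 / (C * t powr Q)"
            unfolding \<kappa>_def using t tp G(1) \<rho>(1)
            by (intro X.comparable_scale_energy) (auto simp: c_def t\<^sub>0_def algebra_simps)
          then have "n * (\<kappa> * t powr Q) \<le> n * ((\<rho> powr Q / C) * (\<rho> powr Q / C) * 1 / (C * t powr Q))"
            by (rule mult_left_mono) simp
          then have "n * \<kappa> * t powr Q \<le> card {..<n} * ((\<rho> powr Q / C) * (\<rho> powr Q / C) * 1 / (C * t powr Q))"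
            by (simp only: mult.assoc card_lessThan)
          ultimately show ?thesis by (meson ennreal_leI order_trans)
        qed
        have "ennpow (ennreal ((n * \<kappa>) powr (q / p) / 2)) (1 / q) \<le> besov_norm M s p q (v \<circ> f)"
          using low \<kappa> X.Q_pos s q0 p t\<^sub>0 by (intro besov_norm_ge_single[where T = t\<^sub>0 and Q = Q]) auto
        moreover have "besov_norm N s p q v \<le> ennpow (ennreal (K\<^sub>U * 1 powr q * n)) (1 / q)"
          unfolding v_def
        proof (rule K\<^sub>U(2))
          show "0 < H * \<gamma> k" for k using H(1) \<gamma>[of k] by simp
          show "2 * (H * \<gamma> k) \<le> H * \<gamma> (Suc k)" if "Suc k < n" for k
            using lac[of k "Suc k"] that H(1) by (simp add: \<gamma>_def mult_left_mono)
        qed simp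
        ultimately show ?thesis by (intro K\<^sub>B(2)[OF cv]) (use K\<^sub>U(1) in auto)
      qed simp
      have "n powr (q / p - 1) \<le> 2 * K\<^sub>B * K\<^sub>U / \<kappa> powr (q / p)" if "0 < n" for n :: nat
      proof -
        have "n powr (q / p) * \<kappa> powr (q / p) \<le> 2 * K\<^sub>B * K\<^sub>U * n" using main[of n] by (simp add: powr_mult)
        then show ?thesis using \<kappa> that by (simp add: powr_diff field_simps)
      qed
      then show False using q(2) p0 by (intro powr_unbounded[of "q / p - 1"]) auto
    qed
  qed
qed

text \<open>Here the bumps have a common scale in the domain, while their compositions with \<open>g\<close> live at
  lacunary scales: the orders \<open>n powr (q / p)\<close> and \<open>n\<close> are exchanged.\<close>

lemma stretch_ratio_comparable_if_greater:
  assumes s: "0 < s" "s < 1" and p: "p = Q / s" and q: "1 < q" "q < p"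
    and bdd: "induced_map_bounded N M s p q g"
  shows "\<exists>L. \<forall>x b x' b'. x \<noteq> b \<longrightarrow> x' \<noteq> b' \<longrightarrow> stretch_ratio f x' b' \<le> L * stretch_ratio f x b"
proof (rule ccontr)
  assume "\<not> ?thesis"
  then have unb: "\<exists>x b x' b'. x \<noteq> b \<and> x' \<noteq> b' \<and> L * (dist (f x) (f b) / dist x b) < dist (f x') (f b') / dist x' b'" for L
    unfolding stretch_ratio_def by (metis not_le)
  have p0: "0 < p" and q0: "0 < q" using q by auto
  have "range f = UNIV" using homeo by (simp add: homeomorphism_def)
  then have "connected (UNIV :: 'b set)"
    using connected_continuous_image[OF _ connected, of f] homeo by (simp add: homeomorphism_def)
  then interpret inv: qs_homeo N M Q C' C g f
    using homeomorphism_symD[OF homeo] quasisymmetric_inverse by unfold_locales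
  obtain H where H: "1 \<le> H" "\<And>x a b. dist x a \<le> 1 * dist x b \<Longrightarrow> dist (g x) (g a) \<le> H * dist (g x) (g b)"
    using quasisymmetricE[OF quasisymmetric_inverse] by metis
  \<comment> \<open>The bumps have support radius 2 * H * \<rho>. A further \<rho> is the tolerance
    for preimages near \<open>w j\<close>, and one more \<rho> is margin.\<close>
  define K\<^sub>2 where "K\<^sub>2 = 2 * H + 2"
  have K\<^sub>2: "1 \<le> K\<^sub>2" using H(1) by (simp add: K\<^sub>2_def)
  obtain F where F: "1 \<le> F" "\<And>x a b. dist x a \<le> K\<^sub>2 * dist x b \<Longrightarrow> dist (f x) (f a) \<le> F * dist (f x) (f b)"
    using quasisymmetricE[OF qs] by metis
  \<comment> \<open>Centred at \<open>f (w j)\<close>, this gives a ball in the target, proportional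
    to its distance from \<open>f (u j)\<close>, that \<open>g\<close> maps to within \<rho> of
    \<open>w j\<close>, since \<open>w j\<close> is K_2 * \<rho> from \<open>u j\<close>.\<close>
  obtain \<delta> where \<delta>: "0 < \<delta>" "\<And>x a b. dist x b \<le> \<delta> * dist x a \<Longrightarrow> dist (g x) (g b) \<le> 1 / K\<^sub>2 * dist (g x) (g a)"
    using inv.shrink[of "1 / K\<^sub>2"] K\<^sub>2 by (metis less_le_trans zero_less_divide_1_iff zero_less_one)
  obtain u\<^sub>0 v\<^sub>0 :: 'a where uv: "u\<^sub>0 \<noteq> v\<^sub>0" using X.nontrivial by blast
  define \<rho>\<^sub>0 where "\<rho>\<^sub>0 = dist u\<^sub>0 v\<^sub>0 / (2 * K\<^sub>2)"
  have \<rho>\<^sub>0: "0 < \<rho>\<^sub>0" using uv K\<^sub>2 by (simp add: \<rho>\<^sub>0_def)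
  \<comment> \<open>The bound 1 / 2 keeps the ball about \<open>f (u j)\<close> where the bump
    equals 1. The bound \<delta> / F makes the radius e * \<gamma> j small enough for
    \<open>\<delta>\<close> at \<open>f (w j)\<close>, as \<open>\<gamma> j\<close> is at most F
    times the distance from \<open>f (u j)\<close> to \<open>f (w j)\<close>.\<close>
  define e where "e = min (1 / 2) (\<delta> / F)"
  have e: "0 < e" "e \<le> 1 / 2" "e * F \<le> \<delta>" using \<delta>(1) F(1) by (auto simp: e_def min_def field_simps)
  define c where "c = 2 * (F + 1) / e"
  define \<kappa> where "\<kappa> = 1 / (c powr Q * c powr Q * C' * C' * C')"
  have c: "0 < c" using F(1) e by (simp add: c_def)
  have \<kappa>: "0 < \<kappa>" using Y.C_ge_1 c by (simp add: \<kappa>_def)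
  show False
  proof (rule X.besov_norm_disjoint_bumps[OF s p q(1)])
    fix K\<^sub>U assume K\<^sub>U: "0 < K\<^sub>U" "\<And>n (c :: nat \<Rightarrow> 'a) \<tau>. 0 < \<tau>
      \<Longrightarrow> (\<And>i j. i < n \<Longrightarrow> j < n \<Longrightarrow> i \<noteq> j \<Longrightarrow> 4 * \<tau> \<le> dist (c i) (c j))
      \<Longrightarrow> besov_norm M s p q (\<lambda>y. \<Sum>k<n. bump (c k) \<tau> y) \<le> ennpow (ennreal (K\<^sub>U * n powr (q / p))) (1 / q)"
    show False
    proof (rule induced_map_boundedE[OF bdd X.sets_M q0])
      fix K\<^sub>B assume K\<^sub>B: "0 < K\<^sub>B" "\<And>f' B\<^sub>1 B\<^sub>2. continuous_on UNIV f' \<Longrightarrow> 0 \<le> B\<^sub>1 \<Longrightarrow> 0 \<le> B\<^sub>2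
        \<Longrightarrow> ennpow (ennreal B\<^sub>1) (1 / q) \<le> besov_norm N s p q (f' \<circ> g)
        \<Longrightarrow> besov_norm M s p q f' \<le> ennpow (ennreal B\<^sub>2) (1 / q) \<Longrightarrow> B\<^sub>1 \<le> K\<^sub>B * B\<^sub>2"
      have main: "n * \<kappa> powr (q / p) / 2 \<le> K\<^sub>B * (K\<^sub>U * n powr (q / p))" for n :: nat
      \<comment> \<open>The ratio 3 makes the scale intervals \<open>{T j..2 * T j}\<close>
        disjoint. The separation (4 * H + 8) * \<rho> exceeds both 4 * H * \<rho>, needed for
        disjoint bumps, and (4 * H + 3) * \<rho>, needed for points near \<open>w j\<close> to avoid
        the other bumps.\<close>
      proof (rule lacunary_pairs[OF unb \<rho>\<^sub>0, of 3 n "4 * H + 8"])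
        fix \<rho> u b
        assume \<rho>: "0 < \<rho>" "\<rho> \<le> \<rho>\<^sub>0" and ub: "\<And>j. dist (u j) (b j) = \<rho>"
          and lac: "\<And>i j. i < j \<Longrightarrow> j < n \<Longrightarrow> 3 * dist (f (u i)) (f (b i)) \<le> dist (f (u j)) (f (b j))"
          and sep: "\<And>i j. i < j \<Longrightarrow> j < n \<Longrightarrow> (4 * H + 8) * \<rho> < dist (u i) (u j)"
        define \<gamma> where "\<gamma> j = dist (f (u j)) (f (b j))" for j
        have \<gamma>: "0 < \<gamma> j" for j using ub[of j] \<rho>(1) by (auto simp: \<gamma>_def)
        have sep': "(4 * H + 8) * \<rho> < dist (u i) (u j)" if "i \<noteq> j" "i < n" "j < n" for i j
          using sep[of i j] sep[of j i] that by (cases "i < j") (auto simp: dist_commute)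
        have H\<rho>: "0 < H * \<rho>" using H(1) \<rho>(1) by simp
        have "\<exists>w. dist (u j) w = K\<^sub>2 * \<rho>" for j
        proof (rule connected_sphere_point'[OF connected])
          show "2 * (K\<^sub>2 * \<rho>) \<le> dist u\<^sub>0 v\<^sub>0" using \<rho>(2) K\<^sub>2 by (simp add: \<rho>\<^sub>0_def pos_le_divide_eq mult_ac)
        qed (use K\<^sub>2 \<rho>(1) in auto)
        then obtain w where w: "\<And>j. dist (u j) (w j) = K\<^sub>2 * \<rho>" by metis
        define v where "v y = (\<Sum>k<n. bump (u k) (H * \<rho>) y)" for y
        have cv: "continuous_on UNIV v" unfolding v_def by (intro continuous_intros continuous_bump)
        define r where "r j = e * \<gamma> j" for j
        have r: "0 < r j" "r j \<le> \<gamma> j / 2" for j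
          using e \<gamma>[of j] mult_right_mono[OF e(2), of "\<gamma> j"] by (auto simp: r_def)
        have v1: "1 \<le> v (g z)" if "z \<in> ball (f (u j)) (r j)" "j < n" for z j
        proof -
          have "dist (f (u j)) z \<le> 1 * dist (f (u j)) (f (b j))" using that r[of j] \<gamma>[of j] by (simp add: \<gamma>_def)
          from H(2)[OF this] have "dist (u j) (g z) \<le> H * \<rho>" by (simp add: ub)
          then have "dist (g z) (u j) \<le> H * \<rho>" by (simp add: dist_commute)
          then have "bump (u j) (H * \<rho>) (g z) = 1" using H\<rho> by (intro bump_eq_1)
          moreover have "bump (u j) (H * \<rho>) (g z) \<le> (\<Sum>k<n. bump (u k) (H * \<rho>) (g z))"
            using that(2) by (intro member_le_sum) (auto simp: bump_bounds)
          ultimately show ?thesis by (simp add: v_def)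
        qed
        have v0: "v (g z) = 0" if z: "z \<in> ball (f (w j)) (r j)" and j: "j < n" for z j
        proof -
          have "\<rho> \<le> K\<^sub>2 * (K\<^sub>2 * \<rho>)" using K\<^sub>2 \<rho>(1) mult_mono[of 1 K\<^sub>2 1 K\<^sub>2] by (simp flip: mult.assoc)
          then have "\<gamma> j \<le> F * dist (f (u j)) (f (w j))" unfolding \<gamma>_def using ub w by (intro F(2)) simp
          then have "e * \<gamma> j \<le> e * (F * dist (f (u j)) (f (w j)))" using e by (intro mult_left_mono) auto
          also have "\<dots> \<le> \<delta> * dist (f (u j)) (f (w j))"
            using mult_right_mono[OF e(3), of "dist (f (u j)) (f (w j))"] by (simp add: mult_ac)
          finally have "dist (f (w j)) z \<le> \<delta> * dist (f (w j)) (f (u j))" using z by (simp add: r_def dist_commute)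
          from \<delta>(2)[OF this] have zw: "dist (w j) (g z) \<le> \<rho>" using w[of j] K\<^sub>2 by (simp add: dist_commute)
          have "bump (u k) (H * \<rho>) (g z) = 0" if k: "k < n" for k
          proof (rule bump_eq_0[OF H\<rho>])
            show "2 * (H * \<rho>) \<le> dist (g z) (u k)"
            proof (cases "k = j")
              case True
              have "dist (u j) (w j) \<le> dist (g z) (u j) + dist (w j) (g z)" by (metis dist_commute dist_triangle)
              then show ?thesis using zw w[of j] True \<rho>(1) by (simp add: K\<^sub>2_def distrib_right)
            next
              case False
              have "dist (u k) (u j) \<le> dist (g z) (u k) + dist (w j) (g z) + dist (u j) (w j)"
                by (smt (verit) dist_commute dist_triangle)
              then show ?thesis using zw w[of j] sep'[OF False k j] \<rho>(1) H\<rho> by (simp add: K\<^sub>2_def distrib_right)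
            qed
          qed
          then show ?thesis by (simp add: v_def)
        qed
        define T where "T j = (F + 1) * \<gamma> j" for j
        have T: "0 < T j" for j using F(1) \<gamma>[of j] by (simp add: T_def)
        have low: "ennreal (\<kappa> * t powr Q) \<le> besov_energy N p (v \<circ> g) t" if j: "j \<in> {..<n}" and t: "t \<in> {T j..2 * T j}" for j t
        proof -
          have tp: "0 < t" using t T[of j] by auto
          have rj: "r j < dist (f (u j)) (f (b j))" using r[of j] \<gamma>[of j] by (simp add: \<gamma>_def)
          \<comment> \<open>At this scale only the j-th pair of balls is used, hence a one-element
            index set; the factor n arises from the n disjoint scale intervals.\<close>
          have "ennreal (card {()} * ((r j powr Q / C') * (r j powr Q / C') * 1 / (C' * t powr Q))) \<le> besov_energy N p (v \<circ> g) t"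
          proof (rule Y.besov_energy_ge_disjoint[where A = "\<lambda>_. ball (f (u j)) (r j)" and Z = "\<lambda>_. ball (f (w j)) (r j)"])
            fix a z assume a: "a \<in> ball (f (u j)) (r j)" and z: "z \<in> ball (f (w j)) (r j)"
            have "dist a z \<le> dist (f (u j)) a + dist (f (u j)) (f (w j)) + dist (f (w j)) z"
              by (smt (verit) dist_commute dist_triangle)
            also have "dist (f (u j)) (f (w j)) \<le> F * \<gamma> j" unfolding \<gamma>_def using ub w by (intro F(2)) simp
            finally have "dist a z < r j + F * \<gamma> j + r j" using a z by simp
            also have "\<dots> \<le> T j" using r(2)[of j] by (simp add: T_def algebra_simps)
            finally have "dist a z < t" using t by simp
            moreover have "1 \<le> \<bar>(v \<circ> g) a - (v \<circ> g) z\<bar> powr p"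
              using v1[OF a] v0[OF z] j p0 by (simp add: ge_one_powr_ge_zero)
            ultimately show "dist a z < t \<and> 1 \<le> \<bar>(v \<circ> g) a - (v \<circ> g) z\<bar> powr p" ..
          qed (use tp Y.C_ge_1 Y.lower[OF r(1) rj] in \<open>auto simp: disjoint_family_on_def\<close>)
          moreover have "\<kappa> * t powr Q \<le> (r j powr Q / C') * (r j powr Q / C') * 1 / (C' * t powr Q)"
            unfolding \<kappa>_def
          proof (rule Y.comparable_scale_energy[OF c tp r(1)])
            have "c * r j = 2 * T j" using e by (simp add: c_def T_def r_def)
            then show "t \<le> c * r j" using t by simp
          qed
          ultimately show ?thesis by (simp add: order_trans[OF ennreal_leI])
        qed
        have gap: "2 * T i < T j" if "i < j" "j < n" for i j
        proof -
          have "(F + 1) * (3 * \<gamma> i) \<le> (F + 1) * \<gamma> j" using lac[OF that] F(1) unfolding \<gamma>_def by (intro mult_left_mono) auto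
          then show ?thesis using T[of i] by (simp add: T_def)
        qed
        have "ennpow (ennreal (card {..<n} * \<kappa> powr (q / p) / 2)) (1 / q) \<le> besov_norm N s p q (v \<circ> g)"
        proof (rule besov_norm_ge[where T = T])
          show "disjoint_family_on (\<lambda>i. {T i..2 * T i}) {..<n}"
            unfolding disjoint_family_on_def
          proof (intro ballI impI)
            fix i j assume "i \<in> {..<n}" "j \<in> {..<n}" "i \<noteq> j"
            then have "2 * T i < T j \<or> 2 * T j < T i" using gap[of i j] gap[of j i] by (cases "i < j") auto
            then show "{T i..2 * T i} \<inter> {T j..2 * T j} = {}" by auto
          qed
        qed (use low \<kappa> X.Q_pos s q0 p T in auto)
        moreover have "besov_norm M s p q v \<le> ennpow (ennreal (K\<^sub>U * n powr (q / p))) (1 / q)"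
          unfolding v_def
        proof (rule K\<^sub>U(2)[OF H\<rho>])
          fix i j assume "i < n" "j < n" "i \<noteq> j"
          then have "(4 * H + 8) * \<rho> < dist (u i) (u j)" using sep' by simp
          then show "4 * (H * \<rho>) \<le> dist (u i) (u j)" using \<rho>(1) by (simp add: distrib_right)
        qed
        ultimately show ?thesis by (intro K\<^sub>B(2)[OF cv]) (use K\<^sub>U(1) \<kappa> in auto)
      qed simp
      have "n powr (1 - q / p) \<le> 2 * K\<^sub>B * K\<^sub>U / \<kappa> powr (q / p)" if "0 < n" for n :: nat
      proof -
        have "n * \<kappa> powr (q / p) \<le> 2 * K\<^sub>B * K\<^sub>U * n powr (q / p)" using main[of n] by simp
        then show ?thesis using \<kappa> that by (simp add: powr_diff field_simps)
      qed
      then show False using q p0 by (intro powr_unbounded[of "1 - q / p"]) auto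
    qed
  qed
qed

end

section \<open>From comparable stretch ratios to the bi-Lipschitz conclusion\<close>

lemma bi_lipschitz_of_comparable_stretch:
  fixes f :: "'a::metric_space \<Rightarrow> 'b::metric_space"
  assumes "inj f" "\<exists>u v :: 'a. u \<noteq> v"
    and cmp: "\<And>x b x' b'. x \<noteq> b \<Longrightarrow> x' \<noteq> b' \<Longrightarrow> stretch_ratio f x' b' \<le> L * stretch_ratio f x b"
  shows "bi_lipschitz f"
proof -
  obtain u v :: 'a where uv: "u \<noteq> v" using assms(2) by blast
  define a where "a = stretch_ratio f u v"
  have a: "0 < a" using uv assms(1) by (simp add: a_def stretch_ratio_def inj_eq)
  have "a \<le> L * a" unfolding a_def by (rule cmp[OF uv uv])
  then have L: "1 \<le> L" using a by simp
  define B where "B = max 1 (max (L * a) (L / a))"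
  have B: "1 \<le> B" "L * a \<le> B" "L / a \<le> B" by (auto simp: B_def)
  have "dist x y / B \<le> dist (f x) (f y) \<and> dist (f x) (f y) \<le> B * dist x y" for x y
  proof (cases "x = y")
    case False
    then have xy: "0 < dist x y" by simp
    have "stretch_ratio f x y \<le> B" using cmp[OF uv False] B(2) by (simp add: a_def)
    then have up: "dist (f x) (f y) \<le> B * dist x y" using xy by (simp add: stretch_ratio_def pos_divide_le_eq)
    have "a \<le> L * stretch_ratio f x y" unfolding a_def by (rule cmp[OF False uv])
    then have "1 \<le> L / a * stretch_ratio f x y" using a by (simp add: field_simps)
    also have "\<dots> \<le> B * stretch_ratio f x y" using B(3) by (intro mult_right_mono) (auto simp: stretch_ratio_def)
    finally have "1 * dist x y \<le> B * stretch_ratio f x y * dist x y" using xy by (intro mult_right_mono) auto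
    then have "dist x y \<le> B * dist (f x) (f y)" using xy by (simp add: stretch_ratio_def)
    then show ?thesis using up B(1) by (simp add: pos_divide_le_eq mult.commute)
  qed simp
  then show ?thesis unfolding bi_lipschitz_def using B(1) by blast
qed

theorem theorem3p6:
  fixes \<mu> :: "'a::metric_space measure" and \<nu> :: "'b::metric_space measure"
    and \<phi> :: "'a \<Rightarrow> 'b" and Q s q :: real
  assumes "Q > 1"
    and "sets \<mu> = sets borel" and "sets \<nu> = sets borel"
    and "proper_metric TYPE('a)" and "quasiconvex TYPE('a)"
    and "ahlfors_regular Q \<mu>" and "weak_poincare Q \<mu>"
    and "path_connected (UNIV :: 'b set)" and "ahlfors_regular Q \<nu>"
    and "locally compact (UNIV :: 'b set)" and "linearly_locally_connected TYPE('b)"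
    and "bounded (UNIV :: 'a set) \<longleftrightarrow> bounded (UNIV :: 'b set)"
    and "\<exists>\<psi>. homeomorphism UNIV UNIV \<phi> \<psi>"
    and "0 < s" and "s < 1" and "1 < q" and "q \<noteq> Q / s"
    and "induced_map_bounded \<mu> \<nu> s (Q / s) q \<phi>"
    and "\<And>A. bounded A \<Longrightarrow> bounded (\<phi> ` A)"
  shows "bi_lipschitz \<phi>"
proof (cases "\<exists>u v :: 'a. u \<noteq> v")
  \<comment> \<open>A one-point space is treated apart because \<open>regular_space\<close> contains
    two distinct points.\<close>
  case False
  then have "x = y" for x y :: 'a by metis
  then have "dist x y / 1 \<le> dist (\<phi> x) (\<phi> y) \<and> dist (\<phi> x) (\<phi> y) \<le> 1 * dist x y" for x y
    by (metis dist_self div_0 mult_zero_right order_refl)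
  then show ?thesis unfolding bi_lipschitz_def by (intro exI[of _ 1]) simp
next
  case nontrivX: True
  obtain \<psi> where hom: "homeomorphism UNIV UNIV \<phi> \<psi>" using assms(13) by blast
  have h: "\<psi> (\<phi> x) = x" "\<phi> (\<psi> y) = y" and surj: "range \<phi> = UNIV" "range \<psi> = UNIV"
    and cont: "continuous_on UNIV \<phi>" "continuous_on UNIV \<psi>" for x y
    using hom by (auto simp: homeomorphism_def)
  have inj: "inj \<phi>" by (metis h(1) injI)
  have nontrivY: "\<exists>u v :: 'b. u \<noteq> v" using nontrivX h(1) by metis
  have cptX: "compact (UNIV :: 'a set)" if bX: "bounded (UNIV :: 'a set)"
  proof -
    obtain x :: 'a and r where "\<forall>y. dist x y \<le> r" using bX unfolding bounded_def by auto
    then have "UNIV = cball x r" by auto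
    then show ?thesis using assms(4) by (metis proper_metric_def)
  qed
  have cptY: "compact (UNIV :: 'b set)" if "bounded (UNIV :: 'b set)"
    using compact_continuous_image[OF cont(1) cptX] that assms(12) surj by simp
  have Q0: "0 < Q" using assms(1) by simp
  obtain C where X: "regular_space \<mu> Q C"
    using regular_space_of_ahlfors_regular[OF assms(6,2) Q0 nontrivX cptX] by blast
  obtain C' where Y: "regular_space \<nu> Q C'"
    using regular_space_of_ahlfors_regular[OF assms(9,3) Q0 nontrivY cptY] by blast
  have connY: "connected (UNIV :: 'b set)" using assms(8) by (rule path_connected_imp_connected)
  then have connX: "connected (UNIV :: 'a set)" using connected_continuous_image[OF cont(2)] surj by simp
  have qs: "quasisymmetric \<phi>"
  proof (rule quasisymmetric_of_bounded_composition[OF X Y assms(1) hom assms(11,14,15,16) refl assms(18)])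
    fix K
    show "\<exists>H. \<forall>x a b. x \<noteq> b \<longrightarrow> dist x a \<le> K * dist x b \<longrightarrow> H * dist (\<phi> x) (\<phi> b) \<le> dist (\<phi> x) (\<phi> a)
      \<longrightarrow> (\<exists>a'. dist x b \<le> dist a a' \<and> dist (\<phi> x) (\<phi> a) \<le> dist (\<phi> x) (\<phi> a'))"
    proof (cases "bounded (UNIV :: 'b set)")
      case True
      then have "bounded (UNIV :: 'a set)" using assms(12) by simp
      then show ?thesis by (intro far_point_compact[OF cptX cptY[OF True] hom nontrivY])
    next
      case False
      then show ?thesis using far_point_unbounded[OF surj(1) False assms(19)] by blast
    qed
  qed
  interpret Xr: regular_space \<mu> Q C by (rule X)
  interpret Yr: regular_space \<nu> Q C' by (rule Y)
  interpret \<phi>: qs_homeo \<mu> \<nu> Q C C' \<phi> \<psi> using hom connX qs by unfold_locales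
  interpret \<psi>: qs_homeo \<nu> \<mu> Q C' C \<psi> \<phi>
    using homeomorphism_symD[OF hom] connY \<phi>.quasisymmetric_inverse by unfold_locales
  have "\<exists>L. \<forall>x b x' b'. x \<noteq> b \<longrightarrow> x' \<noteq> b' \<longrightarrow> stretch_ratio \<phi> x' b' \<le> L * stretch_ratio \<phi> x b"
  proof (cases "Q / s < q")
    case True
    then show ?thesis
      by (intro \<phi>.stretch_ratio_comparable_if_less[OF assms(14,15) refl assms(1,16) _ assms(18)])
  next
    case False
    then have "q < Q / s" using assms(17) by simp
    \<comment> \<open>The lemma is applied to \<psi>, whose inverse \<phi> carries the bounded
      composition: bumps of common radius now sit in the target of \<phi>. Stretch ratios of \<psi>
      are reciprocals of those of \<phi>, so the pairs change places.\<close>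
    then obtain L where L: "\<And>y b y' b'. y \<noteq> b \<Longrightarrow> y' \<noteq> b' \<Longrightarrow> stretch_ratio \<psi> y' b' \<le> L * stretch_ratio \<psi> y b"
      using \<psi>.stretch_ratio_comparable_if_greater[OF assms(14,15) refl assms(16) _ assms(18)] by blast
    have inv: "stretch_ratio \<psi> (\<phi> x) (\<phi> b) = 1 / stretch_ratio \<phi> x b" for x b
      by (simp add: stretch_ratio_def)
    have "stretch_ratio \<phi> x' b' \<le> L * stretch_ratio \<phi> x b" if "x \<noteq> b" "x' \<noteq> b'" for x b x' b'
    proof -
      have "1 / stretch_ratio \<phi> x b \<le> L * (1 / stretch_ratio \<phi> x' b')"
        using L[of "\<phi> x'" "\<phi> b'" "\<phi> x" "\<phi> b"] that by (simp only: inv \<phi>.f_eq_iff simp_thms)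
      moreover have "0 < stretch_ratio \<phi> x b" "0 < stretch_ratio \<phi> x' b'"
        using that by (simp_all add: stretch_ratio_def)
      ultimately show ?thesis by (simp add: field_simps)
    qed
    then show ?thesis by blast
  qed
  then show ?thesis using bi_lipschitz_of_comparable_stretch[OF inj nontrivX] by blast
qed

end
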